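(* Let $F(X)$ be the free group on a finite set $X$ and let $K$ be a finitely generated subgroup of $F(X)$. Let $M$ be the unique minimal element (with respect to inclusion) among the algebraic extensions of $K$ which are isolated in $F(X)$ (such an $M$ exists). Then $iso(K)=M$. In particular, $iso(K)$ is finitely generated, the extension $K\le iso(K)$ is algebraic, and $rk(iso(K))\le rk(K)$. Moreover, there exists an algorithm which, given a finite generating set of $K$, produces a free basis of $iso(K)$.
   Context: Let $K \le H \le F(X)$. $H$ is a free extension of $K$ if there are subgroups $C \ne 1$ and $K'$ of $F(X)$ such that $K \le K'$ and $H = K' * C$ (internal free product). If $K \le H$ is not a free extension, it is called an algebraic extension. A subgroup $H$ of a group $G$ is isolated in $G$ if whenever $g\in G$, $n>0$ and $g^n\in H$, we also have $g\in H$. For a finitely generated $K\le F(X)$, the isolator is $$iso(K)=\bigcap\{H \mid K\le H\le F(X),\ H \text{ isolated in } F(X)\}.$$ $rk$ denotes the rank of a finitely generated free group (the cardinality of any free basis). *)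

theory Defs
  imports "HOL-Algebra.Generated_Groups" "HOL-Library.Nat_Bijection"
begin

section \<open>Free groups\<close>

text \<open>
  The letter \<open>(x, True)\<close> stands for the generator \<open>x\<close> and \<open>(x, False)\<close> for its formal inverse.
  The elements of the free group are the reduced words.
\<close>

type_synonym 'a letter = "'a \<times> bool"
type_synonym 'a word = "'a letter list"

definition inv_letter :: "'a letter \<Rightarrow> 'a letter" where
  "inv_letter l = (fst l, \<not> snd l)"

definition reduced :: "'a word \<Rightarrow> bool" where
  "reduced = successively (\<lambda>l m. m \<noteq> inv_letter l)"

text \<open>Multiplication of a reduced word by a letter on the left, followed by cancellation.\<close>

fun cons_cancel :: "'a letter \<Rightarrow> 'a word \<Rightarrow> 'a word" where
  "cons_cancel l [] = [l]"
| "cons_cancel l (m # w) = (if m = inv_letter l then w else l # m # w)"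

definition free_group :: "'a set \<Rightarrow> 'a word monoid" where
  "free_group X =
     \<lparr>carrier = {w. fst ` set w \<subseteq> X \<and> reduced w},
      mult = foldr cons_cancel,
      one = []\<rparr>"

lemma inv_letter_inv_letter [simp]: "inv_letter (inv_letter l) = l"
  by (simp add: inv_letter_def)

lemma fst_inv_letter [simp]: "fst (inv_letter l) = fst l"
  by (simp add: inv_letter_def)

lemma reduced_cons_cancel: "reduced w \<Longrightarrow> reduced (cons_cancel l w)"
  by (cases w) (auto simp: reduced_def successively_Cons)

lemma reduced_foldr: "reduced v \<Longrightarrow> reduced (foldr cons_cancel u v)"
  by (induction u) (auto intro: reduced_cons_cancel)

lemma set_cons_cancel: "set (cons_cancel l w) \<subseteq> insert l (set w)"
  by (cases w) auto

lemma set_foldr_cons_cancel: "set (foldr cons_cancel u v) \<subseteq> set u \<union> set v"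
proof (induction u)
  case (Cons l u)
  then show ?case using set_cons_cancel[of l "foldr cons_cancel u v"] by auto
qed simp

lemma cons_cancel_inv: 
  assumes "reduced w" shows "cons_cancel l (cons_cancel (inv_letter l) w) = w"
proof (cases w)
  case (Cons m v)
  then show ?thesis using assms by (cases v) (auto simp: reduced_def)
qed simp

lemma foldr_cons_cancel_assoc:
  assumes "reduced w"
  shows "foldr cons_cancel (foldr cons_cancel u v) w =
         foldr cons_cancel u (foldr cons_cancel v w)"
proof (induction u)
  case (Cons l u)
  have *: "foldr cons_cancel (cons_cancel l v') w = cons_cancel l (foldr cons_cancel v' w)" for v'
    by (cases v') (use assms in \<open>auto simp: cons_cancel_inv reduced_foldr\<close>)
  show ?case using Cons by (simp add: *)
qed simp

lemma foldr_cons_cancel_Nil: "reduced w \<Longrightarrow> foldr cons_cancel w [] = w"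
proof (induction w)
  case (Cons l w)
  then show ?case by (cases w) (auto simp: reduced_def)
qed simp

lemma foldr_cons_cancel_inverse:
  "reduced w \<Longrightarrow> foldr cons_cancel (foldr cons_cancel (rev (map inv_letter w)) []) w = []"
proof (induction w)
  case (Cons l w)
  have w: "reduced w" using Cons.prems by (auto simp: reduced_def successively_Cons)
  have "foldr cons_cancel (foldr cons_cancel (rev (map inv_letter (l # w))) []) (l # w) =
        foldr cons_cancel (rev (map inv_letter w)) (cons_cancel (inv_letter l) (l # w))"
    using foldr_cons_cancel_assoc[OF Cons.prems, of "rev (map inv_letter (l # w))" "[]"] by simp
  also have "\<dots> = foldr cons_cancel (foldr cons_cancel (rev (map inv_letter w)) []) w"
    using foldr_cons_cancel_assoc[OF w, of "rev (map inv_letter w)" "[]"] by simp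
  finally show ?case using Cons.IH[OF w] by simp
qed simp

lemma group_free_group: "group (free_group X)"
proof (rule groupI)
  fix u v assume uv: "u \<in> carrier (free_group X)" "v \<in> carrier (free_group X)"
  have "fst ` set (foldr cons_cancel u v) \<subseteq> fst ` set u \<union> fst ` set v"
    using image_mono[OF set_foldr_cons_cancel[of u v], of fst] by (simp only: image_Un)
  also have "\<dots> \<subseteq> X" using uv by (simp add: free_group_def)
  finally show "u \<otimes>\<^bsub>free_group X\<^esub> v \<in> carrier (free_group X)"
    using uv by (simp add: free_group_def reduced_foldr)
next
  fix w assume w: "w \<in> carrier (free_group X)"
  let ?v = "foldr cons_cancel (rev (map inv_letter w)) []"
  have "fst ` set ?v \<subseteq> fst ` set w"
    using image_mono[OF set_foldr_cons_cancel[of "rev (map inv_letter w)" "[]"], of fst] 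
    by (simp add: image_image)
  moreover have "reduced ?v" by (rule reduced_foldr) (simp add: reduced_def)
  ultimately have "?v \<in> carrier (free_group X)" using w by (auto simp: free_group_def)
  then show "\<exists>v\<in>carrier (free_group X). v \<otimes>\<^bsub>free_group X\<^esub> w = \<one>\<^bsub>free_group X\<^esub>"
    using w foldr_cons_cancel_inverse[of w] by (intro bexI[of _ ?v]) (auto simp: free_group_def)
qed (auto simp: free_group_def foldr_cons_cancel_assoc, simp add: reduced_def)


section \<open>Free bases and rank\<close>

definition eval_word :: "('g, 'm) monoid_scheme \<Rightarrow> 'g word \<Rightarrow> 'g" where
  "eval_word G w =
     foldr (\<lambda>l y. (if snd l then fst l else inv\<^bsub>G\<^esub> fst l) \<otimes>\<^bsub>G\<^esub> y) w \<one>\<^bsub>G\<^esub>"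

text \<open>
  \<open>B\<close> is a free basis of the subgroup \<open>H\<close> of \<open>G\<close> if the canonical map from the
  free group on \<open>B\<close> to \<open>H\<close> is an isomorphism.
\<close>

definition free_basis :: "('g, 'm) monoid_scheme \<Rightarrow> 'g set \<Rightarrow> 'g set \<Rightarrow> bool" where
  "free_basis G H B \<longleftrightarrow>
     subgroup H G \<and> B \<subseteq> H \<and> eval_word G \<in> Group.iso (free_group B) (G\<lparr>carrier := H\<rparr>)"

text \<open>Only meaningful if \<open>H\<close> has a finite free basis.\<close>

definition rk :: "('g, 'm) monoid_scheme \<Rightarrow> 'g set \<Rightarrow> nat" where
  "rk G H = (THE n. \<exists>B. free_basis G H B \<and> finite B \<and> card B = n)"


section \<open>Extensions of subgroups\<close>

definition fin_gen_subgroup :: "('g, 'm) monoid_scheme \<Rightarrow> 'g set \<Rightarrow> bool" where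
  "fin_gen_subgroup G H \<longleftrightarrow> (\<exists>S. finite S \<and> S \<subseteq> carrier G \<and> H = generate G S)"

text \<open>
  The internal free product \<open>H = A * B\<close>: the subgroups \<open>A\<close> and \<open>B\<close> generate \<open>H\<close>, and no nonempty
  product of nontrivial elements taken alternately from \<open>A\<close> and \<open>B\<close> is trivial.
  The Boolean component records the factor from which an element is taken;
  alternating words of length two give \<open>A \<inter> B = {\<one>}\<close>.
\<close>

definition alternating :: "('g, 'm) monoid_scheme \<Rightarrow> 'g set \<Rightarrow> 'g set \<Rightarrow> (bool \<times> 'g) list \<Rightarrow> bool" where
  "alternating G A B ps \<longleftrightarrow>
     (\<forall>(i, g)\<in>set ps. g \<in> (if i then A else B) - {\<one>\<^bsub>G\<^esub>}) \<and>
     successively (\<lambda>p q. fst p \<noteq> fst q) ps"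

definition internal_free_product ::
    "('g, 'm) monoid_scheme \<Rightarrow> 'g set \<Rightarrow> 'g set \<Rightarrow> 'g set \<Rightarrow> bool" where
  "internal_free_product G H A B \<longleftrightarrow>
     subgroup A G \<and> subgroup B G \<and> H = generate G (A \<union> B) \<and>
     (\<forall>ps. alternating G A B ps \<and> ps \<noteq> [] \<longrightarrow>
           foldr (\<lambda>p y. snd p \<otimes>\<^bsub>G\<^esub> y) ps \<one>\<^bsub>G\<^esub> \<noteq> \<one>\<^bsub>G\<^esub>)"

definition free_extension :: "('g, 'm) monoid_scheme \<Rightarrow> 'g set \<Rightarrow> 'g set \<Rightarrow> bool" where
  "free_extension G K H \<longleftrightarrow>
     subgroup K G \<and> subgroup H G \<and> K \<subseteq> H \<and>
     (\<exists>C K'. subgroup C G \<and> subgroup K' G \<and> C \<noteq> {\<one>\<^bsub>G\<^esub>} \<and> K \<subseteq> K' \<and>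
             internal_free_product G H K' C)"

definition algebraic_extension :: "('g, 'm) monoid_scheme \<Rightarrow> 'g set \<Rightarrow> 'g set \<Rightarrow> bool" where
  "algebraic_extension G K H \<longleftrightarrow>
     subgroup K G \<and> subgroup H G \<and> K \<subseteq> H \<and> \<not> free_extension G K H"

definition isolated :: "('g, 'm) monoid_scheme \<Rightarrow> 'g set \<Rightarrow> bool" where
  "isolated G H \<longleftrightarrow>
     subgroup H G \<and> (\<forall>g\<in>carrier G. \<forall>n::nat. n > 0 \<and> g [^]\<^bsub>G\<^esub> n \<in> H \<longrightarrow> g \<in> H)"

definition isolator :: "('g, 'm) monoid_scheme \<Rightarrow> 'g set \<Rightarrow> 'g set" where
  "isolator G K = \<Inter>{H. K \<subseteq> H \<and> subgroup H G \<and> isolated G H}"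

definition minimal_isolated_algebraic ::
    "('g, 'm) monoid_scheme \<Rightarrow> 'g set \<Rightarrow> 'g set \<Rightarrow> bool" where
  "minimal_isolated_algebraic G K M \<longleftrightarrow>
     algebraic_extension G K M \<and> isolated G M \<and>
     (\<forall>N. algebraic_extension G K N \<and> isolated G N \<and> N \<subseteq> M \<longrightarrow> N = M)"


section \<open>Algorithms\<close>

text \<open>
  Algorithms are descriptions of partial recursive functions; \<open>computes p xs y\<close> means that
  \<open>p\<close> halts on the arguments \<open>xs\<close> with output \<open>y\<close>.
\<close>

datatype recf =
    Zero
  | Succ
  | Proj nat
  | Comp recf "recf list"
  | PrimRec recf recf
  | Mu recf

inductive computes :: "recf \<Rightarrow> nat list \<Rightarrow> nat \<Rightarrow> bool" where
  computes_Zero: "computes Zero xs 0"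
| computes_Succ: "computes Succ [x] (Suc x)"
| computes_Proj: "i < length xs \<Longrightarrow> computes (Proj i) xs (xs ! i)"
| computes_Comp: "length zs = length gs \<Longrightarrow> (\<forall>i<length gs. computes (gs ! i) xs (zs ! i)) \<Longrightarrow>
    computes f zs y \<Longrightarrow> computes (Comp f gs) xs y"
| computes_PrimRec_0: "computes f xs y \<Longrightarrow> computes (PrimRec f g) (0 # xs) y"
| computes_PrimRec_Suc: "computes (PrimRec f g) (n # xs) z \<Longrightarrow> computes g (n # z # xs) y \<Longrightarrow>
    computes (PrimRec f g) (Suc n # xs) y"
| computes_Mu: "computes f (n # xs) 0 \<Longrightarrow> (\<forall>m<n. \<exists>z>0. computes f (m # xs) z) \<Longrightarrow>
    computes (Mu f) xs n"

lemma computes_deterministic: "computes p xs y \<Longrightarrow> computes p xs y' \<Longrightarrow> y = y'"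
proof (induction arbitrary: y' rule: computes.induct)
  case (computes_Zero xs)
  then show ?case by cases simp
next
  case (computes_Succ x)
  then show ?case by cases simp
next
  case (computes_Proj i xs)
  from computes_Proj.prems show ?case by cases simp
next
  case (computes_Comp zs gs xs f y)
  from computes_Comp.prems show ?case
  proof cases
    case prems: (computes_Comp zs')
    have "zs = zs'"
    proof (rule nth_equalityI)
      show "length zs = length zs'"
        using \<open>length zs = length gs\<close> prems(1) by simp
      show "zs ! i = zs' ! i" if "i < length zs" for i
        using computes_Comp.IH(1) \<open>length zs = length gs\<close> prems(2) that by simp
    qed
    then show ?thesis using computes_Comp.IH(2) prems(3) by simp
  qed
next
  case (computes_PrimRec_0 f xs y g)
  from computes_PrimRec_0.prems show ?case
    by cases (rule computes_PrimRec_0.IH)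
next
  case (computes_PrimRec_Suc f g n xs z y)
  from computes_PrimRec_Suc.prems show ?case
  proof cases
    case prems: (computes_PrimRec_Suc z')
    from prems have "z = z'" by (intro computes_PrimRec_Suc.IH(1))
    with prems show ?thesis by (intro computes_PrimRec_Suc.IH(2)) simp
  qed
next
  case (computes_Mu f n xs)
  from computes_Mu.prems show ?case
  proof cases
    case prems: computes_Mu
    show ?thesis
    proof (rule linorder_cases[of n y'])
      assume "n < y'"
      then obtain z where "z > 0" "computes f (n # xs) z" using prems(2) by blast
      then show ?thesis using computes_Mu.IH(1)[of z] by simp
    next
      assume "y' < n"
      then obtain z where "z > 0" "\<forall>x. computes f (y' # xs) x \<longrightarrow> z = x"
        using computes_Mu.IH(2) by blast
      then show ?thesis using prems(1) by auto
    qed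
  qed
qed

text \<open>
  Words and finite lists of words are input and output as natural numbers; \<open>e\<close> is a numbering of
  the generators.
\<close>

definition word_code :: "('a \<Rightarrow> nat) \<Rightarrow> 'a word \<Rightarrow> nat" where
  "word_code e w = list_encode (map (\<lambda>l. 2 * e (fst l) + (if snd l then 0 else 1)) w)"

definition words_code :: "('a \<Rightarrow> nat) \<Rightarrow> 'a word list \<Rightarrow> nat" where
  "words_code e ws = list_encode (map (word_code e) ws)"

end

(*
  Subgroups of F(X) are fundamental groups of coset graphs. Let I = iso(K). The part of the coset
  graph of I traversed by the generators of K is finite, and its fundamental group L is isolated
  in I because the reduced form of w^n passes through all edges of the loop w; hence L = I, and a
  spanning tree gives a finite free basis. A free factor of I containing K is malnormal, hence
  isolated, hence equal to I, so I is algebraic over K. As I lies in every isolated subgroup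
  containing K, it is the unique minimal one. For the rank: a homomorphism from I to the reals that
  vanishes on K has an isolated kernel and is zero, so K spans the rationalized abelianization of I.

  The algorithm searches for a certificate: a basis with a finite graph and a spanning tree, the
  transition monoid of the graph, from which isolation can be read off, and a derivation of the
  basis elements from the generators of K by products and roots.
*)

theory Submission
  imports Defs Complex_Main
begin

text \<open>Since the vertices are cosets, the graph is folded from the outset, and a path from the
  base point ends at the coset of its label. This is what makes the traversed part isolated in I:
  for w = u c u^-1 in I the cosets of u c and u agree, so as soon as both lie on the graph the two
  vertices coincide. Isolation in the whole free group must instead be read off a finite graph
  without knowing I, and the obstacle is that it speaks about all words and all exponents. A word
  acts on the V - 1 vertices as a partial injection. If its V-th iterate is defined at a vertex, the
  orbit is a cycle, so one iterate per transition map decides whether a cycle of length greater than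
  one occurs, and there are only finitely many maps. The certificate then squeezes the group
  generated by the proposed basis: isolation bounds the isolator from above, the derivation bounds
  it from below.\<close>

section \<open>Words\<close>

text \<open>The left factor need not be reduced: its letters act one after the other on
  \<open>v\<close>. Hence \<open>u \<star> []\<close> is the free reduction of an arbitrary word
  \<open>u\<close>, and \<open>(u @ v) \<star> w = u \<star> v \<star> w\<close> holds by
  computation.\<close>

abbreviation wmult :: "'a word \<Rightarrow> 'a word \<Rightarrow> 'a word" (infixr "\<star>" 75) where
  "u \<star> v \<equiv> foldr cons_cancel u v"

definition winv :: "'a word \<Rightarrow> 'a word" where
  "winv w = rev (map inv_letter w)"

text \<open>Concatenation without cancellation, so that a path can be followed through all copies of
  \<open>w\<close>; \<open>wpow_star\<close> links it to the power in the group.\<close>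

definition wpow :: "'a word \<Rightarrow> nat \<Rightarrow> 'a word" where
  "wpow w n = concat (replicate n w)"

lemma inv_letter_neq [simp]: "inv_letter l \<noteq> l" "l \<noteq> inv_letter l"
  by (auto simp: inv_letter_def prod_eq_iff)

lemma inv_letter_mem_iff [simp]: "inv_letter l \<in> X \<times> UNIV \<longleftrightarrow> l \<in> X \<times> UNIV"
  by (cases l) (auto simp: inv_letter_def)

lemma winv_Nil [simp]: "winv [] = []"
  and winv_Cons: "winv (l # w) = winv w @ [inv_letter l]"
  and winv_append [simp]: "winv (u @ v) = winv v @ winv u"
  and winv_winv [simp]: "winv (winv w) = w"
  and winv_eq_Nil_iff [simp]: "winv w = [] \<longleftrightarrow> w = []"
  by (auto simp: winv_def rev_map comp_def)

lemma last_winv: "w \<noteq> [] \<Longrightarrow> last (winv w) = inv_letter (hd w)"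
  by (simp add: winv_def last_rev hd_map)

lemma set_winv_subset_iff [simp]: "set (winv w) \<subseteq> X \<times> UNIV \<longleftrightarrow> set w \<subseteq> X \<times> UNIV"
  by (auto simp: winv_def inv_letter_def image_subset_iff mem_Times_iff)

lemma wpow_0 [simp]: "wpow w 0 = []"
  and wpow_Suc [simp]: "wpow w (Suc n) = w @ wpow w n"
  by (auto simp: wpow_def)

lemma set_wpow_subset: "set w \<subseteq> A \<Longrightarrow> set (wpow w n) \<subseteq> A"
  by (induction n) auto

lemma reduced_Nil [simp]: "reduced []"
  and reduced_single [simp]: "reduced [l]"
  by (simp_all add: reduced_def)

lemma reduced_append_iff:
  "reduced (u @ v) \<longleftrightarrow> reduced u \<and> reduced v \<and> (u \<noteq> [] \<longrightarrow> v \<noteq> [] \<longrightarrow> hd v \<noteq> inv_letter (last u))"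
  by (auto simp: reduced_def successively_append_iff)

lemma reduced_Cons_iff:
  "reduced (l # v) \<longleftrightarrow> reduced v \<and> (v \<noteq> [] \<longrightarrow> hd v \<noteq> inv_letter l)"
  using reduced_append_iff[of "[l]" v] by auto

lemma carrier_free_group: "carrier (free_group X) = {w. set w \<subseteq> X \<times> UNIV \<and> reduced w}"
  by (fastforce simp: free_group_def)

lemma mult_free_group [simp]: "mult (free_group X) = foldr cons_cancel"
  and one_free_group [simp]: "one (free_group X) = []"
  by (simp_all add: free_group_def)

lemma Nil_in_free_group [simp]: "[] \<in> carrier (free_group X)"
  by (simp add: carrier_free_group)

lemma star_assoc: "reduced w \<Longrightarrow> (u \<star> v) \<star> w = u \<star> (v \<star> w)"
  by (rule foldr_cons_cancel_assoc)

lemma star_Nil: "reduced w \<Longrightarrow> w \<star> [] = w"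
  by (rule foldr_cons_cancel_Nil)

lemma reduced_star [simp]: "reduced v \<Longrightarrow> reduced (u \<star> v)"
  by (rule reduced_foldr)

lemma set_star: "set u \<subseteq> A \<Longrightarrow> set v \<subseteq> A \<Longrightarrow> set (u \<star> v) \<subseteq> A"
  using set_foldr_cons_cancel[of u v] by blast

lemma star_carrier:
  "set u \<subseteq> X \<times> UNIV \<Longrightarrow> v \<in> carrier (free_group X) \<Longrightarrow> u \<star> v \<in> carrier (free_group X)"
  using set_star[of u "X \<times> UNIV" v] by (auto simp: carrier_free_group)

lemma cons_cancel_reduced: "reduced (l # v) \<Longrightarrow> cons_cancel l v = l # v"
  by (cases v) (auto simp: reduced_Cons_iff)

lemma star_winv_left: "reduced w \<Longrightarrow> winv u \<star> (u \<star> w) = w"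
proof (induction u arbitrary: w)
  case (Cons l u)
  then show ?case
    using cons_cancel_inv[of "u \<star> w" "inv_letter l"] by (simp add: winv_Cons)
qed simp

lemma star_winv_right: "reduced w \<Longrightarrow> u \<star> (winv u \<star> w) = w"
  using star_winv_left[of w "winv u"] by simp

lemma star_cancel_right: "reduced u \<Longrightarrow> reduced v \<Longrightarrow> reduced w \<Longrightarrow> u \<star> w = v \<star> w \<longleftrightarrow> u = v"
  by (metis reduced_Nil reduced_star star_Nil star_assoc star_winv_right)

lemma reduced_winv [simp]: "reduced (winv w) \<longleftrightarrow> reduced w"
proof -
  have *: "reduced (winv w)" if "reduced w" for w :: "'a word"
    using that
  proof (induction w)
    case (Cons l w)
    then show ?case
      by (cases "w = []") (auto simp: reduced_Cons_iff reduced_append_iff winv_Cons last_winv)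
  qed simp
  from *[of w] *[of "winv w"] show ?thesis by auto
qed

lemma winv_carrier: "w \<in> carrier (free_group X) \<Longrightarrow> winv w \<in> carrier (free_group X)"
  by (simp add: carrier_free_group)

lemma winv_star:
  assumes "reduced v" "reduced w"
  shows "winv (u \<star> v) \<star> w = winv v \<star> winv u \<star> w"
proof -
  have "(u \<star> v) \<star> winv v \<star> winv u \<star> w = w"
    using assms by (simp add: star_assoc star_winv_right)
  then show ?thesis
    using star_winv_left[of "winv v \<star> winv u \<star> w" "u \<star> v"] assms by simp
qed

interpretation free_group: group "free_group X" for X :: "'a set"
  by (rule group_free_group)

lemma inv_free_group:
  assumes "w \<in> carrier (free_group X)"
  shows "inv\<^bsub>free_group X\<^esub> w = winv w"
proof (rule free_group.inv_equality)
  show "winv w \<otimes>\<^bsub>free_group X\<^esub> w = \<one>\<^bsub>free_group X\<^esub>"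
    using assms star_winv_left[of "[]" w] by (simp add: star_Nil carrier_free_group)
qed (use assms in \<open>auto intro: winv_carrier\<close>)

lemma wpow_star:
  assumes "w \<in> carrier (free_group X)"
  shows "w [^]\<^bsub>free_group X\<^esub> n = wpow w n \<star> []"
proof (induction n)
  case (Suc n)
  have "w [^]\<^bsub>free_group X\<^esub> Suc n = w \<star> (w [^]\<^bsub>free_group X\<^esub> n)"
    using free_group.nat_pow_Suc2[OF assms] by simp
  then show ?case using Suc by simp
qed simp

lemma subgroup_free_groupD:
  assumes "subgroup H (free_group X)"
  shows "H \<subseteq> carrier (free_group X)" "[] \<in> H"
    "\<And>u v. u \<in> H \<Longrightarrow> v \<in> H \<Longrightarrow> u \<star> v \<in> H" "\<And>u. u \<in> H \<Longrightarrow> winv u \<in> H"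
proof -
  show sub: "H \<subseteq> carrier (free_group X)" "[] \<in> H"
    using subgroup.subset[OF assms] subgroup.one_closed[OF assms] by auto
  show "u \<star> v \<in> H" if "u \<in> H" "v \<in> H" for u v
    using subgroup.m_closed[OF assms that] by simp
  show "winv u \<in> H" if "u \<in> H" for u
    using subgroup.m_inv_closed[OF assms that] inv_free_group[of u X] sub(1) that by auto
qed

lemma subgroup_free_groupI:
  assumes "H \<subseteq> carrier (free_group X)" "[] \<in> H"
    "\<And>u v. u \<in> H \<Longrightarrow> v \<in> H \<Longrightarrow> u \<star> v \<in> H" "\<And>u. u \<in> H \<Longrightarrow> winv u \<in> H"
  shows "subgroup H (free_group X)"
  by (rule free_group.subgroupI) (use assms in \<open>auto simp: inv_free_group subset_iff\<close>)

section \<open>Cyclically reduced cores and powers\<close>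

lemma cyclic_decomposition:
  assumes "reduced w" "w \<noteq> []"
  obtains u c where "w = u @ c @ winv u" "c \<noteq> []" "hd c \<noteq> inv_letter (last c)"
  using assms
proof (induction w arbitrary: thesis rule: length_induct)
  case (1 w)
  show ?case
  proof (cases "hd w = inv_letter (last w)")
    case True
    obtain l v where w: "w = l # v" using 1 by (cases w) auto
    with True have "v \<noteq> []" by auto
    then obtain v' m where v: "v = v' @ [m]" by (metis rev_exhaust)
    with True w have m: "m = inv_letter l" by simp
    \<comment> \<open>Two mutually inverse letters cannot be all that is left of a reduced word;
      this keeps the core \<open>c\<close> nonempty.\<close>
    have "v' \<noteq> []" using 1 w v m by (auto simp: reduced_Cons_iff)
    moreover have "reduced v'" using 1 w v by (auto simp: reduced_Cons_iff reduced_append_iff)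
    ultimately obtain u c where "v' = u @ c @ winv u" "c \<noteq> []" "hd c \<noteq> inv_letter (last c)"
      using 1(1) w v by (metis length_Cons length_append_singleton lessI less_SucI)
    then show ?thesis using w v m by (intro 1(2)[of "l # u" c]) (auto simp: winv_Cons)
  next
    case False
    then show ?thesis using 1(2)[of "[]" w] 1 by auto
  qed
qed

lemma reduced_wpow:
  assumes "reduced c" "c \<noteq> []" "hd c \<noteq> inv_letter (last c)"
  shows "reduced (wpow c n)"
proof (induction n)
  case (Suc n)
  show ?case by (cases n) (use Suc assms in \<open>auto simp: reduced_append_iff\<close>)
qed simp

lemma hd_wpow_append: "c \<noteq> [] \<Longrightarrow> hd (wpow c n @ v) = (if n = 0 then hd v else hd c)"
  by (cases n) auto

lemma last_wpow: "c \<noteq> [] \<Longrightarrow> last (wpow c (Suc n)) = last c"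
  by (induction n) auto

text \<open>The trailing factor \<open>w\<close> lets each inner \<open>winv u \<star> u\<close>
  cancel by \<open>star_winv_left\<close>, whether or not \<open>u\<close> and \<open>c\<close> are
  reduced.\<close>

lemma wpow_conj:
  "reduced w \<Longrightarrow> wpow (u @ c @ winv u) n \<star> w = (u @ wpow c n @ winv u) \<star> w"
proof (induction n)
  case 0
  then show ?case by (simp add: star_winv_right)
next
  case (Suc n)
  have "wpow (u @ c @ winv u) (Suc n) \<star> w = (u @ c @ winv u) \<star> (wpow (u @ c @ winv u) n \<star> w)"
    by simp
  also have "\<dots> = u \<star> c \<star> winv u \<star> (u @ wpow c n @ winv u) \<star> w"
    using Suc by simp
  also have "\<dots> = u \<star> c \<star> wpow c n \<star> winv u \<star> w"
    using Suc.prems star_winv_left[of "wpow c n \<star> winv u \<star> w" u] by simp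
  finally show ?case by simp
qed

text \<open>For a cyclically reduced core no cancellation occurs at any junction, so a positive
  power is literally the concatenation of \<open>u\<close>, \<open>n\<close> copies of
  \<open>c\<close> and \<open>winv u\<close>. For \<open>n = 0\<close> this fails unless
  \<open>u\<close> is empty, hence the restriction.\<close>

lemma pow_decomposition:
  assumes "w \<in> carrier (free_group X)" "w \<noteq> []"
  obtains u c where "w = u @ c @ winv u" "c \<noteq> []"
    "\<And>n. 0 < n \<Longrightarrow> w [^]\<^bsub>free_group X\<^esub> n = u @ wpow c n @ winv u"
proof -
  have red: "reduced w" using assms by (simp add: carrier_free_group)
  from this assms(2) obtain u c where uc: "w = u @ c @ winv u" "c \<noteq> []" "hd c \<noteq> inv_letter (last c)"
    by (rule cyclic_decomposition)
  have "w [^]\<^bsub>free_group X\<^esub> n = u @ wpow c n @ winv u" if n0: "0 < n" for n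
  proof -
    obtain m where n: "n = Suc m" using n0 by (cases n) auto
    have "reduced (u @ wpow c n @ winv u)"
      using red uc(2,3) reduced_wpow[of c n] last_wpow[of c m]
      unfolding uc(1) n by (cases "u = []") (auto simp: reduced_append_iff hd_wpow_append split: if_splits)
    then show ?thesis
      using wpow_star[OF assms(1), of n] wpow_conj[of "[]" u c n] star_Nil uc(1) by (metis reduced_Nil)
  qed
  with uc(1,2) that show ?thesis by blast
qed

lemma free_group_torsion_free:
  fixes n :: nat
  assumes "w \<in> carrier (free_group X)" "0 < n" "w [^]\<^bsub>free_group X\<^esub> n = []"
  shows "w = []"
proof (rule ccontr)
  assume "w \<noteq> []"
  obtain u c where "c \<noteq> []" "\<And>n. 0 < n \<Longrightarrow> w [^]\<^bsub>free_group X\<^esub> n = u @ wpow c n @ winv u"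
    using pow_decomposition[OF assms(1) \<open>w \<noteq> []\<close>] by metis
  from this(1) this(2)[OF assms(2)] assms(2,3) show False by (cases n) auto
qed

section \<open>Folded graphs\<close>

lemma foldl_wpow: "foldl \<delta> q (wpow c n) = ((\<lambda>q. foldl \<delta> q c) ^^ n) q"
  by (induction n arbitrary: q) (auto simp: funpow_Suc_right simp del: funpow.simps(2))

text \<open>
  The vertices of the graph are \<open>1, \<dots>, V - 1\<close> with base point \<open>1\<close>; the state \<open>0\<close> says that
  there is no edge. A path labelled by the word \<open>w\<close> ends in \<open>foldl \<delta> q w\<close>.
\<close>

locale folded_graph =
  fixes X :: "'a set" and V :: nat and \<delta> :: "nat \<Rightarrow> 'a letter \<Rightarrow> nat"
  assumes V: "1 < V"
    and dead: "l \<in> X \<times> UNIV \<Longrightarrow> \<delta> 0 l = 0"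
    and bounded: "q < V \<Longrightarrow> l \<in> X \<times> UNIV \<Longrightarrow> \<delta> q l < V"
    and folded: "q < V \<Longrightarrow> l \<in> X \<times> UNIV \<Longrightarrow> \<delta> q l \<noteq> 0 \<Longrightarrow> \<delta> (\<delta> q l) (inv_letter l) = q"
begin

lemma run_dead: "set w \<subseteq> X \<times> UNIV \<Longrightarrow> foldl \<delta> 0 w = 0"
  by (induction w) (auto simp: dead)

lemma run_bounded: "q < V \<Longrightarrow> set w \<subseteq> X \<times> UNIV \<Longrightarrow> foldl \<delta> q w < V"
  by (induction w arbitrary: q) (auto simp: bounded)

lemma run_prefix_alive: 
  "set v \<subseteq> X \<times> UNIV \<Longrightarrow> foldl \<delta> q (u @ v) \<noteq> 0 \<Longrightarrow> foldl \<delta> q u \<noteq> 0"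
  by (metis foldl_append run_dead)

lemma run_winv:
  "q < V \<Longrightarrow> set w \<subseteq> X \<times> UNIV \<Longrightarrow> foldl \<delta> q w \<noteq> 0 \<Longrightarrow> foldl \<delta> (foldl \<delta> q w) (winv w) = q"
proof (induction w arbitrary: q)
  case (Cons l w)
  then have "\<delta> q l \<noteq> 0" using run_prefix_alive[of w q "[l]"] by simp
  then show ?case using Cons by (simp add: winv_Cons bounded folded)
qed simp

lemma run_cons_cancel:
  assumes "q < V" "l \<in> X \<times> UNIV" "set v \<subseteq> X \<times> UNIV" "foldl \<delta> q (l # v) \<noteq> 0"
  shows "foldl \<delta> q (cons_cancel l v) = foldl \<delta> q (l # v)"
proof (cases v)
  case (Cons m v')
  then show ?thesis
    using assms folded[of q l] run_prefix_alive[of v q "[l]"] by auto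
qed simp

text \<open>A cancelled pair of letters walks along an edge and back, so removing it keeps the
  endpoint. The hypothesis is on the uncancelled path, since cancellation may turn a path that
  leaves the graph into one that stays.\<close>

lemma run_star:
  "q < V \<Longrightarrow> set u \<subseteq> X \<times> UNIV \<Longrightarrow> set v \<subseteq> X \<times> UNIV \<Longrightarrow> foldl \<delta> q (u @ v) \<noteq> 0 \<Longrightarrow>
    foldl \<delta> q (u \<star> v) = foldl \<delta> q (u @ v)"
proof (induction u arbitrary: q)
  case (Cons l u)
  then have "foldl \<delta> (\<delta> q l) (u \<star> v) = foldl \<delta> (\<delta> q l) (u @ v)" by (simp add: bounded)
  then show ?case
    using Cons.prems run_cons_cancel[of q l "u \<star> v"] set_star[of u "X \<times> UNIV" v] by simp
qed simp

text \<open>The fundamental group at the base point, given by the reduced words that label closed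
  paths.\<close>

definition lang :: "'a word set" where
  "lang = {w \<in> carrier (free_group X). foldl \<delta> 1 w = 1}"

lemma subgroup_lang: "subgroup lang (free_group X)"
proof (rule subgroup_free_groupI)
  show "u \<star> v \<in> lang" if "u \<in> lang" "v \<in> lang" for u v
    using that V run_star[of 1 u v] star_carrier[of u X v] by (auto simp: lang_def carrier_free_group)
  show "winv u \<in> lang" if "u \<in> lang" for u
    using that V run_winv[of 1 u] winv_carrier[of u X] by (auto simp: lang_def carrier_free_group)
qed (auto simp: lang_def)

text \<open>The reduced form of the power spells out \<open>u\<close>, the copies of
  \<open>c\<close> and \<open>winv u\<close>, so its closed path reaches the vertex after
  \<open>u\<close> and runs through \<open>c\<close> repeatedly from there. The last conclusion
  leaves only the question whether \<open>c\<close> alone fixes that vertex; isolation inside a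
  subgroup and the check of a certificate answer it in different ways.\<close>

lemma pow_in_langE:
  assumes "w \<in> carrier (free_group X)" "0 < n" "w [^]\<^bsub>free_group X\<^esub> n \<in> lang"
  obtains u c where "w = u @ c @ winv u" "foldl \<delta> 1 u \<noteq> 0"
    "foldl \<delta> (foldl \<delta> 1 u) (wpow c n) = foldl \<delta> 1 u"
    "foldl \<delta> (foldl \<delta> 1 u) c = foldl \<delta> 1 u \<Longrightarrow> w \<in> lang"
proof (cases "w = []")
  case True
  show ?thesis by (rule that[of "[]" "[]"]) (use True in \<open>auto simp: lang_def wpow_def\<close>)
next
  case False
  obtain u c where uc: "w = u @ c @ winv u" "c \<noteq> []"
    and pow: "\<And>n. 0 < n \<Longrightarrow> w [^]\<^bsub>free_group X\<^esub> n = u @ wpow c n @ winv u"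
    using pow_decomposition[OF assms(1) False] by metis
  have letters: "set u \<subseteq> X \<times> UNIV" "set c \<subseteq> X \<times> UNIV"
    using assms(1) uc(1) by (auto simp: carrier_free_group)
  then have letters': "set (wpow c n) \<subseteq> X \<times> UNIV" by (simp add: set_wpow_subset)
  define q where "q = foldl \<delta> 1 u"
  have run: "foldl \<delta> 1 (u @ wpow c n @ winv u) = 1"
    using assms(3) pow[OF assms(2)] by (simp add: lang_def)
  have "q \<noteq> 0"
    unfolding q_def by (rule run_prefix_alive[of "wpow c n @ winv u"]) (use run letters letters' in auto)
  have "q < V" unfolding q_def using V letters by (intro run_bounded) auto
  define r where "r = foldl \<delta> q (wpow c n)"
  have r: "foldl \<delta> r (winv u) = 1" using run by (simp add: q_def r_def)
  have "r < V" unfolding r_def using \<open>q < V\<close> letters' by (rule run_bounded)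
  \<comment> \<open>Reading \<open>winv u\<close> from \<open>r\<close> ends at the base point;
    reversing this path identifies \<open>r\<close> as the endpoint of \<open>u\<close>.\<close>
  then have "r = q" using run_winv[of r "winv u"] r letters by (simp add: q_def)
  have "foldl \<delta> q (winv u) = 1" unfolding q_def
    by (rule run_winv) (use V letters \<open>q \<noteq> 0\<close> q_def in auto)
  with \<open>r = q\<close> \<open>q \<noteq> 0\<close> uc(1) assms(1) that[of u c] show ?thesis
    by (auto simp: q_def r_def lang_def)
qed

end


section \<open>Evaluation of words\<close>

lemma eval_word_Nil [simp]: "eval_word G [] = \<one>\<^bsub>G\<^esub>"
  and eval_word_Cons:
    "eval_word G (l # w) = (if snd l then fst l else inv\<^bsub>G\<^esub> fst l) \<otimes>\<^bsub>G\<^esub> eval_word G w"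
  by (simp_all add: eval_word_def)

context group
begin

lemma eval_word_closed [simp, intro]: "set w \<subseteq> carrier G \<times> UNIV \<Longrightarrow> eval_word G w \<in> carrier G"
  by (induction w) (auto simp: eval_word_Cons)

lemma eval_word_subgroup: "subgroup H G \<Longrightarrow> set w \<subseteq> H \<times> UNIV \<Longrightarrow> eval_word G w \<in> H"
  by (induction w) (auto simp: eval_word_Cons subgroup.one_closed subgroup.m_closed subgroup.m_inv_closed)

lemma eval_word_cons_cancel:
  assumes "l \<in> carrier G \<times> UNIV" "set w \<subseteq> carrier G \<times> UNIV"
  shows "eval_word G (cons_cancel l w) = eval_word G (l # w)"
proof (cases w)
  case (Cons m v)
  then show ?thesis
    using assms by (auto simp: eval_word_Cons inv_letter_def m_assoc[symmetric])
qed simp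

lemma eval_word_star:
  assumes "set u \<subseteq> carrier G \<times> UNIV" "set v \<subseteq> carrier G \<times> UNIV"
  shows "eval_word G (u \<star> v) = eval_word G u \<otimes> eval_word G v"
  using assms(1)
proof (induction u)
  case (Cons l u)
  then have "eval_word G (l # (u \<star> v)) = eval_word G (l # u) \<otimes> eval_word G v"
    using assms(2) by (auto simp: eval_word_Cons m_assoc)
  then show ?case
    using Cons.prems assms(2) eval_word_cons_cancel[of l "u \<star> v"] set_star[of u "carrier G \<times> UNIV" v]
    by simp
qed (use assms(2) in simp)

lemma eval_word_generate: "set w \<subseteq> S \<times> UNIV \<Longrightarrow> S \<subseteq> carrier G \<Longrightarrow> eval_word G w \<in> generate G S"
  using eval_word_subgroup[OF generate_is_subgroup[of S], of w] generate.incl[of _ S G] by fastforce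

end


section \<open>Free bases from spanning trees\<close>

text \<open>
  \<open>T q\<close> is the label of the path from the base point to \<open>q\<close> in a spanning tree. Every edge
  gives rise to an element \<open>edge_elem\<close> of the fundamental group, and up to inversion \<open>B\<close> consists
  of the nontrivial ones.
\<close>

locale basis_graph = folded_graph +
  fixes T :: "nat \<Rightarrow> 'a word" and B :: "'a word set"
  assumes T_1: "T 1 = []"
    and tree: "1 < q \<Longrightarrow> q < V \<Longrightarrow>
      \<exists>p<q. p \<noteq> 0 \<and> (\<exists>l\<in>X \<times> UNIV. \<delta> p l = q \<and> T q = T p \<star> [l])"
    and edge: "q < V \<Longrightarrow> l \<in> X \<times> UNIV \<Longrightarrow> \<delta> q l \<noteq> 0 \<Longrightarrow>
      T q \<star> [l] = T (\<delta> q l) \<or>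
      (\<exists>b\<in>B. T q \<star> [l] = b \<star> T (\<delta> q l) \<or> b \<star> T q \<star> [l] = T (\<delta> q l))"
    and B_carrier: "B \<subseteq> carrier (free_group X)"
    and basis_edge: "b \<in> B \<Longrightarrow>
      \<exists>q<V. \<exists>l\<in>X \<times> UNIV. \<delta> q l \<noteq> 0 \<and> T q \<star> [l] = b \<star> T (\<delta> q l)"
    and indep: "b \<in> B \<Longrightarrow> b' \<in> B \<Longrightarrow> b \<star> b' \<noteq> []"
begin

lemma T_Suc_0 [simp]: "T (Suc 0) = []"
  using T_1 by simp

lemma tree_word: "0 < q \<Longrightarrow> q < V \<Longrightarrow> T q \<in> carrier (free_group X) \<and> foldl \<delta> 1 (T q) = q"
proof (induction q rule: less_induct)
  case (less q)
  show ?case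
  proof (cases "q = 1")
    case False
    with less.prems obtain p l where p: "p < q" "p \<noteq> 0" "l \<in> X \<times> UNIV" "\<delta> p l = q" "T q = T p \<star> [l]"
      using tree[of q] by auto
    then have Tp: "T p \<in> carrier (free_group X)" "foldl \<delta> 1 (T p) = p" 
      using less by auto
    have "[l] \<in> carrier (free_group X)" using p by (simp add: carrier_free_group)
    moreover have "foldl \<delta> 1 (T p \<star> [l]) = foldl \<delta> 1 (T p @ [l])"
      using p Tp V less.prems by (intro run_star) (auto simp: carrier_free_group)
    ultimately show ?thesis
      using p Tp star_carrier[of "T p" X "[l]"] by (auto simp: carrier_free_group)
  qed simp
qed

definition edge_elem :: "nat \<Rightarrow> 'a letter \<Rightarrow> 'a word" where
  "edge_elem q l = T q \<star> [l] \<star> winv (T (\<delta> q l))"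

context
  fixes q l
  assumes q: "q < V" and l: "l \<in> X \<times> UNIV" and alive: "\<delta> q l \<noteq> 0"
begin

private lemma facts: "T q \<in> carrier (free_group X)" "reduced (T q)" "T (\<delta> q l) \<in> carrier (free_group X)"
    "reduced (T (\<delta> q l))" "set (T q) \<subseteq> X \<times> UNIV" "set (T (\<delta> q l)) \<subseteq> X \<times> UNIV"
proof -
  have "q \<noteq> 0" using dead[OF l] alive by metis
  then show "T q \<in> carrier (free_group X)" "T (\<delta> q l) \<in> carrier (free_group X)"
    using tree_word[of q] tree_word[of "\<delta> q l"] q bounded[OF q l] alive by auto
  then show "reduced (T q)" "reduced (T (\<delta> q l))" "set (T q) \<subseteq> X \<times> UNIV" "set (T (\<delta> q l)) \<subseteq> X \<times> UNIV"
    by (auto simp: carrier_free_group)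
qed

lemma edge_elem_carrier: "edge_elem q l \<in> carrier (free_group X)"
  unfolding edge_elem_def using facts l
  by (intro star_carrier winv_carrier) auto

lemma edge_elem_iff: "g \<in> carrier (free_group X) \<Longrightarrow> T q \<star> [l] = g \<star> T (\<delta> q l) \<longleftrightarrow> edge_elem q l = g"
proof -
  assume g: "g \<in> carrier (free_group X)"
  then have "reduced g" by (simp add: carrier_free_group)
  have "T q \<star> [l] = edge_elem q l \<star> T (\<delta> q l)"
    using facts star_winv_left[of "[]" "T (\<delta> q l)"] star_assoc[of "T (\<delta> q l)" "T q @ [l]" "winv (T (\<delta> q l))"]
    by (simp add: edge_elem_def star_Nil)
  moreover have "reduced (edge_elem q l)" using edge_elem_carrier by (simp add: carrier_free_group)
  ultimately show ?thesis
    using star_cancel_right[of "edge_elem q l" g "T (\<delta> q l)"] \<open>reduced g\<close> facts by auto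
qed

lemma edge_elem_inv: "edge_elem (\<delta> q l) (inv_letter l) = winv (edge_elem q l)"
proof -
  have "reduced (edge_elem q l)" using edge_elem_carrier by (simp add: carrier_free_group)
  then have "winv (edge_elem q l) = winv (edge_elem q l) \<star> []" by (simp add: star_Nil)
  also have "\<dots> = T (\<delta> q l) \<star> cons_cancel (inv_letter l) (winv (T q) \<star> [])"
    using facts winv_star[of "[l] \<star> winv (T (\<delta> q l))" "[]" "T q"] winv_star[of "winv (T (\<delta> q l))" "winv (T q) \<star> []" "[l]"]
    by (simp add: edge_elem_def winv_Cons reduced_cons_cancel)
  also have "winv (T q) \<star> [] = winv (T q)" using facts by (simp add: star_Nil)
  finally show ?thesis using folded[OF q l alive] by (simp add: edge_elem_def)
qed

text \<open>The equations in \<open>edge\<close> avoid inverses, as suits a check on codes; they say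
  that the edge element is trivial, a basis element or the inverse of one.\<close>

lemma edge_elem_cases: "edge_elem q l = [] \<or> edge_elem q l \<in> B \<or> winv (edge_elem q l) \<in> B"
  using edge[OF q l alive]
proof (elim disjE bexE)
  assume "T q \<star> [l] = T (\<delta> q l)"
  then show ?thesis using edge_elem_iff[of "[]"] by simp
next
  fix b assume "b \<in> B" "T q \<star> [l] = b \<star> T (\<delta> q l)"
  then show ?thesis using edge_elem_iff[of b] B_carrier by auto
next
  fix b assume b: "b \<in> B" "b \<star> T q \<star> [l] = T (\<delta> q l)"
  then have "T q \<star> [l] = winv b \<star> T (\<delta> q l)"
    using star_winv_left[of "T q \<star> [l]" b] by simp
  then have "edge_elem q l = winv b" using edge_elem_iff[of "winv b"] B_carrier b winv_carrier[of b X] by auto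
  then show ?thesis using b by simp
qed

end

lemma edge_elem_tree:
  assumes "1 < q" "q < V"
  obtains p l where "p < q" "p \<noteq> 0" "l \<in> X \<times> UNIV" "\<delta> p l = q" "T q = T p \<star> [l]" "edge_elem p l = []"
proof -
  from assms obtain p l where p: "p < q" "p \<noteq> 0" "l \<in> X \<times> UNIV" "\<delta> p l = q" "T q = T p \<star> [l]"
    using tree[of q] by auto
  moreover have "edge_elem p l = []"
    using p assms edge_elem_iff[of p l "[]"] by simp
  ultimately show ?thesis by (rule that)
qed

section \<open>Paths as words over the basis\<close>

definition label :: "'a word \<Rightarrow> 'a word word" where
  "label g = (if g = [] then [] else if g \<in> B then [(g, True)] else [(winv g, False)])"

text \<open>Applying \<open>indep\<close> to \<open>b\<close> and its inverse, and to
  \<open>b\<close> twice, rules out both degenerate cases; hence the orientation chosen by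
  \<open>label\<close> is unambiguous.\<close>

lemma winv_notin_B:
  assumes "b \<in> B" shows "winv b \<notin> B" "b \<noteq> []"
proof -
  have "reduced b" using assms B_carrier by (auto simp: carrier_free_group)
  then have "b \<star> winv b = []" using star_winv_right[of "[]" b] by (simp add: star_Nil)
  then show "winv b \<notin> B" using indep assms by auto
  show "b \<noteq> []" using indep[OF assms assms] by auto
qed

lemma label_carrier: "g = [] \<or> g \<in> B \<or> winv g \<in> B \<Longrightarrow> label g \<in> carrier (free_group B)"
  by (auto simp: label_def carrier_free_group)

lemma label_winv: "g = [] \<or> g \<in> B \<or> winv g \<in> B \<Longrightarrow> label (winv g) = winv (label g)"
  using winv_notin_B(1)[of g] by (auto simp: label_def winv_Cons inv_letter_def)

lemma eval_label: "g = [] \<or> g \<in> B \<or> winv g \<in> B \<Longrightarrow> eval_word (free_group X) (label g) = g"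
  using B_carrier inv_free_group[of g X] inv_free_group[of "winv g" X] 
  by (auto simp: label_def eval_word_Cons star_Nil carrier_free_group subset_iff)

text \<open>Collapsing the spanning tree turns a path into a word over \<open>B\<close>: each edge
  crossed contributes its basis letter, tree edges contribute nothing. On closed paths at the base
  point this is the two-sided inverse of evaluation, which proves freeness.\<close>

fun reading :: "nat \<Rightarrow> 'a word \<Rightarrow> 'a word word" where
  "reading q [] = []"
| "reading q (l # w) = label (edge_elem q l) \<star> reading (\<delta> q l) w"

lemma aliveD:
  assumes "q < V" "l \<in> X \<times> UNIV" "set w \<subseteq> X \<times> UNIV" "foldl \<delta> q (l # w) \<noteq> 0"
  shows "\<delta> q l \<noteq> 0" "\<delta> q l < V" "foldl \<delta> (\<delta> q l) w \<noteq> 0"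
  using assms run_prefix_alive[of w q "[l]"] bounded[of q l] by auto

lemma reading_carrier:
  "q < V \<Longrightarrow> set w \<subseteq> X \<times> UNIV \<Longrightarrow> foldl \<delta> q w \<noteq> 0 \<Longrightarrow> reading q w \<in> carrier (free_group B)"
proof (induction w arbitrary: q)
  case (Cons l w)
  have l: "l \<in> X \<times> UNIV" "set w \<subseteq> X \<times> UNIV" using Cons.prems by auto
  note a = aliveD[OF Cons.prems(1) l Cons.prems(3)]
  have "label (edge_elem q l) \<in> carrier (free_group B)"
    by (rule label_carrier, rule edge_elem_cases) (use a l Cons.prems in auto)
  then show ?case
    using Cons.IH[OF a(2) l(2) a(3)] star_carrier[of "label (edge_elem q l)" B "reading (\<delta> q l) w"]
    by (simp add: carrier_free_group)
qed simp

lemma reading_reduced: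
  "q < V \<Longrightarrow> set w \<subseteq> X \<times> UNIV \<Longrightarrow> foldl \<delta> q w \<noteq> 0 \<Longrightarrow> reduced (reading q w)"
  using reading_carrier by (auto simp: carrier_free_group)

lemma reading_append:
  "q < V \<Longrightarrow> set u \<subseteq> X \<times> UNIV \<Longrightarrow> set v \<subseteq> X \<times> UNIV \<Longrightarrow> foldl \<delta> q (u @ v) \<noteq> 0 \<Longrightarrow>
    reading q (u @ v) = reading q u \<star> reading (foldl \<delta> q u) v"
proof (induction u arbitrary: q)
  case (Cons l u)
  have l: "l \<in> X \<times> UNIV" "set (u @ v) \<subseteq> X \<times> UNIV" "foldl \<delta> q (l # u @ v) \<noteq> 0" using Cons.prems by auto
  note a = aliveD[OF Cons.prems(1) l]
  have "reduced (reading (foldl \<delta> q (l # u)) v)"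
    by (rule reading_reduced) (use Cons.prems l in \<open>auto intro!: run_bounded bounded\<close>)
  then have "reduced (reading (foldl \<delta> (\<delta> q l) u) v)" by simp
  from star_assoc[OF this, of "label (edge_elem q l)"] show ?case
    using Cons.IH[OF a(2)] a l by simp
qed simp

text \<open>Going along an edge and back contributes a label and its inverse, so the reading depends
  only on the reduced path.\<close>

lemma reading_cancel:
  assumes "q < V" "l \<in> X \<times> UNIV" "set w \<subseteq> X \<times> UNIV" "foldl \<delta> q (l # inv_letter l # w) \<noteq> 0"
  shows "reading q (l # inv_letter l # w) = reading q w"
proof -
  have w: "set (inv_letter l # w) \<subseteq> X \<times> UNIV" using assms inv_letter_mem_iff[of l X] by simp
  note a = aliveD[OF assms(1,2) w assms(4)]
  have e: "edge_elem q l = [] \<or> edge_elem q l \<in> B \<or> winv (edge_elem q l) \<in> B"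
    using edge_elem_cases assms(1,2) a(1) by blast
  have "\<delta> (\<delta> q l) (inv_letter l) = q" using folded[OF assms(1,2) a(1)] .
  moreover have "edge_elem (\<delta> q l) (inv_letter l) = winv (edge_elem q l)" 
    using edge_elem_inv[OF assms(1,2) a(1)] .
  moreover have "reduced (reading q w)"
    by (rule reading_reduced) (use assms a calculation(1) in auto)
  ultimately show ?thesis
    using star_winv_right[of "reading q w" "label (edge_elem q l)"] label_winv[OF e] by simp
qed

lemma reading_cons_cancel:
  assumes "q < V" "l \<in> X \<times> UNIV" "set v \<subseteq> X \<times> UNIV" "foldl \<delta> q (l # v) \<noteq> 0"
  shows "reading q (cons_cancel l v) = reading q (l # v)"
  using assms reading_cancel[of q l "tl v"] by (cases v) auto

lemma reading_star:
  "q < V \<Longrightarrow> set u \<subseteq> X \<times> UNIV \<Longrightarrow> set v \<subseteq> X \<times> UNIV \<Longrightarrow> foldl \<delta> q (u @ v) \<noteq> 0 \<Longrightarrow>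
    reading q (u \<star> v) = reading q u \<star> reading (foldl \<delta> q u) v"
proof -
  assume q: "q < V" and u: "set u \<subseteq> X \<times> UNIV" and v: "set v \<subseteq> X \<times> UNIV" and "foldl \<delta> q (u @ v) \<noteq> 0"
  then have "reading q (u \<star> v) = reading q (u @ v)"
  proof (induction u arbitrary: q)
    case (Cons l u)
    have l: "l \<in> X \<times> UNIV" "set (u @ v) \<subseteq> X \<times> UNIV" "foldl \<delta> q (l # u @ v) \<noteq> 0" using Cons.prems by auto
    note a = aliveD[OF Cons.prems(1) l]
    have "reading (\<delta> q l) (u \<star> v) = reading (\<delta> q l) (u @ v)"
      by (rule Cons.IH) (use a l v in auto)
    moreover have "foldl \<delta> (\<delta> q l) (u \<star> v) = foldl \<delta> (\<delta> q l) (u @ v)"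
      by (rule run_star) (use a l v in auto)
    ultimately show ?case
      using reading_cons_cancel[of q l "u \<star> v"] set_star[of u "X \<times> UNIV" v] a l Cons.prems by simp
  qed simp
  also have "\<dots> = reading q u \<star> reading (foldl \<delta> q u) v"
    by (rule reading_append) fact+
  finally show ?thesis .
qed

text \<open>By \<open>reading_star\<close> the reading of the reversed path is a left inverse of the
  reading of the path, and left inverses in the free group on \<open>B\<close> are unique.\<close>

lemma reading_winv:
  assumes q: "q < V" and w: "w \<in> carrier (free_group X)" and alive: "foldl \<delta> q w \<noteq> 0"
  shows "reading (foldl \<delta> q w) (winv w) = winv (reading q w)"
proof -
  define r where "r = foldl \<delta> q w"
  have w': "set w \<subseteq> X \<times> UNIV" "reduced w" using w by (auto simp: carrier_free_group)
  have r: "r < V" "foldl \<delta> r (winv w) = q" 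
    using q w' alive run_bounded run_winv by (auto simp: r_def)
  have q0: "q \<noteq> 0" using w' alive run_dead by metis
  have red: "reduced (reading q w)" "reduced (reading r (winv w))"
    using reading_reduced[of q w] reading_reduced[of r "winv w"] q w' alive r q0 by (auto simp: r_def)
  have "winv w \<star> w = []" using star_winv_left[of "[]" w] w' by (simp add: star_Nil)
  then have "reading r (winv w) \<star> reading q w = []"
    using reading_star[of r "winv w" w] r w' alive q by (simp add: r_def)
  also have "[] = winv (reading q w) \<star> reading q w"
    using star_winv_left[of "[]" "reading q w"] red by (simp add: star_Nil)
  finally show ?thesis
    using star_cancel_right[of "reading r (winv w)" "winv (reading q w)" "reading q w"] red by (simp add: r_def)
qed

text \<open>Passing from \<open>T p\<close> to \<open>T q\<close> multiplies by the letter of a tree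
  edge, possibly with cancellation, so the step goes through \<open>reading_star\<close> and adds
  the trivial label.\<close>

lemma reading_tree: "0 < q \<Longrightarrow> q < V \<Longrightarrow> reading 1 (T q) = []"
proof (induction q rule: less_induct)
  case (less q)
  show ?case
  proof (cases "q = 1")
    case False
    with less.prems obtain p l where p: "p < q" "p \<noteq> 0" "l \<in> X \<times> UNIV" "\<delta> p l = q" "T q = T p \<star> [l]" "edge_elem p l = []"
      using edge_elem_tree[of q] by auto
    then have Tp: "T p \<in> carrier (free_group X)" "foldl \<delta> 1 (T p) = p" 
      using tree_word[of p] less.prems by auto
    have "reading 1 (T p \<star> [l]) = reading 1 (T p) \<star> reading p [l]"
      using reading_star[of 1 "T p" "[l]"] p Tp V less.prems by (auto simp: carrier_free_group)
    then show ?thesis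
      using p less by (simp add: label_def)
  qed simp
qed

text \<open>Up to cancellation, \<open>b\<close> labels the path along the tree to an edge, across
  it and back along the tree. Both tree parts read as the empty word, so only the letter of the edge
  itself survives.\<close>

lemma basis_lang:
  assumes b: "b \<in> B"
  shows "b \<in> lang" "reading 1 b = [(b, True)]"
proof -
  obtain q l where q: "q < V" "l \<in> X \<times> UNIV" "\<delta> q l \<noteq> 0" "T q \<star> [l] = b \<star> T (\<delta> q l)"
    using basis_edge[OF b] by auto
  define r where "r = \<delta> q l"
  have eq: "edge_elem q l = b"
    using edge_elem_iff[OF q(1-3), of b] q b B_carrier by auto
  then have b_eq: "b = T q \<star> [l] \<star> winv (T r)" by (simp add: edge_elem_def r_def)
  have r: "0 < r" "r < V" using q bounded by (auto simp: r_def)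
  have "q \<noteq> 0" using q dead by metis
  then have Tq: "T q \<in> carrier (free_group X)" "foldl \<delta> 1 (T q) = q" "set (T q) \<subseteq> X \<times> UNIV"
    using tree_word[of q] q by (auto simp: carrier_free_group)
  have Tr: "T r \<in> carrier (free_group X)" "foldl \<delta> 1 (T r) = r" "set (T r) \<subseteq> X \<times> UNIV"
    using tree_word[of r] r by (auto simp: carrier_free_group)
  have back_run: "foldl \<delta> r (winv (T r)) = 1"
    using run_winv[of 1 "T r"] V r Tr by simp
  have back_reading: "reading r (winv (T r)) = []"
    using reading_winv[of 1 "T r"] V r Tr reading_tree[of r] by simp
  have run: "foldl \<delta> q ([l] \<star> winv (T r)) = 1"
    using run_star[of q "[l]" "winv (T r)"] q Tr back_run by (simp add: r_def)
  have "reading q ([l] \<star> winv (T r)) = label b"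
    using reading_star[of q "[l]" "winv (T r)"] q Tr back_run back_reading eq label_carrier[of b] b
    by (simp add: r_def carrier_free_group star_Nil)
  also have "label b = [(b, True)]" using winv_notin_B[OF b] b by (simp add: label_def)
  finally have reading: "reading q ([l] \<star> winv (T r)) = [(b, True)]" .
  have letters: "set ([l] \<star> winv (T r)) \<subseteq> X \<times> UNIV"
    using q Tr by (intro set_star) auto
  show "b \<in> lang"
    using run_star[of 1 "T q" "[l] \<star> winv (T r)"] V Tq letters run b B_carrier
    unfolding b_eq[symmetric] by (auto simp: lang_def)
  show "reading 1 b = [(b, True)]"
    using reading_star[of 1 "T q" "[l] \<star> winv (T r)"] V Tq letters run reading q reading_tree[of q] \<open>q \<noteq> 0\<close>
    unfolding b_eq[symmetric] by simp
qed

lemma langD: "w \<in> lang \<Longrightarrow> foldl \<delta> (Suc 0) w = Suc 0 \<and> set w \<subseteq> X \<times> UNIV \<and> reduced w"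
  by (simp add: lang_def carrier_free_group)

lemma reading_mult: "u \<in> lang \<Longrightarrow> v \<in> lang \<Longrightarrow> reading 1 (u \<star> v) = reading 1 u \<star> reading 1 v"
  using reading_star[of 1 u v] V langD[of u] langD[of v] by simp

text \<open>The tree words telescope: crossing an edge replaces \<open>T q \<star> [l]\<close> by
  the edge element times the tree word of the next vertex. For a closed path at the base point both
  outer tree words are trivial.\<close>

lemma eval_reading:
  "q < V \<Longrightarrow> set w \<subseteq> X \<times> UNIV \<Longrightarrow> foldl \<delta> q w \<noteq> 0 \<Longrightarrow>
    T q \<star> w \<star> [] = eval_word (free_group X) (reading q w) \<star> T (foldl \<delta> q w)"
proof (induction w arbitrary: q)
  case Nil
  then show ?case using tree_word[of q] by (simp add: star_Nil carrier_free_group)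
next
  case (Cons l w)
  let ?g = "edge_elem q l" and ?ev = "eval_word (free_group X)"
  have l: "l \<in> X \<times> UNIV" "set w \<subseteq> X \<times> UNIV" using Cons.prems by auto
  note a = aliveD[OF Cons.prems(1) l Cons.prems(3)]
  have e: "?g = [] \<or> ?g \<in> B \<or> winv ?g \<in> B" 
    using edge_elem_cases[OF Cons.prems(1) l(1) a(1)] .
  define t where "t = T (foldl \<delta> (\<delta> q l) w)"
  have t: "reduced t"
    using tree_word[of "foldl \<delta> (\<delta> q l) w"] run_bounded[OF a(2) l(2)] a(3) by (simp add: carrier_free_group t_def)
  have sub: "set (label ?g) \<subseteq> carrier (free_group X) \<times> UNIV" 
    "set (reading (\<delta> q l) w) \<subseteq> carrier (free_group X) \<times> UNIV"
    using label_carrier[OF e] reading_carrier[OF a(2) l(2) a(3)] B_carrier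
    by (auto simp: carrier_free_group)
  have "T q \<star> (l # w) \<star> [] = (T q \<star> [l]) \<star> (w \<star> [])"
    using star_assoc[of "w \<star> []" "T q" "[l]"] by simp
  also have "T q \<star> [l] = ?g \<star> T (\<delta> q l)"
    using edge_elem_iff[OF Cons.prems(1) l(1) a(1), of ?g] edge_elem_carrier[OF Cons.prems(1) l(1) a(1)] by simp
  also have "(?g \<star> T (\<delta> q l)) \<star> w \<star> [] = ?g \<star> T (\<delta> q l) \<star> w \<star> []"
    by (simp add: star_assoc)
  also have "\<dots> = ?ev (label ?g) \<star> ?ev (reading (\<delta> q l) w) \<star> t"
    using Cons.IH[OF a(2) l(2) a(3)] eval_label[OF e] by (simp add: t_def)
  also have "\<dots> = ?ev (label ?g \<star> reading (\<delta> q l) w) \<star> t"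
    using free_group.eval_word_star[OF sub] t by (simp add: star_assoc)
  finally show ?case by (simp add: t_def)
qed

lemma eval_reading_lang: "w \<in> lang \<Longrightarrow> eval_word (free_group X) (reading 1 w) = w"
proof -
  assume w: "w \<in> lang"
  have "set (reading 1 w) \<subseteq> carrier (free_group X) \<times> UNIV"
    using reading_carrier[of 1 w] V langD[OF w] B_carrier by (auto simp: carrier_free_group)
  from free_group.eval_word_closed[OF this]
  show ?thesis
    using eval_reading[of 1 w] V langD[OF w] by (simp add: star_Nil carrier_free_group)
qed

lemma eval_in_lang: "set u \<subseteq> B \<times> UNIV \<Longrightarrow> eval_word (free_group X) u \<in> lang"
  by (rule free_group.eval_word_subgroup[OF subgroup_lang]) (use basis_lang in auto)

lemma reading_eval: "u \<in> carrier (free_group B) \<Longrightarrow> reading 1 (eval_word (free_group X) u) = u"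
proof (induction u)
  case (Cons l u)
  obtain b s where l: "l = (b, s)" by (cases l)
  have b: "b \<in> B" and u: "u \<in> carrier (free_group B)" and red: "reduced (l # u)"
    using Cons.prems by (auto simp: carrier_free_group reduced_Cons_iff l)
  have u': "eval_word (free_group X) u \<in> lang" using u by (intro eval_in_lang) (auto simp: carrier_free_group)
  have inv: "winv b \<in> lang" using subgroup_free_groupD(4)[OF subgroup_lang] basis_lang(1)[OF b] .
  have "reading 1 (winv b) = [(b, False)]"
    using reading_winv[of 1 b] V langD[OF basis_lang(1)[OF b]] basis_lang(2)[OF b] b B_carrier
    by (auto simp: winv_Cons inv_letter_def)
  moreover have "inv\<^bsub>free_group X\<^esub> b = winv b" using b B_carrier by (intro inv_free_group) auto
  ultimately have "reading 1 (eval_word (free_group X) (l # u)) = [l] \<star> u"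
    using reading_mult[OF basis_lang(1)[OF b] u'] reading_mult[OF inv u'] Cons.IH[OF u] basis_lang(2)[OF b]
    by (cases s) (simp_all add: eval_word_Cons l)
  then show ?case using cons_cancel_reduced[OF red] by simp
qed simp

theorem free_basis_lang: "free_basis (free_group X) lang B"
proof -
  let ?ev = "eval_word (free_group X)"
  have sub: "set u \<subseteq> carrier (free_group X) \<times> UNIV" if "u \<in> carrier (free_group B)" for u
    using that B_carrier by (auto simp: carrier_free_group)
  have "?ev \<in> hom (free_group B) (free_group X\<lparr>carrier := lang\<rparr>)"
    using free_group.eval_word_star[OF sub sub] eval_in_lang by (auto simp: hom_def carrier_free_group)
  moreover have "bij_betw ?ev (carrier (free_group B)) lang"
  proof (rule bij_betwI)
    show "?ev \<in> carrier (free_group B) \<rightarrow> lang"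
      using eval_in_lang by (auto simp: carrier_free_group)
    show "reading 1 \<in> lang \<rightarrow> carrier (free_group B)"
      using reading_carrier[of 1] V langD by auto
  qed (use reading_eval eval_reading_lang in auto)
  ultimately show ?thesis
    using subgroup_lang basis_lang(1) by (auto simp: free_basis_def iso_def)
qed

end

section \<open>Rank\<close>

definition exp_sum :: "('g \<Rightarrow> real) \<Rightarrow> 'g word \<Rightarrow> real" where
  "exp_sum f w = (\<Sum>l\<leftarrow>w. if snd l then f (fst l) else - f (fst l))"

lemma exp_sum_simps [simp]:
  "exp_sum f [] = 0"
  "exp_sum f (l # w) = (if snd l then f (fst l) else - f (fst l)) + exp_sum f w"
  by (simp_all add: exp_sum_def)

lemma exp_sum_star: "exp_sum f (u \<star> v) = exp_sum f u + exp_sum f v"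
proof (induction u)
  case (Cons l u)
  have "exp_sum f (cons_cancel l w) = exp_sum f (l # w)" for w
    by (cases w) (auto simp: inv_letter_def)
  then show ?case using Cons by simp
qed simp

text \<open>For a fixed word the value is linear in \<open>f\<close>, with the exponent sums of the
  single basis elements as coefficients; so vanishing on given words is a homogeneous linear system
  for \<open>f\<close>.\<close>

lemma exp_sum_eq:
  assumes "finite B" "set w \<subseteq> B \<times> UNIV"
  shows "exp_sum f w = (\<Sum>b\<in>B. exp_sum (\<lambda>x. if x = b then 1 else 0) w * f b)"
  using assms(2)
proof (induction w)
  case (Cons l w)
  then have "fst l \<in> B" by auto
  have "(\<Sum>b\<in>B. exp_sum (\<lambda>x. if x = b then 1 else 0) (l # w) * f b) =
    (\<Sum>b\<in>B. (if fst l = b then (if snd l then f b else - f b) else 0) + 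
       exp_sum (\<lambda>x. if x = b then 1 else 0) w * f b)"
    by (intro sum.cong) (auto simp: algebra_simps)
  also have "\<dots> = (if snd l then f (fst l) else - f (fst l)) + exp_sum f w"
    using Cons \<open>fst l \<in> B\<close> assms(1) by (simp add: sum.distrib)
  finally show ?case by simp
qed simp

text \<open>Gaussian elimination: an equation with a nonzero coefficient at \<open>c\<close>
  determines \<open>f c\<close>, and substituting it leaves one equation and one unknown
  fewer.\<close>

lemma homogeneous_system:
  fixes a :: "'s \<Rightarrow> 'b \<Rightarrow> real"
  assumes "finite S" "finite B" "card S < card B"
  shows "\<exists>f. (\<exists>b\<in>B. f b \<noteq> 0) \<and> (\<forall>s\<in>S. (\<Sum>b\<in>B. a s b * f b) = 0)"
  using assms
proof (induction S arbitrary: B a rule: finite_induct)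
  case empty
  then have "B \<noteq> {}" by auto
  then show ?case by (intro exI[of _ "\<lambda>_. 1"]) auto
next
  case (insert s S)
  show ?case
  proof (cases "\<forall>b\<in>B. a s b = 0")
    case True
    then show ?thesis using insert.IH[of B a] insert by auto
  next
    case False
    then obtain c where c: "c \<in> B" "a s c \<noteq> 0" by auto
    let ?B = "B - {c}"
    have "\<exists>f. (\<exists>b\<in>?B. f b \<noteq> 0) \<and> (\<forall>t\<in>S. (\<Sum>b\<in>?B. (a t b - a t c * a s b / a s c) * f b) = 0)"
      by (rule insert.IH) (use insert c in auto)
    then obtain f where f: "\<exists>b\<in>?B. f b \<noteq> 0" 
      "\<forall>t\<in>S. (\<Sum>b\<in>?B. (a t b - a t c * a s b / a s c) * f b) = 0"
      by blast
    \<comment> \<open>The value at \<open>c\<close> forced by the equation of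
      \<open>s\<close>.\<close>
    define x where "x = - (\<Sum>b\<in>?B. a s b * f b) / a s c"
    have sum: "(\<Sum>b\<in>B. a t b * (f(c := x)) b) = a t c * x + (\<Sum>b\<in>?B. a t b * f b)" for t
      using insert.prems c by (subst sum.remove[of B c]) auto
    have "(\<Sum>b\<in>B. a t b * (f(c := x)) b) = 0" if "t \<in> S" for t
    proof -
      have "0 = (\<Sum>b\<in>?B. a t b * f b - a t c / a s c * (a s b * f b))"
        using f(2) that by (simp add: left_diff_distrib mult.assoc)
      also have "\<dots> = (\<Sum>b\<in>?B. a t b * f b) - a t c / a s c * (\<Sum>b\<in>?B. a s b * f b)"
        by (simp add: sum_subtractf sum_distrib_left)
      finally show ?thesis unfolding sum by (simp add: x_def)
    qed
    moreover have "(\<Sum>b\<in>B. a s b * (f(c := x)) b) = 0"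
      unfolding sum using c by (simp add: x_def)
    moreover have "\<exists>b\<in>B. (f(c := x)) b \<noteq> 0" using f(1) by auto
    ultimately show ?thesis by (intro exI[of _ "f(c := x)"]) blast
  qed
qed

section \<open>Rank and additive maps on free subgroups\<close>

context group
begin

lemma free_basis_generate:
  assumes "free_basis G H B" shows "H = generate G B"
proof
  have H: "subgroup H G" "B \<subseteq> H" "bij_betw (eval_word G) (carrier (free_group B)) H"
    using assms by (auto simp: free_basis_def iso_def)
  then have B: "B \<subseteq> carrier G" using subgroup.subset by blast
  show "H \<subseteq> generate G B"
    using bij_betw_imp_surj_on[OF H(3)] eval_word_generate[OF _ B] by (auto simp: carrier_free_group)
  show "generate G B \<subseteq> H" using generate_subgroup_incl H by blast
qed

text \<open>The formula for powers later makes the kernel closed under roots, since the reals have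
  no torsion.\<close>

lemma additive_kernel:
  fixes \<phi> :: "'a \<Rightarrow> real"
  assumes H: "subgroup H G" and add: "\<And>g h. g \<in> H \<Longrightarrow> h \<in> H \<Longrightarrow> \<phi> (g \<otimes> h) = \<phi> g + \<phi> h"
  shows "subgroup {g \<in> H. \<phi> g = 0} G" "\<And>g n. g \<in> H \<Longrightarrow> \<phi> (g [^] (n::nat)) = real n * \<phi> g"
proof -
  have one: "\<phi> \<one> = 0" using add[of \<one> \<one>] subgroup.one_closed[OF H] by simp
  have inv: "\<phi> (inv g) = - \<phi> g" if "g \<in> H" for g
    using add[of g "inv g"] that one subgroup.m_inv_closed[OF H] subgroup.subset[OF H] by (auto simp: r_inv)
  show "subgroup {g \<in> H. \<phi> g = 0} G"
    by (rule subgroup.intro)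
      (use H one inv add subgroup.subset[OF H] in \<open>auto simp: subgroup.one_closed subgroup.m_closed subgroup.m_inv_closed\<close>)
  show "\<phi> (g [^] n) = real n * \<phi> g" if "g \<in> H" for g and n :: nat
  proof (induction n)
    case (Suc n)
    have "g [^] n \<in> H" using H that by (induction n) (auto simp: subgroup.one_closed subgroup.m_closed)
    then show ?case using Suc add that by (simp add: algebra_simps)
  qed (simp add: one)
qed

text \<open>Prescribed values on a basis extend to a homomorphism, and fewer elements than basis
  elements impose too few linear conditions to force it to vanish. Both the invariance of the rank
  and the rank bound for the isolator rest on such a map.\<close>

lemma free_basis_additive_map:
  assumes basis: "free_basis G H B" and "finite B" "finite S" "S \<subseteq> H" "card S < card B"
  obtains \<phi> :: "'a \<Rightarrow> real" where
    "\<And>g h. g \<in> H \<Longrightarrow> h \<in> H \<Longrightarrow> \<phi> (g \<otimes> h) = \<phi> g + \<phi> h"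
    "\<And>s. s \<in> S \<Longrightarrow> \<phi> s = 0" "\<exists>h\<in>H. \<phi> h \<noteq> 0"
proof -
  have H: "subgroup H G" "B \<subseteq> H" "bij_betw (eval_word G) (carrier (free_group B)) H"
    using basis by (auto simp: free_basis_def iso_def)
  then have B: "B \<subseteq> carrier G" using subgroup.subset by blast
  \<comment> \<open>Coordinates of an element of \<open>H\<close> as a reduced word over
    \<open>B\<close>.\<close>
  define rep where "rep = inv_into (carrier (free_group B)) (eval_word G)"
  have rep: "rep g \<in> carrier (free_group B)" "eval_word G (rep g) = g" if "g \<in> H" for g
    using that H(3) by (auto simp: rep_def bij_betw_def inv_into_into f_inv_into_f)
  have rep_eval: "rep (eval_word G u) = u" if "u \<in> carrier (free_group B)" for u
    using that H(3) by (simp add: rep_def bij_betw_def)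
  have rep_mult: "rep (g \<otimes> h) = rep g \<star> rep h" if "g \<in> H" "h \<in> H" for g h
  proof -
    have "eval_word G (rep g \<star> rep h) = g \<otimes> h"
      using rep[OF that(1)] rep[OF that(2)] B eval_word_star[of "rep g" "rep h"]
      by (fastforce simp: carrier_free_group)
    moreover have "rep g \<star> rep h \<in> carrier (free_group B)"
      using rep(1)[OF that(1)] rep(1)[OF that(2)] by (intro star_carrier) (auto simp: carrier_free_group)
    ultimately show ?thesis using rep_eval by metis
  qed
  obtain f :: "'a \<Rightarrow> real" where f: "\<exists>b\<in>B. f b \<noteq> 0"
    "\<forall>s\<in>S. (\<Sum>b\<in>B. exp_sum (\<lambda>x. if x = b then 1 else 0) (rep s) * f b) = 0"
    using homogeneous_system[OF assms(3,2,5), of "\<lambda>s b. exp_sum (\<lambda>x. if x = b then 1 else 0) (rep s)"]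
    by blast
  show ?thesis
  proof (rule that[of "\<lambda>g. exp_sum f (rep g)"])
    show "exp_sum f (rep s) = 0" if "s \<in> S" for s
      using f(2) that rep(1)[of s] assms(4) exp_sum_eq[OF assms(2), of "rep s" f]
      by (auto simp: carrier_free_group)
    show "\<exists>h\<in>H. exp_sum f (rep h) \<noteq> 0"
    proof -
      obtain b where b: "b \<in> B" "f b \<noteq> 0" using f(1) by auto
      have "eval_word G [(b, True)] = b" using b B by (auto simp: eval_word_Cons)
      then have "rep b = [(b, True)]" using rep_eval[of "[(b, True)]"] b by (simp add: carrier_free_group)
      then show ?thesis using b H by (intro bexI[of _ b]) auto
    qed
  qed (simp add: rep_mult exp_sum_star)
qed

text \<open>A nonzero additive map killing all of \<open>S\<close> would have a kernel that contains
  the generated subgroup.\<close>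

lemma card_free_basis_le:
  assumes "free_basis G H B" "finite B" "finite S" "H = generate G S" "S \<subseteq> carrier G"
  shows "card B \<le> card S"
proof (rule ccontr)
  assume "\<not> card B \<le> card S"
  then have less: "card S < card B" by simp
  have SH: "S \<subseteq> H" using assms(4) generate.incl[of _ S G] by auto
  have H: "subgroup H G" using assms(1) by (simp add: free_basis_def)
  show False
  proof (rule free_basis_additive_map[OF assms(1-3) SH less])
    fix \<phi> :: "'a \<Rightarrow> real"
    assume \<phi>: "\<And>g h. g \<in> H \<Longrightarrow> h \<in> H \<Longrightarrow> \<phi> (g \<otimes> h) = \<phi> g + \<phi> h"
      "\<And>s. s \<in> S \<Longrightarrow> \<phi> s = 0" "\<exists>h\<in>H. \<phi> h \<noteq> 0"
    have "H \<subseteq> {g \<in> H. \<phi> g = 0}"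
      using generate_subgroup_incl[OF _ additive_kernel(1)[OF H, of \<phi>, OF \<phi>(1)], of S] SH \<phi>(2) assms(4) 
      by auto
    with \<phi>(3) show False by auto
  qed
qed

lemma rk_eq_card:
  assumes "free_basis G H B" "finite B"
  shows "rk G H = card B"
proof -
  have "card B' \<le> card C" if "free_basis G H B'" "finite B'" "free_basis G H C" "finite C" for B' C
    using card_free_basis_le[OF that(1,2,4)] free_basis_generate[OF that(3)] that(3)
    by (metis free_basis_def dual_order.trans subgroup.subset)
  then have "card B' = card B" if "free_basis G H B'" "finite B'" for B'
    using assms that by (metis le_antisym)
  then show ?thesis
    unfolding rk_def using assms by (intro the_equality) (blast, metis)
qed

end


section \<open>Isolators\<close>

context group
begin

lemma isolated_carrier: "isolated G (carrier G)"
  by (auto simp: isolated_def subgroup_self)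

lemma isolator_least: "K \<subseteq> H \<Longrightarrow> isolated G H \<Longrightarrow> isolator G K \<subseteq> H"
  by (auto simp: isolator_def isolated_def)

lemma subset_isolator: "K \<subseteq> isolator G K"
  by (auto simp: isolator_def)

lemma isolated_isolator:
  assumes "K \<subseteq> carrier G"
  shows "isolated G (isolator G K)"
proof -
  \<comment> \<open>The family is nonempty, so its intersection is a subgroup.\<close>
  have "carrier G \<in> {H. K \<subseteq> H \<and> subgroup H G \<and> isolated G H}"
    using assms isolated_carrier subgroup_self by simp
  then have "subgroup (isolator G K) G"
    unfolding isolator_def by (intro subgroups_Inter) auto
  then show ?thesis unfolding isolated_def isolator_def by blast
qed

lemma subgroup_isolator: "K \<subseteq> carrier G \<Longrightarrow> subgroup (isolator G K) G"
  using isolated_isolator by (simp add: isolated_def)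

lemma isolatedI:
  "subgroup H G \<Longrightarrow> (\<And>g n. g \<in> carrier G \<Longrightarrow> 0 < n \<Longrightarrow> g [^] (n::nat) \<in> H \<Longrightarrow> g \<in> H) \<Longrightarrow> isolated G H"
  by (auto simp: isolated_def)

lemma isolatedD: "isolated G H \<Longrightarrow> g \<in> carrier G \<Longrightarrow> 0 < n \<Longrightarrow> g [^] (n::nat) \<in> H \<Longrightarrow> g \<in> H"
  by (auto simp: isolated_def)

text \<open>
  An additive map from the isolator to the reals that vanishes on \<open>K\<close> is zero, because its
  kernel is isolated; so the images of \<open>K\<close> span the rationalized abelianization of the isolator.
\<close>

lemma rank_isolator_le:
  assumes "free_basis G (isolator G K) B" "finite B" "free_basis G K C" "finite C"
  shows "card B \<le> card C"
proof (rule ccontr)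
  assume "\<not> card B \<le> card C"
  then have less: "card C < card B" by simp
  let ?I = "isolator G K"
  have K: "subgroup K G" "C \<subseteq> K" "K = generate G C"
    using assms(3) free_basis_generate[OF assms(3)] by (auto simp: free_basis_def)
  have KI: "K \<subseteq> ?I" by (rule subset_isolator)
  have iso: "isolated G ?I" using isolated_isolator K(1) subgroup.subset by blast
  have I: "subgroup ?I G" using assms(1) by (simp add: free_basis_def)
  show False
  proof (rule free_basis_additive_map[OF assms(1,2,4) order_trans[OF K(2) KI] less])
    fix \<phi> :: "'a \<Rightarrow> real"
    assume \<phi>: "\<And>g h. g \<in> ?I \<Longrightarrow> h \<in> ?I \<Longrightarrow> \<phi> (g \<otimes> h) = \<phi> g + \<phi> h"
      "\<And>s. s \<in> C \<Longrightarrow> \<phi> s = 0" "\<exists>h\<in>?I. \<phi> h \<noteq> 0"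
    let ?N = "{g \<in> ?I. \<phi> g = 0}"
    note ker = additive_kernel[OF I, of \<phi>, OF \<phi>(1)]
    have "isolated G ?N"
    proof (rule isolatedI[OF ker(1)])
      fix g and n :: nat assume g: "g \<in> carrier G" "0 < n" "g [^] n \<in> ?N"
      then have "g \<in> ?I" using isolatedD[OF iso] by auto
      with g ker(2)[of g n] show "g \<in> ?N" by auto
    qed
    moreover have "K \<subseteq> ?N"
      using generate_subgroup_incl[OF _ ker(1), of C] K KI \<phi>(2) by auto
    ultimately have "?I \<subseteq> ?N" by (intro isolator_least)
    with \<phi>(3) show False by auto
  qed
qed

end


section \<open>Free factors\<close>

context group
begin

lemma inv_cancel_left:
  "x \<in> carrier G \<Longrightarrow> y \<in> carrier G \<Longrightarrow> inv x \<otimes> (x \<otimes> y) = y"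
  "x \<in> carrier G \<Longrightarrow> y \<in> carrier G \<Longrightarrow> x \<otimes> (inv x \<otimes> y) = y"
  by (simp_all add: m_assoc[symmetric])

section \<open>Normal forms in a free product\<close>

abbreviation alt_prod :: "(bool \<times> 'a) list \<Rightarrow> 'a" where
  "alt_prod ps \<equiv> foldr (\<lambda>p y. snd p \<otimes> y) ps \<one>"

lemma alternating_Nil [simp]: "alternating G A B []"
  by (simp add: alternating_def)

lemma alternating_append_iff:
  "alternating G A B (ps @ qs) \<longleftrightarrow> alternating G A B ps \<and> alternating G A B qs \<and>
    (ps \<noteq> [] \<longrightarrow> qs \<noteq> [] \<longrightarrow> fst (last ps) \<noteq> fst (hd qs))"
  by (auto simp: alternating_def successively_append_iff)

lemma alternating_single [simp]:
  "alternating G A B [p] \<longleftrightarrow> snd p \<in> (if fst p then A else B) - {\<one>}"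
  by (cases p) (simp add: alternating_def)

lemma alternating_Cons_iff:
  "alternating G A B (p # qs) \<longleftrightarrow> snd p \<in> (if fst p then A else B) - {\<one>} \<and> alternating G A B qs \<and>
    (qs \<noteq> [] \<longrightarrow> fst p \<noteq> fst (hd qs))"
  using alternating_append_iff[of A B "[p]" qs] by auto

context
  fixes A B :: "'a set"
  assumes A: "subgroup A G" and B: "subgroup B G"
begin

lemma alternating_carrier: "alternating G A B ps \<Longrightarrow> snd ` set ps \<subseteq> carrier G"
  using subgroup.subset[OF A] subgroup.subset[OF B] by (force simp: alternating_def split: if_splits)

lemma alt_prod_closed: "snd ` set ps \<subseteq> carrier G \<Longrightarrow> alt_prod ps \<in> carrier G"
  by (induction ps) auto

lemma alt_prod_append:
  "snd ` set ps \<subseteq> carrier G \<Longrightarrow> snd ` set qs \<subseteq> carrier G \<Longrightarrow> alt_prod (ps @ qs) = alt_prod ps \<otimes> alt_prod qs"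
  by (induction ps) (auto simp: alt_prod_closed m_assoc)

text \<open>Reverse the list and invert each entry. The end conditions are recorded because the
  inverse is later spliced between elements of \<open>A\<close>.\<close>

lemma alternating_inverse:
  assumes "alternating G A B ps"
  obtains qs where "alternating G A B qs" "alt_prod qs = inv (alt_prod ps)"
    "ps \<noteq> [] \<Longrightarrow> qs \<noteq> [] \<and> fst (hd qs) = fst (last ps) \<and> fst (last qs) = fst (hd ps)"
    "ps = [] \<Longrightarrow> qs = []"
  using assms
proof (induction ps arbitrary: thesis)
  case Nil
  then show ?case by (metis alternating_Nil foldr.simps(1) id_apply inv_one)
next
  case (Cons p ps)
  then have p: "snd p \<in> (if fst p then A else B) - {\<one>}" and ps: "alternating G A B ps"
    by (auto simp: alternating_Cons_iff)
  obtain qs where qs: "alternating G A B qs" "alt_prod qs = inv (alt_prod ps)"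
    "ps \<noteq> [] \<Longrightarrow> qs \<noteq> [] \<and> fst (hd qs) = fst (last ps) \<and> fst (last qs) = fst (hd ps)"
    and empty: "ps = [] \<Longrightarrow> qs = []"
    using Cons.IH[OF _ ps] by blast
  have pc: "snd p \<in> carrier G" using p subgroup.subset[OF A] subgroup.subset[OF B] by (auto split: if_splits)
  have psc: "alt_prod ps \<in> carrier G" using alternating_carrier[OF ps] by (rule alt_prod_closed)
  have "inv (snd p) \<in> (if fst p then A else B) - {\<one>}"
    using p pc subgroup.m_inv_closed[OF A] subgroup.m_inv_closed[OF B] inv_eq_1_iff[OF pc] by (auto split: if_splits)
  then have "alternating G A B (qs @ [(fst p, inv (snd p))])"
    using qs Cons.prems(2) empty
    by (cases "ps = []") (auto simp: alternating_append_iff alternating_Cons_iff)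
  moreover have "alt_prod (qs @ [(fst p, inv (snd p))]) = inv (alt_prod (p # ps))"
    using alt_prod_append[OF alternating_carrier[OF qs(1)], of "[(fst p, inv (snd p))]"] qs(2) pc psc
    by (simp add: inv_mult_group)
  ultimately show ?case
    by (rule Cons.prems(1)) (use qs(3) empty in \<open>cases "ps = []"; simp\<close>)+
qed

text \<open>A nontrivial factor is prepended, merged with a first syllable from the same side, or
  cancels that syllable.\<close>

lemma alternating_mult:
  assumes "alternating G A B ps" "x \<in> (if i then A else B)"
  obtains qs where "alternating G A B qs" "alt_prod qs = x \<otimes> alt_prod ps"
proof -
  have x: "x \<in> carrier G" using assms(2) subgroup.subset[OF A] subgroup.subset[OF B] by (auto split: if_splits)
  have c: "alt_prod ps \<in> carrier G" using alternating_carrier[OF assms(1)] by (rule alt_prod_closed)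
  show ?thesis
  proof (cases "x = \<one>")
    case True
    then show ?thesis using that[OF assms(1)] c by simp
  next
    case x1: False
    show ?thesis
    proof (cases "ps = [] \<or> fst (hd ps) \<noteq> i")
      case True
      then show ?thesis using that[of "(i, x) # ps"] assms x1 by (auto simp: alternating_Cons_iff)
    next
      case False
      then obtain y qs where ps: "ps = (i, y) # qs" by (cases ps) auto
      then have y: "y \<in> (if i then A else B)" and qs: "alternating G A B qs"
        using assms(1) by (auto simp: alternating_Cons_iff)
      then have yc: "y \<in> carrier G" "alt_prod qs \<in> carrier G"
        using subgroup.subset[OF A] subgroup.subset[OF B] alternating_carrier[OF qs] 
        by (auto split: if_splits intro: alt_prod_closed)
      have xy: "x \<otimes> y \<in> (if i then A else B)"
        using assms(2) y subgroup.m_closed[OF A] subgroup.m_closed[OF B] by (auto split: if_splits)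
      have eq: "x \<otimes> alt_prod ps = (x \<otimes> y) \<otimes> alt_prod qs"
        using x yc by (simp add: ps m_assoc)
      show ?thesis
      proof (cases "x \<otimes> y = \<one>")
        case True
        then show ?thesis using that[OF qs] eq yc by simp
      next
        case False
        then show ?thesis using that[of "(i, x \<otimes> y) # qs"] eq xy assms(1) 
          by (auto simp: alternating_Cons_iff ps)
      qed
    qed
  qed
qed

text \<open>Generalizing over an alternating product on the right turns membership in the generated
  subgroup into repeated use of \<open>alternating_mult\<close>.\<close>

lemma generate_alternating:
  assumes "h \<in> generate G (A \<union> B)"
  obtains ps where "alternating G A B ps" "alt_prod ps = h"
proof -
  have "\<exists>qs. alternating G A B qs \<and> alt_prod qs = h \<otimes> alt_prod ps" if "alternating G A B ps" for ps
    using assms that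
  proof (induction h arbitrary: ps rule: generate.induct)
    case one
    then show ?case using alt_prod_closed[OF alternating_carrier] by auto
  next
    case (incl h)
    then show ?case by (metis Un_iff alternating_mult)
  next
    case (inv h)
    then have "inv h \<in> A \<or> inv h \<in> B" 
      using subgroup.m_inv_closed[OF A, of h] subgroup.m_inv_closed[OF B, of h] by auto
    then show ?case using inv(2) by (metis alternating_mult)
  next
    case (eng h1 h2)
    then have c: "h1 \<in> carrier G" "h2 \<in> carrier G"
      using generate_in_carrier[of "A \<union> B"] subgroup.subset[OF A] subgroup.subset[OF B] by auto
    obtain qs where qs: "alternating G A B qs" "alt_prod qs = h2 \<otimes> alt_prod ps" using eng by blast
    with eng.IH(1)[OF qs(1)] show ?case
      using c alt_prod_closed[OF alternating_carrier[OF eng.prems]] by (simp add: m_assoc)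
  qed
  from this[of "[]"] that show ?thesis
    using assms generate_in_carrier[of "A \<union> B" h] subgroup.subset[OF A] subgroup.subset[OF B] by auto
qed

text \<open>Peeling off syllables from \<open>A\<close> at both ends leaves a core that is empty or
  starts and ends in \<open>B\<close>, so that elements of \<open>A\<close> can be placed next to it
  without losing alternation.\<close>

lemma alternating_strip:
  assumes "alternating G A B ps"
  obtains y qs z where "y \<in> A" "z \<in> A" "alternating G A B qs" "alt_prod ps = y \<otimes> alt_prod qs \<otimes> z"
    "qs = [] \<or> \<not> fst (hd qs) \<and> \<not> fst (last qs)"
proof -
  have one: "\<one> \<in> A" using A by (rule subgroup.one_closed)
  have Ac: "A \<subseteq> carrier G" by (rule subgroup.subset[OF A])
  obtain y ps' where ps': "y \<in> A" "alternating G A B ps'" "alt_prod ps = y \<otimes> alt_prod ps'"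
    "ps' = [] \<or> \<not> fst (hd ps')"
  proof (cases "ps = [] \<or> \<not> fst (hd ps)")
    case True
    then show ?thesis 
      using that[OF one assms] alt_prod_closed[OF alternating_carrier[OF assms]] by simp
  next
    case False
    then show ?thesis using that[of "snd (hd ps)" "tl ps"] assms
      by (cases ps) (auto simp: alternating_Cons_iff)
  qed
  have c: "alt_prod ps' \<in> carrier G" using alt_prod_closed[OF alternating_carrier[OF ps'(2)]] .
  show ?thesis
  proof (cases "ps' = [] \<or> \<not> fst (last ps')")
    case True
    then show ?thesis using that[OF ps'(1) one ps'(2)] ps' c Ac by auto
  next
    case False
    then obtain qs p where qs: "ps' = qs @ [p]" "fst p" by (metis rev_exhaust last_snoc)
    then have alt: "alternating G A B qs" "snd p \<in> A" 
      using ps'(2) by (auto simp: alternating_append_iff)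
    have "alt_prod ps' = alt_prod qs \<otimes> snd p"
      using alt_prod_append[OF alternating_carrier[OF alt(1)], of "[p]"] alt(2) Ac qs(1) by auto
    then have "alt_prod ps = y \<otimes> alt_prod qs \<otimes> snd p"
      using ps'(1,3) Ac alt(2) alt_prod_closed[OF alternating_carrier[OF alt(1)]] 
      by (simp add: m_assoc subset_iff)
    then show ?thesis
      by (rule that[OF ps'(1) alt(2) alt(1)]) (use qs ps' in \<open>auto simp: alternating_append_iff\<close>)
  qed
qed

text \<open>Write \<open>h = y g z\<close> with \<open>y\<close>, \<open>z\<close> in
  \<open>A\<close> and a core \<open>g\<close> that starts and ends in \<open>B\<close>. If the core
  is nonempty, commutation with \<open>a\<close> yields \<open>g b g^-1 b' = 1\<close> for
  nontrivial \<open>b\<close>, \<open>b'\<close> in \<open>A\<close>, an alternating product that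
  cannot be trivial. Centralizers are the case that matters for roots, since an element commutes
  with its powers.\<close>

lemma free_factor_malnormal:
  assumes free: "internal_free_product G H A B"
    and h: "h \<in> H" and a: "a \<in> A" "a \<noteq> \<one>" and a': "h \<otimes> a = a \<otimes> h"
  shows "h \<in> A"
proof -
  have Ac: "A \<subseteq> carrier G" by (rule subgroup.subset[OF A])
  obtain ps where ps: "alternating G A B ps" "alt_prod ps = h"
    using generate_alternating free h by (auto simp: internal_free_product_def)
  from alternating_strip[OF ps(1)] obtain y qs z where
    yz: "y \<in> A" "z \<in> A" and qs: "alternating G A B qs" "qs = [] \<or> \<not> fst (hd qs) \<and> \<not> fst (last qs)" 
    and h_eq: "h = y \<otimes> alt_prod qs \<otimes> z" using ps(2) by metis
  show ?thesis
  proof (cases "qs = []")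
    case True
    then show ?thesis using yz h_eq Ac subgroup.m_closed[OF A] by auto
  next
    case False
    define g where "g = alt_prod qs"
    have c: "y \<in> carrier G" "z \<in> carrier G" "a \<in> carrier G" "g \<in> carrier G"
      using yz a Ac alt_prod_closed[OF alternating_carrier[OF qs(1)]] by (auto simp: g_def)
    \<comment> \<open>Conjugation moves \<open>y\<close> and \<open>z\<close> over to
      \<open>a\<close>: the relation \<open>y g z a = a y g z\<close> becomes
      \<open>g b = inv b' g\<close>.\<close>
    define b where "b = z \<otimes> a \<otimes> inv z"
    define b' where "b' = inv (inv y \<otimes> a \<otimes> y)"
    have b: "b \<in> A" "b \<noteq> \<one>" "b' \<in> A" "b' \<noteq> \<one>"
    proof -
      show "b \<in> A" "b' \<in> A"
        using yz a A by (auto simp: b_def b'_def intro!: subgroup.m_closed subgroup.m_inv_closed)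
      have "inv z \<otimes> b \<otimes> z = a" using c by (simp add: b_def m_assoc inv_cancel_left)
      then show "b \<noteq> \<one>" using a(2) c by auto
      have "y \<otimes> inv b' \<otimes> inv y = a" using c by (simp add: b'_def m_assoc inv_cancel_left)
      then show "b' \<noteq> \<one>" using a(2) c by auto
    qed
    have bc: "b \<in> carrier G" "b' \<in> carrier G" using b Ac by auto
    obtain rs where rs: "alternating G A B rs" "alt_prod rs = inv g"
      "rs \<noteq> []" "fst (hd rs) = fst (last qs)" "fst (last rs) = fst (hd qs)"
      using alternating_inverse[OF qs(1)] False unfolding g_def by metis
    let ?ls = "qs @ (True, b) # rs @ [(True, b')]"
    have "alternating G A B ?ls"
      using qs rs b False by (auto simp: alternating_append_iff alternating_Cons_iff)
    then have "alt_prod ?ls \<noteq> \<one>" using free by (auto simp: internal_free_product_def)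
    moreover have "alt_prod ?ls = g \<otimes> (b \<otimes> (inv g \<otimes> b'))"
      using alternating_carrier[OF qs(1)] alternating_carrier[OF rs(1)] bc rs(2)
      by (simp add: alt_prod_append g_def del: foldr_append)
    moreover have "\<dots> = \<one>"
    proof -
      have "y \<otimes> (g \<otimes> b) \<otimes> z = h \<otimes> a"
        using c by (simp add: h_eq g_def[symmetric] b_def m_assoc inv_cancel_left)
      also have "\<dots> = y \<otimes> (inv b' \<otimes> g) \<otimes> z"
        unfolding a' using c by (simp add: h_eq g_def[symmetric] b'_def m_assoc inv_cancel_left)
      finally have "g \<otimes> b = inv b' \<otimes> g" using c bc by simp
      then have "g \<otimes> b \<otimes> inv g \<otimes> b' = \<one>" using c bc by (simp add: m_assoc)
      then show ?thesis using c bc by (simp add: m_assoc)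
    qed
    ultimately show ?thesis by simp
  qed
qed

end

section \<open>Isolators as algebraic extensions\<close>

definition torsion_free :: bool where
  "torsion_free \<longleftrightarrow> (\<forall>g\<in>carrier G. \<forall>n::nat. 0 < n \<and> g [^] n = \<one> \<longrightarrow> g = \<one>)"

lemma algebraic_extension_isolator:
  assumes K: "subgroup K G" and tf: torsion_free
  shows "algebraic_extension G K (isolator G K)"
proof -
  let ?I = "isolator G K"
  have Kc: "K \<subseteq> carrier G" using K by (rule subgroup.subset)
  have iso: "isolated G ?I" using isolated_isolator[OF Kc] .
  have False if free: "internal_free_product G ?I A C" and C: "C \<noteq> {\<one>}" and KA: "K \<subseteq> A" for A C
  proof -
    have sub: "subgroup A G" "subgroup C G" and I: "?I = generate G (A \<union> C)"
      using free by (auto simp: internal_free_product_def)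
    have "isolated G A"
    proof (rule isolatedI[OF sub(1)])
      fix g and n :: nat assume g: "g \<in> carrier G" "0 < n" "g [^] n \<in> A"
      show "g \<in> A"
      \<comment> \<open>The centralizer argument needs a nontrivial element of \<open>A\<close>; a
        trivial power is covered by torsion-freeness.\<close>
      proof (cases "g [^] n = \<one>")
        case True
        then have "g = \<one>" using tf g(1,2) unfolding torsion_free_def by blast
        then show ?thesis using subgroup.one_closed[OF sub(1)] by simp
      next
        case False
        have "g [^] n \<in> ?I" unfolding I using g(3) generate.incl[of "g [^] n" "A \<union> C" G] by simp
        then have "g \<in> ?I" using isolatedD[OF iso g(1,2)] by simp
        moreover have "g \<otimes> g [^] n = g [^] n \<otimes> g" using g(1) nat_pow_Suc2[of g n] by simp
        ultimately show ?thesis using free_factor_malnormal[OF sub free] g False by blast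
      qed
    qed
    then have "?I \<subseteq> A" using isolator_least KA by blast
    moreover obtain c where c: "c \<in> C" "c \<noteq> \<one>" using C subgroup.one_closed[OF sub(2)] by auto
    ultimately have "c \<in> A" unfolding I using generate.incl[of c "A \<union> C" G] by auto
    \<comment> \<open>An element \<open>c\<close> taken from \<open>A\<close>, followed by its
      inverse taken from \<open>C\<close>, is an alternating product that is trivial.\<close>
    then have "alternating G A C [(True, c), (False, inv c)]"
      using c subgroup.m_inv_closed[OF sub(2)] subgroup.subset[OF sub(2)] inv_eq_1_iff[of c]
      by (auto simp: alternating_Cons_iff)
    then have "alt_prod [(True, c), (False, inv c)] \<noteq> \<one>" using free by (auto simp: internal_free_product_def)
    moreover have "c \<in> carrier G" using c subgroup.subset[OF sub(2)] by auto
    ultimately show False by simp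
  qed
  then show ?thesis
    using K subgroup_isolator[OF Kc] subset_isolator[of K] 
    by (auto simp: algebraic_extension_def free_extension_def)
qed

lemma minimal_isolated_algebraic_iff:
  assumes K: "subgroup K G" and tf: torsion_free
  shows "minimal_isolated_algebraic G K M \<longleftrightarrow> M = isolator G K"
proof
  have least: "isolator G K \<subseteq> N" if "algebraic_extension G K N" "isolated G N" for N
    using that isolator_least by (auto simp: algebraic_extension_def)
  have I: "algebraic_extension G K (isolator G K)" "isolated G (isolator G K)"
    using algebraic_extension_isolator[OF assms] isolated_isolator[OF subgroup.subset[OF K]] .
  show "M = isolator G K" if "minimal_isolated_algebraic G K M"
    using that I least[of M] unfolding minimal_isolated_algebraic_def by metis
  show "minimal_isolated_algebraic G K M" if "M = isolator G K"
    using that I least by (auto simp: minimal_isolated_algebraic_def)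
qed

end

section \<open>Finite parts of coset graphs\<close>

text \<open>Equality of the right cosets \<open>H u\<close> and \<open>H v\<close>, the vertices of
  the coset graph.\<close>

definition same_coset :: "'a word set \<Rightarrow> 'a word \<Rightarrow> 'a word \<Rightarrow> bool" where
  "same_coset H u v \<longleftrightarrow> (\<exists>h\<in>H. u = h \<star> v)"

text \<open>Vertices of a finite tree in the coset graph, one representative per coset, starting
  with the coset \<open>H\<close> itself; every later one continues an earlier one by a letter. The
  order of the list supplies the numbering of the vertices.\<close>

definition tree_list :: "'a set \<Rightarrow> 'a word set \<Rightarrow> 'a word list \<Rightarrow> bool" where
  "tree_list X H ts \<longleftrightarrow> ts \<noteq> [] \<and> ts ! 0 = [] \<and> set ts \<subseteq> carrier (free_group X) \<and>
    (\<forall>i<length ts. 0 < i \<longrightarrow> (\<exists>j<i. \<exists>l\<in>X \<times> UNIV. ts ! i = ts ! j \<star> [l])) \<and>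
    (\<forall>i<length ts. \<forall>j<length ts. same_coset H (ts ! i) (ts ! j) \<longrightarrow> i = j)"

locale free_subgroup =
  fixes X :: "'a set" and H
  assumes subgroup: "subgroup H (free_group X)"
begin

lemmas subgroup_simps = subgroup_free_groupD[OF subgroup]

lemma same_coset_refl: "same_coset H u u"
  using subgroup_simps(2) by (auto simp: same_coset_def intro!: bexI[of _ "[]"])

lemma same_coset_sym: "reduced v \<Longrightarrow> same_coset H u v \<Longrightarrow> same_coset H v u"
  unfolding same_coset_def using subgroup_simps(4) star_winv_left by metis

lemma same_coset_trans: "reduced w \<Longrightarrow> same_coset H u v \<Longrightarrow> same_coset H v w \<Longrightarrow> same_coset H u w"
  unfolding same_coset_def using subgroup_simps(3) star_assoc by metis

lemma same_coset_star: "reduced w \<Longrightarrow> same_coset H u v \<Longrightarrow> same_coset H (u \<star> w) (v \<star> w)"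
  unfolding same_coset_def using star_assoc by metis

lemma reducedI: "w \<in> carrier (free_group X) \<Longrightarrow> reduced w"
  by (simp add: carrier_free_group)

text \<open>A new vertex is appended at the end, so earlier vertices keep their numbers and the
  cosets already covered remain covered.\<close>

lemma tree_list_extend:
  assumes ts: "tree_list X H ts" and t: "t \<in> set ts" and l: "l \<in> X \<times> UNIV"
  shows "\<exists>ts'. tree_list X H (ts @ ts') \<and> (\<exists>t'\<in>set (ts @ ts'). same_coset H (t \<star> [l]) t')"
proof (cases "\<exists>t'\<in>set ts. same_coset H (t \<star> [l]) t'")
  case True
  then show ?thesis using ts by (intro exI[of _ "[]"]) auto
next
  case False
  let ?u = "t \<star> [l]"
  have tc: "t \<in> carrier (free_group X)" using ts t by (auto simp: tree_list_def)
  then have u: "?u \<in> carrier (free_group X)" 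
    using l by (intro star_carrier) (auto simp: carrier_free_group)
  have no: "\<not> same_coset H ?u (ts ! i)" "\<not> same_coset H (ts ! i) ?u" if "i < length ts" for i
    using nth_mem[OF that] False same_coset_sym[of "?u" "ts ! i"] reducedI[OF u] by blast+
  obtain k where k: "k < length ts" "t = ts ! k" using t by (auto simp: in_set_conv_nth)
  have "tree_list X H (ts @ [?u])"
    unfolding tree_list_def
  proof (intro conjI allI impI)
    fix i assume i: "i < length (ts @ [?u])" "0 < i"
    show "\<exists>j<i. \<exists>l\<in>X \<times> UNIV. (ts @ [?u]) ! i = (ts @ [?u]) ! j \<star> [l]"
    proof (cases "i < length ts")
      case True
      then obtain j l where "j < i" "l \<in> X \<times> UNIV" "ts ! i = ts ! j \<star> [l]"
        using ts i unfolding tree_list_def by blast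
      then show ?thesis using True by (auto simp: nth_append intro!: exI[of _ j])
    next
      case False
      then show ?thesis using i k l by (auto simp: nth_append intro!: exI[of _ k])
    qed
  next
    fix i j assume ij: "i < length (ts @ [?u])" "j < length (ts @ [?u])"
      and same: "same_coset H ((ts @ [?u]) ! i) ((ts @ [?u]) ! j)"
    show "i = j"
    proof (cases "i < length ts \<and> j < length ts")
      case True
      then show ?thesis using ts same unfolding tree_list_def by (auto simp: nth_append)
    next
      case False
      then show ?thesis using ij no same by (auto simp: nth_append less_Suc_eq split: if_splits)
    qed
  qed (use ts u in \<open>auto simp: tree_list_def nth_append\<close>)
  then show ?thesis using same_coset_refl by (intro exI[of _ "[?u]"]) auto
qed

text \<open>The cosets of the prefixes of \<open>w\<close> are the vertices that its path visits;
  adding them one letter at a time keeps the tree condition.\<close>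

lemma tree_list_cover_word:
  assumes "tree_list X H ts" "set w \<subseteq> X \<times> UNIV"
  shows "\<exists>ts'. tree_list X H (ts @ ts') \<and>
    (\<forall>i\<le>length w. \<exists>t\<in>set (ts @ ts'). same_coset H (take i w \<star> []) t)"
  using assms(2)
proof (induction w rule: rev_induct)
  case Nil
  have "[] \<in> set ts" using assms(1) nth_mem[of 0 ts] by (auto simp: tree_list_def)
  then show ?case using assms(1) same_coset_refl by (intro exI[of _ "[]"]) auto
next
  case (snoc l w)
  then obtain ts' where ts': "tree_list X H (ts @ ts')"
    "\<forall>i\<le>length w. \<exists>t\<in>set (ts @ ts'). same_coset H (take i w \<star> []) t" by auto
  then obtain t where t: "t \<in> set (ts @ ts')" "same_coset H (w \<star> []) t" by (metis order_refl take_all)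
  obtain ts'' t' where ts'': "tree_list X H ((ts @ ts') @ ts'')" "t' \<in> set ((ts @ ts') @ ts'')" "same_coset H (t \<star> [l]) t'"
    using tree_list_extend[OF ts'(1) t(1), of l] snoc.prems by auto
  have "reduced t'" using ts'' by (auto simp: tree_list_def carrier_free_group)
  then have "same_coset H ((w \<star> []) \<star> [l]) t'"
    using same_coset_trans[OF _ same_coset_star[OF _ t(2)] ts''(3)] by simp
  then have last: "same_coset H ((w @ [l]) \<star> []) t'" by (simp add: star_assoc)
  have "\<exists>t\<in>set (ts @ ts' @ ts''). same_coset H (take i (w @ [l]) \<star> []) t" if "i \<le> length (w @ [l])" for i
  proof (cases "i \<le> length w")
    case True
    then show ?thesis using ts'(2) by fastforce
  next
    case False
    then show ?thesis using that last ts''(2) by (intro bexI[of _ t']) auto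
  qed
  then show ?case using ts''(1) by (intro exI[of _ "ts' @ ts''"]) auto
qed

lemma tree_list_cover:
  assumes "\<And>w. w \<in> set ws \<Longrightarrow> set w \<subseteq> X \<times> UNIV"
  shows "\<exists>ts. tree_list X H ts \<and>
    (\<forall>w\<in>set ws. \<forall>i\<le>length w. \<exists>t\<in>set ts. same_coset H (take i w \<star> []) t)"
  using assms
proof (induction ws)
  case Nil
  show ?case by (intro exI[of _ "[[]]"]) (auto simp: tree_list_def)
next
  case (Cons w ws)
  then obtain ts where ts: "tree_list X H ts"
    "\<forall>w\<in>set ws. \<forall>i\<le>length w. \<exists>t\<in>set ts. same_coset H (take i w \<star> []) t" by auto
  from tree_list_cover_word[OF ts(1), of w] Cons.prems obtain ts' where
    "tree_list X H (ts @ ts')" "\<forall>i\<le>length w. \<exists>t\<in>set (ts @ ts'). same_coset H (take i w \<star> []) t" by auto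
  then show ?case using ts(2) by (intro exI[of _ "ts @ ts'"]) fastforce
qed

end

section \<open>The graph on a finite list of cosets\<close>

locale coset_graph = free_subgroup +
  fixes ts
  assumes tree_list: "tree_list X H ts"
begin

text \<open>One more than the number of cosets, because state \<open>0\<close> is reserved for
  missing edges; vertex \<open>q\<close> carries the entry of \<open>ts\<close> at position
  \<open>q - 1\<close>.\<close>

definition V where "V = Suc (length ts)"

definition T where "T q = ts ! (q - 1)"

text \<open>All edges of the coset graph between listed cosets are kept, not only those of the tree.
  Distinct entries represent distinct cosets, so at most one \<open>r\<close> qualifies; this is
  \<open>delta_eqI\<close>.\<close>

definition \<delta> where
  "\<delta> q l = (if 0 < q \<and> q < V \<and> (\<exists>r>0. r < V \<and> same_coset H (T q \<star> [l]) (T r))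
            then SOME r. 0 < r \<and> r < V \<and> same_coset H (T q \<star> [l]) (T r) else 0)"

lemma one_less_V: "1 < V"
  using tree_list by (simp add: V_def tree_list_def)

lemma T_1: "T 1 = []"
  using tree_list by (simp add: T_def tree_list_def)

lemma T_carrier: "0 < q \<Longrightarrow> q < V \<Longrightarrow> T q \<in> carrier (free_group X)"
  using tree_list by (auto simp: T_def V_def tree_list_def)

lemma T_reduced: "0 < q \<Longrightarrow> q < V \<Longrightarrow> reduced (T q)"
  using T_carrier reducedI by blast

lemma T_inj: "0 < q \<Longrightarrow> q < V \<Longrightarrow> 0 < r \<Longrightarrow> r < V \<Longrightarrow> same_coset H (T q) (T r) \<Longrightarrow> q = r"
proof -
  assume "0 < q" "q < V" "0 < r" "r < V" "same_coset H (T q) (T r)"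
  then have "q - 1 = r - 1" using tree_list unfolding tree_list_def T_def V_def by auto
  then show ?thesis using \<open>0 < q\<close> \<open>0 < r\<close> by simp
qed

lemma delta_D: 
  assumes "\<delta> q l \<noteq> 0"
  shows "0 < q" "q < V" "\<delta> q l < V" "same_coset H (T q \<star> [l]) (T (\<delta> q l))"
proof -
  have ex: "0 < q \<and> q < V \<and> (\<exists>r>0. r < V \<and> same_coset H (T q \<star> [l]) (T r))"
    using assms by (metis \<delta>_def)
  then show "0 < q" "q < V" by auto
  have "0 < \<delta> q l \<and> \<delta> q l < V \<and> same_coset H (T q \<star> [l]) (T (\<delta> q l))"
    unfolding \<delta>_def using ex by (simp only: if_True simp_thms) (rule someI_ex, auto)
  then show "\<delta> q l < V" "same_coset H (T q \<star> [l]) (T (\<delta> q l))" by auto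
qed

lemma delta_eqI:
  assumes "0 < q" "q < V" "0 < r" "r < V" "same_coset H (T q \<star> [l]) (T r)"
  shows "\<delta> q l = r"
proof -
  have "\<exists>r. 0 < r \<and> r < V \<and> same_coset H (T q \<star> [l]) (T r)" using assms by blast
  from someI_ex[OF this] have "\<delta> q l \<noteq> 0" using assms by (auto simp: \<delta>_def)
  note d = delta_D[OF this]
  have "same_coset H (T (\<delta> q l)) (T q \<star> [l])"
    using same_coset_sym[OF _ d(4)] T_reduced \<open>\<delta> q l \<noteq> 0\<close> d(3) by simp
  then have "same_coset H (T (\<delta> q l)) (T r)"
    using same_coset_trans assms(5) T_reduced[OF assms(3,4)] by blast
  then show ?thesis using T_inj d \<open>\<delta> q l \<noteq> 0\<close> assms by simp
qed

text \<open>Right multiplication by a letter permutes the cosets and is undone by the inverse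
  letter, so every edge can be traversed backwards.\<close>

sublocale folded_graph X V \<delta>
proof
  show "\<delta> (\<delta> q l) (inv_letter l) = q" if "\<delta> q l \<noteq> 0" for q l
  proof -
    note d = delta_D[OF that]
    have "same_coset H (T (\<delta> q l) \<star> [inv_letter l]) ((T q \<star> [l]) \<star> [inv_letter l])"
      using same_coset_star[OF _ same_coset_sym[OF _ d(4)]] T_reduced that d(3) by simp
    also have "(T q \<star> [l]) \<star> [inv_letter l] = T q"
      using star_assoc[of "[inv_letter l]" "T q" "[l]"] T_reduced[OF d(1,2)] by (simp add: star_Nil)
    finally show ?thesis
      using delta_eqI[of "\<delta> q l" q "inv_letter l"] that d(1-3) by simp
  qed
  show "\<delta> q l < V" for q l using delta_D(3)[of q l] one_less_V by (cases "\<delta> q l = 0") auto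
qed (use one_less_V in \<open>auto simp: \<delta>_def\<close>)

text \<open>Each edge multiplies the coset by its letter. Hence a closed path at the base point has
  its label in \<open>H\<close>; the converse holds for words whose prefixes are all
  covered.\<close>

lemma run_coset:
  "0 < q \<Longrightarrow> q < V \<Longrightarrow> set w \<subseteq> X \<times> UNIV \<Longrightarrow> foldl \<delta> q w \<noteq> 0 \<Longrightarrow>
    same_coset H (T q \<star> w \<star> []) (T (foldl \<delta> q w))"
proof (induction w arbitrary: q)
  case Nil
  then show ?case using same_coset_refl T_reduced by (simp add: star_Nil)
next
  case (Cons l w)
  have alive: "\<delta> q l \<noteq> 0" using Cons.prems run_prefix_alive[of w q "[l]"] by auto
  note d = delta_D[OF this]
  have "same_coset H ((T q \<star> [l]) \<star> (w \<star> [])) (T (\<delta> q l) \<star> (w \<star> []))"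
    by (rule same_coset_star[OF _ d(4)]) simp
  moreover have "same_coset H (T (\<delta> q l) \<star> (w \<star> [])) (T (foldl \<delta> (\<delta> q l) w))"
    using Cons alive d by simp
  moreover have "reduced (T (foldl \<delta> (\<delta> q l) w))"
    using Cons.prems run_bounded[of "\<delta> q l" w] d by (intro T_reduced) auto
  ultimately have "same_coset H ((T q \<star> [l]) \<star> (w \<star> [])) (T (foldl \<delta> (\<delta> q l) w))"
    using same_coset_trans by blast
  then show ?case using star_assoc[of "w \<star> []" "T q" "[l]"] by simp
qed

lemma lang_subset: "lang \<subseteq> H"
proof
  fix w assume w: "w \<in> lang"
  then have "same_coset H (T 1 \<star> w \<star> []) (T 1)"
    using run_coset[of 1 w] one_less_V by (auto simp: lang_def carrier_free_group)
  then show "w \<in> H" 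
    using w subgroup_simps(1) unfolding T_1 
    by (auto simp: same_coset_def star_Nil lang_def carrier_free_group subset_iff)
qed

text \<open>Inductively the path of \<open>w\<close> stays on the graph, since the coset of each
  next prefix is listed; it ends at the coset of \<open>w\<close>, which is \<open>H\<close>, so it
  is closed.\<close>

lemma covered_in_lang:
  assumes w: "w \<in> H" and cover: "\<And>i. i \<le> length w \<Longrightarrow> \<exists>t\<in>set ts. same_coset H (take i w \<star> []) t"
  shows "w \<in> lang"
proof -
  have wc: "w \<in> carrier (free_group X)" using w subgroup_simps(1) by auto
  then have letters: "set w \<subseteq> X \<times> UNIV" "reduced w" by (auto simp: carrier_free_group)
  have alive: "foldl \<delta> 1 (take i w) \<noteq> 0" if "i \<le> length w" for i
    using that
  proof (induction i)
    case (Suc i)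
    define l where "l = w ! i"
    define r where "r = foldl \<delta> 1 (take i w)"
    have take: "take (Suc i) w = take i w @ [l]" using Suc.prems by (simp add: take_Suc_conv_app_nth l_def)
    have l: "l \<in> X \<times> UNIV" "set (take i w) \<subseteq> X \<times> UNIV" 
      using letters Suc.prems set_take_subset[of i w] by (auto simp: l_def)
    have r: "0 < r" "r < V" using Suc run_bounded[of 1 "take i w"] one_less_V l by (auto simp: r_def)
    have "same_coset H (T 1 \<star> take i w \<star> []) (T r)"
      using run_coset[of 1 "take i w"] one_less_V l r by (simp add: r_def)
    then have 1: "same_coset H (T r \<star> [l]) ((take i w \<star> []) \<star> [l])"
      using same_coset_star[OF _ same_coset_sym[OF T_reduced[OF r]], of "[l]"] T_1 by simp
    obtain t where t: "t \<in> set ts" "same_coset H (take (Suc i) w \<star> []) t"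
      using cover[OF Suc.prems] by auto
    then obtain k where "k < length ts" "ts ! k = t" by (auto simp: in_set_conv_nth)
    then have k: "0 < Suc k" "Suc k < V" "T (Suc k) = t" by (auto simp: T_def V_def)
    have "same_coset H ((take i w \<star> []) \<star> [l]) t"
      using t(2) by (simp add: take star_assoc)
    then have "same_coset H (T r \<star> [l]) (T (Suc k))"
      using same_coset_trans[OF _ 1] T_reduced[OF k(1,2)] k(3) by simp
    then have "\<delta> r l = Suc k" using delta_eqI r k by blast
    then show ?case by (simp add: take r_def)
  qed simp
  define r where "r = foldl \<delta> 1 w"
  have r: "0 < r" "r < V" using alive[of "length w"] run_bounded[of 1 w] one_less_V letters by (auto simp: r_def)
  have "same_coset H (T 1 \<star> w \<star> []) (T r)"
    using run_coset[of 1 w] one_less_V letters r by (simp add: r_def)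
  then have "same_coset H (T r) w"
    using same_coset_sym[OF T_reduced[OF r]] letters T_1 by (simp add: star_Nil)
  moreover have "same_coset H w (T 1)" using w letters unfolding same_coset_def T_1 
    by (auto simp: star_Nil intro!: bexI[of _ w])
  ultimately have "same_coset H (T r) (T 1)"
    using same_coset_trans T_1 by (metis reduced_Nil)
  then have "r = 1" using T_inj r one_less_V by simp
  then show ?thesis using wc by (simp add: lang_def r_def)
qed

text \<open>Roots are taken inside \<open>H\<close> only: the closed path of the power visits the
  cosets of \<open>u\<close> and of \<open>u c\<close>, and membership of
  \<open>w = u c u^-1\<close> in \<open>H\<close> makes them equal, so the two vertices
  coincide.\<close>

lemma lang_isolated:
  fixes n :: nat
  assumes "w \<in> H" "0 < n" "w [^]\<^bsub>free_group X\<^esub> n \<in> lang"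
  shows "w \<in> lang"
proof -
  have wc: "w \<in> carrier (free_group X)" using assms subgroup_simps(1) by auto
  obtain u c where w: "w = u @ c @ winv u" and u: "foldl \<delta> 1 u \<noteq> 0"
    and run: "foldl \<delta> (foldl \<delta> 1 u) (wpow c n) = foldl \<delta> 1 u"
    and goal: "foldl \<delta> (foldl \<delta> 1 u) c = foldl \<delta> 1 u \<Longrightarrow> w \<in> lang"
    using pow_in_langE[OF wc assms(2,3)] by metis
  have letters: "set u \<subseteq> X \<times> UNIV" "set c \<subseteq> X \<times> UNIV" using wc w by (auto simp: carrier_free_group)
  define q where "q = foldl \<delta> 1 u"
  define r where "r = foldl \<delta> q c"
  have q: "0 < q" "q < V" using u run_bounded[of 1 u] letters one_less_V by (auto simp: q_def)
  obtain m where "n = Suc m" using assms(2) by (cases n) auto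
  then have "foldl \<delta> q (c @ wpow c m) \<noteq> 0" using run u by (simp add: q_def)
  then have r: "0 < r" "r < V"
    using run_prefix_alive[of "wpow c m" q c] set_wpow_subset[OF letters(2)] run_bounded[OF q(2) letters(2)]
    by (auto simp: r_def)
  have 1: "same_coset H (u \<star> []) (T q)"
    using run_coset[of 1 u] one_less_V letters q unfolding T_1 by (simp add: q_def)
  have "same_coset H ((u \<star> []) \<star> (c \<star> [])) (T q \<star> (c \<star> []))"
    by (rule same_coset_star[OF _ 1]) simp
  moreover have "same_coset H (T q \<star> (c \<star> [])) (T r)"
    using run_coset[OF q letters(2)] r by (simp add: r_def)
  ultimately have 2: "same_coset H (u \<star> c \<star> []) (T r)"
    using same_coset_trans[OF T_reduced[OF r]] star_assoc[of "c \<star> []" u "[]"] by auto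
  have "u \<star> c \<star> [] = w \<star> (u \<star> [])"
    using star_winv_left[of "[]" u] by (simp add: w)
  then have "same_coset H (u \<star> c \<star> []) (u \<star> [])"
    using assms(1) by (auto simp: same_coset_def)
  then have "same_coset H (u \<star> c \<star> []) (T q)" using same_coset_trans[OF T_reduced[OF q] _ 1] by blast
  then have "same_coset H (T r) (T q)"
    using same_coset_trans[OF T_reduced[OF q]] same_coset_sym[OF T_reduced[OF r] 2] by blast
  then have "r = q" using T_inj q r by blast
  then show ?thesis using goal by (simp add: q_def r_def)
qed

text \<open>The transition map of \<open>c\<close> is injective where defined. If \<open>V\<close>
  iterations survive at \<open>q\<close>, two of them coincide, so a power of \<open>c\<close>
  returns to \<open>q\<close>; conjugated back to the base point it lies in \<open>H\<close>, and
  isolation removes the exponent.\<close>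

lemma iterate_dead_or_fixed:
  assumes iso: "isolated (free_group X) H" and c: "set c \<subseteq> X \<times> UNIV" and q: "0 < q" "q < V"
  shows "foldl \<delta> q c = q \<or> ((\<lambda>q. foldl \<delta> q c) ^^ V) q = 0"
proof (rule disjCI)
  define f where "f = (\<lambda>q. foldl \<delta> q c)"
  assume "((\<lambda>q. foldl \<delta> q c) ^^ V) q \<noteq> 0"
  then have V_alive: "(f ^^ V) q \<noteq> 0" by (simp add: f_def)
  have f0: "(f ^^ i) 0 = 0" for i using run_dead[OF c] by (induction i) (auto simp: f_def)
  have pow_add: "(f ^^ (i + j)) q = (f ^^ i) ((f ^^ j) q)" for i j by (simp add: funpow_add)
  have alive: "(f ^^ i) q \<noteq> 0" if "i \<le> V" for i
    using V_alive pow_add[of "V - i" i] f0 that by (metis le_add_diff_inverse2)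
  have f_run: "(f ^^ i) q = foldl \<delta> q (wpow c i)" for i
    by (simp add: f_def foldl_wpow)
  have bound: "(f ^^ i) q < V" for i
    unfolding f_run using q(2) set_wpow_subset[OF c] by (rule run_bounded)
  have inj: "x = y" if "f x = f y" "f x \<noteq> 0" "x < V" "y < V" for x y
    using run_winv[OF that(3) c] run_winv[OF that(4) c] that(1,2) unfolding f_def by metis
  \<comment> \<open>The exponents below \<open>V\<close> give \<open>V\<close> iterates among the
    \<open>V - 1\<close> vertices, state \<open>0\<close> being excluded.\<close>
  have "\<not> inj_on (\<lambda>i. (f ^^ i) q) {..<V}"
  proof (rule pigeonhole)
    have "(\<lambda>i. (f ^^ i) q) ` {..<V} \<subseteq> {1..<V}" using alive bound by (force simp: Suc_le_eq)
    then have "card ((\<lambda>i. (f ^^ i) q) ` {..<V}) \<le> card {1..<V}" by (intro card_mono) auto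
    then show "card ((\<lambda>i. (f ^^ i) q) ` {..<V}) < card {..<V}" using q by simp
  qed
  then obtain i j where ij: "i < j" "j < V" "(f ^^ i) q = (f ^^ j) q"
    unfolding inj_on_def by (metis lessThan_iff linorder_neqE_nat)
  have "(f ^^ (j - i)) q = q"
    using ij
  proof (induction i arbitrary: j)
    case (Suc i)
    obtain k where k: "j = Suc k" using Suc.prems by (cases j) auto
    have "(f ^^ i) q = (f ^^ k) q"
      by (rule inj) (use Suc.prems k alive[of "Suc i"] bound in auto)
    then show ?case using Suc.IH[of k] Suc.prems k by auto
  qed simp
  moreover define d where "d = j - i"
  ultimately have d: "0 < d" "foldl \<delta> q (wpow c d) = q" using ij f_run by auto
  \<comment> \<open>The conjugate of \<open>c\<close> by the tree word of \<open>q\<close>; its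
    \<open>d\<close>-th power lies in \<open>H\<close> because \<open>d\<close> copies of
    \<open>c\<close> return to \<open>q\<close>.\<close>
  define g where "g = T q \<star> c \<star> winv (T q)"
  have Tq: "T q \<in> carrier (free_group X)" "reduced (T q)" "set (T q) \<subseteq> X \<times> UNIV"
    using T_carrier[OF q] by (auto simp: carrier_free_group)
  have gc: "g \<in> carrier (free_group X)"
    unfolding g_def by (intro star_carrier winv_carrier) (use Tq c in auto)
  have g_pow: "wpow g i \<star> w = (T q @ wpow c i @ winv (T q)) \<star> w" if "reduced w" for i w
  proof -
    have "g = (T q @ c @ winv (T q)) \<star> []" using Tq by (simp add: g_def star_Nil)
    then have "wpow g i \<star> w = wpow (T q @ c @ winv (T q)) i \<star> w"
      using that by (induction i) (simp_all add: star_assoc)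
    then show ?thesis using wpow_conj[OF that] by simp
  qed
  have "same_coset H (T q \<star> wpow c d \<star> []) (T q)"
    using run_coset[of q "wpow c d"] q d set_wpow_subset[OF c] by simp
  then obtain h where h: "h \<in> H" "T q \<star> wpow c d \<star> [] = h \<star> T q" by (auto simp: same_coset_def)
  have hred: "reduced h" using h subgroup_simps(1) reducedI by auto
  have "g [^]\<^bsub>free_group X\<^esub> d = T q \<star> wpow c d \<star> winv (T q)"
    using wpow_star[OF gc, of d] g_pow[of "[]" d] Tq by (simp add: star_Nil)
  also have "\<dots> = (T q \<star> wpow c d \<star> []) \<star> winv (T q)"
    using Tq star_assoc[of "winv (T q)" "T q @ wpow c d" "[]"] by simp
  also have "\<dots> = h" 
    unfolding h(2) using star_assoc[of "winv (T q)" h "T q"] star_winv_right[of "[]" "T q"] Tq hred by (simp add: star_Nil)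
  finally have "g \<in> H" using free_group.isolatedD[OF iso gc d(1)] h(1) by simp
  moreover have "T q \<star> c \<star> [] = g \<star> T q"
    using g_pow[of "T q" 1] Tq star_winv_left[of "[]" "T q"] by (simp add: star_Nil)
  ultimately have 1: "same_coset H (T q \<star> c \<star> []) (T q)" by (auto simp: same_coset_def)
  have fq: "foldl \<delta> q c \<noteq> 0" "foldl \<delta> q c < V"
    using alive[of 1] one_less_V bound[of 1] by (auto simp: f_def)
  then have "same_coset H (T q \<star> c \<star> []) (T (foldl \<delta> q c))"
    using run_coset q c by simp
  then have "same_coset H (T (foldl \<delta> q c)) (T q)"
    using same_coset_trans[OF Tq(2) _ 1] same_coset_sym T_reduced fq by blast
  then show "foldl \<delta> q c = q" using T_inj fq q by simp
qed

end

section \<open>Bases from the edges of a coset graph\<close>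

lemma choose_orientation:
  assumes "finite E" "E \<subseteq> carrier (free_group X) - {[]}"
  shows "\<exists>B\<subseteq>E. (\<forall>b\<in>B. \<forall>b'\<in>B. b \<star> b' \<noteq> []) \<and> (\<forall>g\<in>E. g \<in> B \<or> winv g \<in> B)"
  using assms
proof (induction E rule: finite_induct)
  case (insert g E)
  then obtain B where B: "B \<subseteq> E" "\<forall>b\<in>B. \<forall>b'\<in>B. b \<star> b' \<noteq> []" "\<forall>g\<in>E. g \<in> B \<or> winv g \<in> B" by auto
  have red: "reduced b" if "b \<in> insert g B" for b
    using that insert.prems B(1) by (auto simp: carrier_free_group)
  have inverse: "x = winv y" if "x \<star> y = []" "reduced x" "reduced y" for x y :: "'a word"
    using star_cancel_right[of x "winv y" y] that star_winv_left[of "[]" y] by (simp add: star_Nil)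
  show ?case
  proof (cases "winv g \<in> B")
    case True
    then show ?thesis using B by (intro exI[of _ B]) auto
  next
    case False
    have g: "g \<in> carrier (free_group X)" "g \<noteq> []" "reduced g" using insert.prems by (auto simp: carrier_free_group)
    \<comment> \<open>No nontrivial element is its own inverse, as free groups have no torsion; this
      is what allows \<open>g\<close> itself to be selected.\<close>
    have "g \<star> g \<noteq> []"
    proof
      assume "g \<star> g = []"
      then have "g [^]\<^bsub>free_group X\<^esub> (2::nat) = []" using wpow_star[OF g(1), of 2] g(3) by (simp add: numeral_2_eq_2 star_Nil)
      then show False using free_group_torsion_free[OF g(1), of 2] g(2) by simp
    qed
    moreover have "g \<star> b \<noteq> [] \<and> b \<star> g \<noteq> []" if "b \<in> B" for b
      using inverse[of g b] inverse[of b g] red[of b] red[of g] that False by auto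
    ultimately show ?thesis using B by (intro exI[of _ "insert g B"]) auto
  qed
qed simp

text \<open>The nontrivial edge elements come in inverse pairs, one for each orientation of an edge;
  selecting one from each pair makes \<open>indep\<close> hold.\<close>

lemma (in coset_graph) ex_basis:
  assumes "finite X"
  shows "\<exists>B. finite B \<and> basis_graph X V \<delta> T B"
proof -
  let ?g = "\<lambda>q l. T q \<star> [l] \<star> winv (T (\<delta> q l))"
  define E where "E = {?g q l |q l. q < V \<and> l \<in> X \<times> UNIV \<and> \<delta> q l \<noteq> 0} - {[]}"
  have "E \<subseteq> (\<lambda>(q, l). ?g q l) ` ({..<V} \<times> X \<times> UNIV)" by (auto simp: E_def)
  then have fin: "finite E" by (rule finite_subset) (use assms in auto)
  have g: "?g q l \<in> carrier (free_group X)" "T q \<star> [l] = ?g q l \<star> T (\<delta> q l)"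
    if "l \<in> X \<times> UNIV" "\<delta> q l \<noteq> 0" for q l
  proof -
    note d = delta_D[OF that(2)]
    have Tr: "T (\<delta> q l) \<in> carrier (free_group X)" "reduced (T (\<delta> q l))" 
      using T_carrier T_reduced d that by auto
    show "?g q l \<in> carrier (free_group X)"
      using T_carrier[OF d(1,2)] Tr that by (intro star_carrier winv_carrier) (auto simp: carrier_free_group)
    show "T q \<star> [l] = ?g q l \<star> T (\<delta> q l)"
      using star_assoc[OF Tr(2), of "T q @ [l]" "winv (T (\<delta> q l))"] star_winv_left[of "[]" "T (\<delta> q l)"] Tr(2)
      by (simp add: star_Nil)
  qed
  then have "E \<subseteq> carrier (free_group X) - {[]}" by (auto simp: E_def)
  from choose_orientation[OF fin this] obtain B where
    B: "B \<subseteq> E" "\<forall>b\<in>B. \<forall>b'\<in>B. b \<star> b' \<noteq> []" "\<forall>g\<in>E. g \<in> B \<or> winv g \<in> B" by auto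
  have "basis_graph X V \<delta> T B"
  proof
    show "T 1 = []" by (rule T_1)
  next
    fix q assume q: "1 < q" "q < V"
    then have "q - 1 < length ts" "0 < q - 1" by (auto simp: V_def)
    then obtain j l where j: "j < q - 1" "l \<in> X \<times> UNIV" "ts ! (q - 1) = ts ! j \<star> [l]"
      using tree_list unfolding tree_list_def by blast
    then have "T q = T (Suc j) \<star> [l]" by (simp add: T_def)
    moreover from this have "\<delta> (Suc j) l = q"
      using q j same_coset_refl[of "T q"] by (intro delta_eqI) auto
    ultimately show "\<exists>p<q. p \<noteq> 0 \<and> (\<exists>l\<in>X \<times> UNIV. \<delta> p l = q \<and> T q = T p \<star> [l])"
      using j q by (intro exI[of _ "Suc j"]) auto
  next
    fix q l assume ql: "q < V" "l \<in> X \<times> UNIV" "\<delta> q l \<noteq> 0"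
    note g = g[OF ql(2,3)]
    consider "?g q l = []" | "?g q l \<in> B" | "winv (?g q l) \<in> B"
      using B(3) ql unfolding E_def by blast
    then show "T q \<star> [l] = T (\<delta> q l) \<or>
      (\<exists>b\<in>B. T q \<star> [l] = b \<star> T (\<delta> q l) \<or> b \<star> T q \<star> [l] = T (\<delta> q l))"
    proof cases
      case 1
      then show ?thesis using g(2) by simp
    next
      case 2
      then show ?thesis using g(2) by blast
    next
      case 3
      have "winv (?g q l) \<star> T q \<star> [l] = T (\<delta> q l)"
        using g star_winv_left[of "T (\<delta> q l)" "?g q l"] T_reduced delta_D[OF ql(3)] ql(3) by simp
      then show ?thesis using 3 by blast
    qed
  next
    show "B \<subseteq> carrier (free_group X)" using B(1) g(1) by (auto simp: E_def)
  next
    fix b assume "b \<in> B"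
    then obtain q l where "b = ?g q l" "q < V" "l \<in> X \<times> UNIV" "\<delta> q l \<noteq> 0" 
      using B(1) unfolding E_def by blast
    then show "\<exists>q<V. \<exists>l\<in>X \<times> UNIV. \<delta> q l \<noteq> 0 \<and> T q \<star> [l] = b \<star> T (\<delta> q l)"
      using g(2) by blast
  qed (use B(2) in auto)
  moreover have "finite B" using B(1) fin finite_subset by blast
  ultimately show ?thesis by blast
qed

text \<open>The hypothesis on \<open>L\<close> is shaped for two applications. If \<open>H\<close>
  is generated by \<open>ws\<close>, every subgroup containing \<open>ws\<close> is large enough; if
  \<open>H\<close> is the isolator, a subgroup closed under roots inside \<open>H\<close> is
  isolated in the whole group and so contains \<open>H\<close>. The traversed graph provides an
  \<open>L\<close> of this kind.\<close>

theorem ex_finite_basis_graph: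
  assumes "finite X" "subgroup H (free_group X)" "set ws \<subseteq> H"
    and minimal: "\<And>L. subgroup L (free_group X) \<Longrightarrow> L \<subseteq> H \<Longrightarrow> set ws \<subseteq> L \<Longrightarrow>
      (\<And>w n. w \<in> H \<Longrightarrow> 0 < (n::nat) \<Longrightarrow> w [^]\<^bsub>free_group X\<^esub> n \<in> L \<Longrightarrow> w \<in> L) \<Longrightarrow> H \<subseteq> L"
  shows "\<exists>V \<delta> T B. basis_graph X V \<delta> T B \<and> folded_graph.lang X \<delta> = H \<and> finite B \<and>
    (isolated (free_group X) H \<longrightarrow> (\<forall>c q. set c \<subseteq> X \<times> UNIV \<longrightarrow> 0 < q \<longrightarrow> q < V \<longrightarrow>
      foldl \<delta> q c = q \<or> ((\<lambda>q. foldl \<delta> q c) ^^ V) q = 0))"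
proof -
  interpret free_subgroup X H using assms(2) by (rule free_subgroup.intro)
  have "\<And>w. w \<in> set ws \<Longrightarrow> set w \<subseteq> X \<times> UNIV"
    using assms(3) subgroup_simps(1) by (auto simp: carrier_free_group subset_iff)
  from tree_list_cover[of ws, OF this] obtain ts where ts: "tree_list X H ts"
    "\<forall>w\<in>set ws. \<forall>i\<le>length w. \<exists>t\<in>set ts. same_coset H (take i w \<star> []) t" by auto
  interpret coset_graph X H ts by unfold_locales fact
  have "set ws \<subseteq> lang" using covered_in_lang assms(3) ts(2) by auto
  then have "H \<subseteq> lang" using minimal[OF subgroup_lang lang_subset] lang_isolated by blast
  then have "lang = H" using lang_subset by auto
  moreover obtain B where "finite B" "basis_graph X V \<delta> T B" using ex_basis[OF assms(1)] by auto
  ultimately show ?thesis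
    by (intro exI[of _ V] exI[of _ \<delta>] exI[of _ T] exI[of _ B] conjI impI allI iterate_dead_or_fixed) auto
qed

section \<open>Computable functions\<close>

text \<open>
  A bound variable is pushed onto the front of the argument list; with \<open>hd\<close> and \<open>tl\<close> in place
  of de Bruijn indices the closure properties below are introduction rules.
\<close>

definition computable :: "nat \<Rightarrow> (nat list \<Rightarrow> nat) \<Rightarrow> bool" where
  "computable n f \<longleftrightarrow> (\<exists>p. \<forall>xs. length xs = n \<longrightarrow> computes p xs (f xs))"

definition decidable :: "nat \<Rightarrow> (nat list \<Rightarrow> bool) \<Rightarrow> bool" where
  "decidable n P \<longleftrightarrow> computable n (\<lambda>xs. of_bool (P xs))"

lemma computableI: "(\<And>xs. length xs = n \<Longrightarrow> computes p xs (f xs)) \<Longrightarrow> computable n f"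
  by (auto simp: computable_def)

lemma computable_cong:
  "computable n f \<Longrightarrow> (\<And>xs. length xs = n \<Longrightarrow> f xs = g xs) \<Longrightarrow> computable n g"
  by (auto simp: computable_def)

lemma decidable_cong:
  "decidable n P \<Longrightarrow> (\<And>xs. length xs = n \<Longrightarrow> P xs = Q xs) \<Longrightarrow> decidable n Q"
  unfolding decidable_def by (erule computable_cong) simp

lemma computable_nth: "i < n \<Longrightarrow> computable n (\<lambda>xs. xs ! i)"
  by (rule computableI[of _ "Proj i"]) (auto intro: computes_Proj)

lemma computable_compose:
  assumes "computable (length gs) f" "\<And>g. g \<in> set gs \<Longrightarrow> computable n g"
  shows "computable n (\<lambda>xs. f (map (\<lambda>g. g xs) gs))"
proof -
  obtain p where p: "\<And>xs. length xs = length gs \<Longrightarrow> computes p xs (f xs)"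
    using assms(1) by (auto simp: computable_def)
  obtain P where P: "\<And>g xs. g \<in> set gs \<Longrightarrow> length xs = n \<Longrightarrow> computes (P g) xs (g xs)"
    using assms(2) unfolding computable_def by metis
  show ?thesis
  proof (rule computableI)
    fix xs :: "nat list" assume "length xs = n"
    then show "computes (Comp p (map P gs)) xs (f (map (\<lambda>g. g xs) gs))"
      by (intro computes_Comp[of "map (\<lambda>g. g xs) gs"]) (auto intro: p P)
  qed
qed

lemma computable_Suc: "computable n f \<Longrightarrow> computable n (\<lambda>xs. Suc (f xs))"
proof -
  assume "computable n f"
  moreover have "computable 1 (\<lambda>xs. Suc (xs ! 0))"
    by (rule computableI[of _ Succ]) (auto simp: length_Suc_conv intro: computes_Succ)
  ultimately show ?thesis using computable_compose[of "[f]" "\<lambda>xs. Suc (xs ! 0)" n] by simp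
qed

lemma computable_const: "computable n (\<lambda>_. c)"
proof (induction c)
  case 0
  show ?case by (rule computableI[of _ Zero]) (rule computes_Zero)
qed (rule computable_Suc)

lemma map_nth_drop:
  fixes xs :: "nat list"
  shows "length xs = n + k \<Longrightarrow> map (\<lambda>i. xs ! (i + k)) [0..<n] = drop k xs"
  by (rule nth_equalityI) (auto simp: add.commute)

lemma computable_weaken: "computable n f \<Longrightarrow> computable (Suc n) (\<lambda>xs. f (tl xs))"
proof (rule computable_cong)
  assume "computable n f"
  then show "computable (Suc n) (\<lambda>xs. f (map (\<lambda>g. g xs) (map (\<lambda>i xs. xs ! (i + 1)) [0..<n])))"
    by (intro computable_compose) (auto intro: computable_nth)
qed (use map_nth_drop[where k = 1] in \<open>simp add: comp_def drop_Suc\<close>)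

lemma computable_hd: "computable (Suc n) hd"
  by (rule computable_cong[OF computable_nth[of 0]]) (auto simp: length_Suc_conv)

text \<open>Inserts an argument in second place, where primitive recursion passes the previous
  value.\<close>

lemma computable_weaken_second:
  assumes "computable (Suc n) (\<lambda>ys. f (hd ys) (tl ys))"
  shows "computable (Suc (Suc n)) (\<lambda>ys. f (hd ys) (tl (tl ys)))"
proof (rule computable_cong)
  show "computable (Suc (Suc n)) (\<lambda>xs. (\<lambda>ys. f (hd ys) (tl ys)) (map (\<lambda>g. g xs) (hd # map (\<lambda>i xs. xs ! (i + 2)) [0..<n])))"
    using assms by (intro computable_compose) (auto intro: computable_nth computable_hd)
qed (use map_nth_drop[where k = 2] in \<open>simp add: comp_def drop_Suc numeral_2_eq_2\<close>)

lemma computable_let: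
  assumes "computable (Suc n) (\<lambda>ys. f (hd ys) (tl ys))" "computable n g"
  shows "computable n (\<lambda>xs. f (g xs) xs)"
proof (rule computable_cong)
  show "computable n (\<lambda>xs. (\<lambda>ys. f (hd ys) (tl ys)) (map (\<lambda>g. g xs) (g # map (\<lambda>i xs. xs ! i) [0..<n])))"
    using assms by (intro computable_compose) (auto intro: computable_nth)
qed (auto simp: comp_def map_nth)

lemma computable_compose1:
  assumes "computable (Suc 0) (\<lambda>xs. f (hd xs))" "computable n g"
  shows "computable n (\<lambda>xs. f (g xs))"
  using computable_compose[of "[g]" "\<lambda>xs. f (hd xs)" n] assms by simp

lemma computable_compose2:
  assumes "computable (Suc (Suc 0)) (\<lambda>xs. f (hd xs) (hd (tl xs)))" "computable n g" "computable n h"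
  shows "computable n (\<lambda>xs. f (g xs) (h xs))"
  using computable_compose[of "[g, h]" "\<lambda>xs. f (hd xs) (hd (tl xs))" n] assms by auto

lemma computable_compose3:
  assumes "computable (Suc (Suc (Suc 0))) (\<lambda>xs. f (hd xs) (hd (tl xs)) (hd (tl (tl xs))))"
    "computable n g" "computable n h" "computable n k"
  shows "computable n (\<lambda>xs. f (g xs) (h xs) (k xs))"
  using computable_compose[of "[g, h, k]" "\<lambda>xs. f (hd xs) (hd (tl xs)) (hd (tl (tl xs)))" n] assms by auto

lemma decidable_compose1:
  assumes "decidable (Suc 0) (\<lambda>xs. P (hd xs))" "computable n g"
  shows "decidable n (\<lambda>xs. P (g xs))"
  using computable_compose1[of "\<lambda>x. of_bool (P x)"] assms by (simp add: decidable_def)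

text \<open>\<open>PrimRec\<close> recurses on its first argument only; binding the number
  \<open>m xs\<close> of iterations with \<open>computable_let\<close> removes this
  restriction.\<close>

lemma computable_rec:
  assumes "computable n b" "computable n m"
    "computable (Suc (Suc n)) (\<lambda>ys. g (hd ys) (hd (tl ys)) (tl (tl ys)))"
  shows "computable n (\<lambda>xs. rec_nat (b xs) (\<lambda>k z. g k z xs) (m xs))"
proof -
  obtain p q where pq: "\<And>xs. length xs = n \<Longrightarrow> computes p xs (b xs)"
    "\<And>k z xs. length xs = n \<Longrightarrow> computes q (k # z # xs) (g k z xs)"
    using assms(1,3) unfolding computable_def
    by (metis length_Cons list.sel(1) list.sel(3))
  have "computable (Suc n) (\<lambda>ys. rec_nat (b (tl ys)) (\<lambda>k z. g k z (tl ys)) (hd ys))"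
  proof (rule computableI)
    fix ys :: "nat list" assume "length ys = Suc n"
    then obtain k xs where ys: "ys = k # xs" "length xs = n" by (auto simp: length_Suc_conv)
    have "computes (PrimRec p q) (k # xs) (rec_nat (b xs) (\<lambda>k z. g k z xs) k)"
      by (induction k) (auto intro: computes_PrimRec_0 computes_PrimRec_Suc pq ys(2))
    then show "computes (PrimRec p q) ys (rec_nat (b (tl ys)) (\<lambda>k z. g k z (tl ys)) (hd ys))"
      by (simp add: ys)
  qed
  from computable_let[where f = "\<lambda>k xs. rec_nat (b xs) (\<lambda>k z. g k z xs) k", OF this assms(2)]
  show ?thesis .
qed

text \<open>A conditional is a recursion of length zero or one, namely over the truth value, with a
  step that ignores its previous value.\<close>

lemma computable_if:
  assumes "decidable n P" "computable n f" "computable n g"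
  shows "computable n (\<lambda>xs. if P xs then f xs else g xs)"
proof (rule computable_cong)
  show "computable n (\<lambda>xs. rec_nat (g xs) (\<lambda>_ _. f xs) (of_bool (P xs)))"
    using assms unfolding decidable_def
    by (intro computable_rec) (auto intro: computable_weaken[OF computable_weaken])
qed auto

lemma computable_proj:
  "computable (Suc n) (\<lambda>xs. hd xs)"
  "computable (Suc (Suc n)) (\<lambda>xs. hd (tl xs))"
  "computable (Suc (Suc (Suc n))) (\<lambda>xs. hd (tl (tl xs)))"
  "computable (Suc (Suc (Suc (Suc n)))) (\<lambda>xs. hd (tl (tl (tl xs))))"
  "computable (Suc (Suc (Suc (Suc (Suc n))))) (\<lambda>xs. hd (tl (tl (tl (tl xs)))))"
  "computable (Suc (Suc (Suc (Suc (Suc (Suc n)))))) (\<lambda>xs. hd (tl (tl (tl (tl (tl xs))))))"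
  by (intro computable_hd computable_weaken computable_hd[THEN computable_weaken])+

section \<open>Arithmetic, connectives and bounded quantifiers\<close>

lemma computable_pred: "computable n f \<Longrightarrow> computable n (\<lambda>xs. f xs - 1)"
proof (rule computable_compose1[where f = "\<lambda>x. x - 1"])
  have "computable (Suc 0) (\<lambda>xs. rec_nat 0 (\<lambda>k z. k) (hd xs))"
    by (intro computable_rec computable_proj computable_const)
  moreover have "rec_nat 0 (\<lambda>k z. k) m = m - 1" for m by (cases m) auto
  ultimately show "computable (Suc 0) (\<lambda>xs. hd xs - 1)" by simp
qed

lemma computable_add: "computable n f \<Longrightarrow> computable n g \<Longrightarrow> computable n (\<lambda>xs. f xs + g xs)"
proof (rule computable_compose2[of "(+)"])
  have "computable (Suc (Suc 0)) (\<lambda>xs. rec_nat (hd xs) (\<lambda>k z. Suc z) (hd (tl xs)))"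
    by (intro computable_rec computable_proj computable_Suc)
  moreover have "rec_nat a (\<lambda>k z. Suc z) b = a + b" for a b by (induction b) auto
  ultimately show "computable (Suc (Suc 0)) (\<lambda>xs. hd xs + hd (tl xs))" by simp
qed

lemma computable_diff: "computable n f \<Longrightarrow> computable n g \<Longrightarrow> computable n (\<lambda>xs. f xs - g xs)"
proof (rule computable_compose2[of "(-)"])
  have "computable (Suc (Suc 0)) (\<lambda>xs. rec_nat (hd xs) (\<lambda>k z. z - 1) (hd (tl xs)))"
    by (intro computable_rec computable_proj computable_pred)
  moreover have "rec_nat a (\<lambda>k z. z - 1) b = a - b" for a b :: nat by (induction b) auto
  ultimately show "computable (Suc (Suc 0)) (\<lambda>xs. hd xs - hd (tl xs))" by simp
qed

lemma decidable_eq: 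
  assumes "computable n f" "computable n g" shows "decidable n (\<lambda>xs. f xs = g xs)"
proof -
  have "computable n (\<lambda>xs. 1 - ((f xs - g xs) + (g xs - f xs)))"
    by (intro computable_diff computable_add computable_const assms)
  then show ?thesis unfolding decidable_def by (rule computable_cong) auto
qed

lemma decidable_not:
  assumes "decidable n P" shows "decidable n (\<lambda>xs. \<not> P xs)"
proof -
  have "computable n (\<lambda>xs. 1 - of_bool (P xs))"
    by (intro computable_diff computable_const assms[unfolded decidable_def])
  then show ?thesis unfolding decidable_def by (rule computable_cong) auto
qed

lemma decidable_conj:
  assumes "decidable n P" "decidable n Q" shows "decidable n (\<lambda>xs. P xs \<and> Q xs)"
proof -
  have "computable n (\<lambda>xs. if P xs then of_bool (Q xs) else 0)"
    by (intro computable_if computable_const assms assms[unfolded decidable_def])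
  then show ?thesis unfolding decidable_def by (rule computable_cong) auto
qed

lemma decidable_disj:
  assumes "decidable n P" "decidable n Q" shows "decidable n (\<lambda>xs. P xs \<or> Q xs)"
  using decidable_not[OF decidable_conj[OF decidable_not[OF assms(1)] decidable_not[OF assms(2)]]] by simp

lemma decidable_imp:
  assumes "decidable n P" "decidable n Q" shows "decidable n (\<lambda>xs. P xs \<longrightarrow> Q xs)"
  using decidable_disj[OF decidable_not[OF assms(1)] assms(2)] unfolding imp_conv_disj .

lemma decidable_less:
  assumes "computable n f" "computable n g" shows "decidable n (\<lambda>xs. f xs < g xs)"
proof -
  have "decidable n (\<lambda>xs. \<not> g xs - f xs = 0)"
    by (intro decidable_not decidable_eq computable_diff computable_const assms)
  then show ?thesis by (rule decidable_cong) auto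
qed

lemma decidable_all_less:
  assumes "computable n m" "decidable (Suc n) (\<lambda>ys. P (hd ys) (tl ys))"
  shows "decidable n (\<lambda>xs. \<forall>i<m xs. P i xs)"
proof -
  have "computable n (\<lambda>xs. rec_nat (Suc 0) (\<lambda>k z. if P k xs then z else 0) (m xs))"
  proof (intro computable_rec computable_if computable_const computable_proj assms)
    show "decidable (Suc (Suc n)) (\<lambda>ys. P (hd ys) (tl (tl ys)))"
      using computable_weaken_second[of n "\<lambda>k xs. of_bool (P k xs)"] assms(2) by (simp add: decidable_def)
  qed
  moreover have "rec_nat (Suc 0) (\<lambda>k z. if P k xs then z else 0) m = of_bool (\<forall>i<m. P i xs)" for m :: nat and xs
    by (induction m) (auto simp: less_Suc_eq)
  ultimately show ?thesis by (simp add: decidable_def)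
qed

lemma decidable_ex_less:
  assumes "computable n m" "decidable (Suc n) (\<lambda>ys. P (hd ys) (tl ys))"
  shows "decidable n (\<lambda>xs. \<exists>i<m xs. P i xs)"
proof -
  have "decidable n (\<lambda>xs. \<not> (\<forall>i<m xs. \<not> P i xs))"
    by (intro decidable_not decidable_all_less assms)
  then show ?thesis by simp
qed

text \<open>The index set lives outside the machine: the quantifier is unrolled into finitely many
  conjuncts. This serves the letters, which form a fixed finite set.\<close>

lemma decidable_ball_finite:
  assumes "finite A" "\<And>a. a \<in> A \<Longrightarrow> decidable n (P a)"
  shows "decidable n (\<lambda>xs. \<forall>a\<in>A. P a xs)"
  using assms
proof (induction A rule: finite_induct)
  case empty
  have "decidable n (\<lambda>_. (0::nat) = 0)" by (intro decidable_eq computable_const)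
  then show ?case by simp
next
  case (insert a A)
  have "decidable n (\<lambda>xs. P a xs \<and> (\<forall>a\<in>A. P a xs))"
    by (intro decidable_conj insert) auto
  then show ?case by simp
qed

lemma decidable_bex_finite:
  assumes "finite A" "\<And>a. a \<in> A \<Longrightarrow> decidable n (P a)"
  shows "decidable n (\<lambda>xs. \<exists>a\<in>A. P a xs)"
proof -
  have "decidable n (\<lambda>xs. \<not> (\<forall>a\<in>A. \<not> P a xs))"
    by (intro decidable_not decidable_ball_finite assms)
  then show ?thesis by simp
qed

text \<open>Minimization stops at the first zero, so the negated truth value is searched. One
  program serves all inputs for which a witness exists; on the others nothing is claimed.\<close>

lemma unbounded_search:
  assumes "decidable (Suc n) (\<lambda>ys. P (hd ys) (tl ys))"
  obtains p where "\<And>xs. length xs = n \<Longrightarrow> \<exists>k. P k xs \<Longrightarrow> computes p xs (LEAST k. P k xs)"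
proof -
  have "computable (Suc n) (\<lambda>ys. of_bool (\<not> P (hd ys) (tl ys)))"
    using decidable_not[OF assms] by (simp add: decidable_def)
  then obtain p where p: "\<And>k xs. length xs = n \<Longrightarrow> computes p (k # xs) (of_bool (\<not> P k xs))"
    unfolding computable_def by (metis length_Cons list.sel(1,3))
  show ?thesis
  proof (rule that)
    fix xs assume xs: "length xs = n" "\<exists>k. P k xs"
    show "computes (Mu p) xs (LEAST k. P k xs)"
    proof (rule computes_Mu)
      show "computes p ((LEAST k. P k xs) # xs) 0"
        using p[OF xs(1), of "LEAST k. P k xs"] LeastI_ex[OF xs(2)] by simp
      show "\<forall>m<LEAST k. P k xs. \<exists>z>0. computes p (m # xs) z"
        using p[OF xs(1)] not_less_Least by (metis of_bool_eq(2) zero_less_one)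
    qed
  qed
qed

lemma computable_Least:
  assumes "decidable (Suc n) (\<lambda>ys. P (hd ys) (tl ys))" "\<And>xs. length xs = n \<Longrightarrow> \<exists>k. P k xs"
  shows "computable n (\<lambda>xs. LEAST k. P k xs)"
  using unbounded_search[OF assms(1)] assms(2) unfolding computable_def by metis

lemmas basic_computable_intros =
  computable_proj computable_const computable_Suc computable_add computable_diff computable_if computable_rec
  decidable_eq decidable_not decidable_conj decidable_disj decidable_imp decidable_less
  decidable_all_less decidable_ex_less


section \<open>Computing with encoded lists\<close>

text \<open>Undoes \<open>list_encode\<close>, which maps a nonempty list to the successor of the
  code of the pair of head and tail. At \<open>0\<close> the truncated difference gives head
  \<open>0\<close> and tail \<open>0\<close>, so reading beyond the end of a list returns
  \<open>0\<close>.\<close>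

definition chd :: "nat \<Rightarrow> nat" where "chd n = fst (prod_decode (n - 1))"

definition ctl :: "nat \<Rightarrow> nat" where "ctl n = snd (prod_decode (n - 1))"

definition ccons :: "nat \<Rightarrow> nat \<Rightarrow> nat" where "ccons a n = Suc (prod_encode (a, n))"

definition cdrop :: "nat \<Rightarrow> nat \<Rightarrow> nat" where "cdrop n i = rec_nat n (\<lambda>_ z. ctl z) i"

definition cnth :: "nat \<Rightarrow> nat \<Rightarrow> nat" where "cnth n i = chd (cdrop n i)"

text \<open>Only the empty list has code \<open>0\<close>, so the length is the first position at
  which the remaining list is exhausted.\<close>

definition clen :: "nat \<Rightarrow> nat" where "clen n = (LEAST k. cdrop n k = 0)"

lemma computable_prod_encode:
  "computable n f \<Longrightarrow> computable n g \<Longrightarrow> computable n (\<lambda>xs. prod_encode (f xs, g xs))"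
proof (rule computable_compose2[of "\<lambda>a b. prod_encode (a, b)"])
  have "rec_nat 0 (\<lambda>k z. z + Suc k) m = triangle m" for m by (induction m) auto
  moreover have "computable (Suc 0) (\<lambda>xs. rec_nat 0 (\<lambda>k z. z + Suc k) (hd xs))"
    by (intro basic_computable_intros)
  ultimately have "computable (Suc 0) (\<lambda>xs. triangle (hd xs))" by simp
  note triangle = computable_compose1[where f = triangle, OF this]
  have "computable (Suc (Suc 0)) (\<lambda>xs. triangle (hd xs + hd (tl xs)) + hd xs)"
    by (intro computable_add computable_proj triangle)
  then show "computable (Suc (Suc 0)) (\<lambda>xs. prod_encode (hd xs, hd (tl xs)))"
    by (simp add: prod_encode_def)
qed

text \<open>The pairing function is inverted by searching for one component; the other is bounded by
  the code, so the test at each step is decidable.\<close>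

lemma computable_prod_decode:
  assumes "computable n f"
  shows "computable n (\<lambda>xs. fst (prod_decode (f xs)))" "computable n (\<lambda>xs. snd (prod_decode (f xs)))"
proof -
  have ex: "\<exists>k<Suc z. prod_encode (fst (prod_decode z), k) = z" "\<exists>k<Suc z. prod_encode (k, snd (prod_decode z)) = z" for z
    using le_prod_encode_1[of "fst (prod_decode z)" "snd (prod_decode z)"] 
      le_prod_encode_2[of "snd (prod_decode z)" "fst (prod_decode z)"]
    by (auto simp: less_Suc_eq_le)
  have fst: "(LEAST m. \<exists>k<Suc z. prod_encode (m, k) = z) = fst (prod_decode z)" for z
    by (rule Least_equality) (use ex in \<open>auto simp: prod_encode_inverse\<close>)
  have snd: "(LEAST m. \<exists>k<Suc z. prod_encode (k, m) = z) = snd (prod_decode z)" for z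
    by (rule Least_equality) (use ex in \<open>auto simp: prod_encode_inverse\<close>)
  have "computable (Suc 0) (\<lambda>xs. LEAST m. \<exists>k<Suc (hd xs). prod_encode (m, k) = hd xs)"
    by (intro computable_Least basic_computable_intros computable_prod_encode) (use ex in blast)
  then show "computable n (\<lambda>xs. fst (prod_decode (f xs)))"
    using computable_compose1[where f = "\<lambda>z. fst (prod_decode z)"] assms unfolding fst by blast
  have "computable (Suc 0) (\<lambda>xs. LEAST m. \<exists>k<Suc (hd xs). prod_encode (k, m) = hd xs)"
    by (intro computable_Least basic_computable_intros computable_prod_encode) (use ex in blast)
  then show "computable n (\<lambda>xs. snd (prod_decode (f xs)))"
    using computable_compose1[where f = "\<lambda>z. snd (prod_decode z)"] assms unfolding snd by blast
qed

lemma computable_chd: "computable n f \<Longrightarrow> computable n (\<lambda>xs. chd (f xs))"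
  unfolding chd_def by (intro computable_prod_decode basic_computable_intros)

lemma computable_ctl: "computable n f \<Longrightarrow> computable n (\<lambda>xs. ctl (f xs))"
  unfolding ctl_def by (intro computable_prod_decode basic_computable_intros)

lemma computable_ccons: "computable n f \<Longrightarrow> computable n g \<Longrightarrow> computable n (\<lambda>xs. ccons (f xs) (g xs))"
  unfolding ccons_def by (intro computable_prod_encode basic_computable_intros)

lemma computable_cdrop: "computable n f \<Longrightarrow> computable n g \<Longrightarrow> computable n (\<lambda>xs. cdrop (f xs) (g xs))"
proof (rule computable_compose2[of cdrop])
  show "computable (Suc (Suc 0)) (\<lambda>xs. cdrop (hd xs) (hd (tl xs)))"
    unfolding cdrop_def by (intro computable_ctl basic_computable_intros)
qed

lemma computable_cnth: "computable n f \<Longrightarrow> computable n g \<Longrightarrow> computable n (\<lambda>xs. cnth (f xs) (g xs))"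
  unfolding cnth_def by (intro computable_chd computable_cdrop)

lemma ctl_0 [simp]: "ctl 0 = 0" and chd_0 [simp]: "chd 0 = 0"
  by (simp_all add: ctl_def chd_def prod_decode_def prod_decode_aux.simps)

lemma chd_ccons [simp]: "chd (ccons a n) = a" and ctl_ccons [simp]: "ctl (ccons a n) = n"
  and ccons_neq_0 [simp]: "ccons a n \<noteq> 0"
  by (simp_all add: chd_def ctl_def ccons_def)

lemma list_encode_Cons: "list_encode (x # xs) = ccons x (list_encode xs)"
  by (simp add: ccons_def)

lemma list_encode_eq_0_iff [simp]: "list_encode xs = 0 \<longleftrightarrow> xs = []"
  by (cases xs) auto

declare list_encode.simps(2) [simp del]

lemma cdrop_list_encode: "cdrop (list_encode xs) i = list_encode (drop i xs)"
proof -
  have "ctl (list_encode ys) = list_encode (tl ys)" for ys by (cases ys) (auto simp: list_encode_Cons)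
  then show ?thesis by (induction i) (auto simp: cdrop_def drop_Suc tl_drop)
qed

lemma cnth_list_encode: "cnth (list_encode xs) i = (if i < length xs then xs ! i else 0)"
  by (auto simp: cnth_def cdrop_list_encode Cons_nth_drop_Suc[symmetric] list_encode_Cons)

lemma clen_list_encode [simp]: "clen (list_encode xs) = length xs"
  unfolding clen_def by (rule Least_equality) (auto simp: cdrop_list_encode)

lemma computable_clen: "computable n f \<Longrightarrow> computable n (\<lambda>xs. clen (f xs))"
proof (rule computable_compose1[of clen])
  show "computable (Suc 0) (\<lambda>xs. clen (hd xs))"
    unfolding clen_def
  proof (intro computable_Least computable_cdrop basic_computable_intros)
    show "\<exists>k. cdrop (hd xs) k = 0" for xs
      using cdrop_list_encode[of "list_decode (hd xs)" "length (list_decode (hd xs))"] by auto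
  qed
qed

lemmas computable_intros = basic_computable_intros
  computable_chd computable_ctl computable_ccons computable_cnth computable_clen


section \<open>Computing with encoded words\<close>

definition letter_code :: "('a \<Rightarrow> nat) \<Rightarrow> 'a letter \<Rightarrow> nat" where
  "letter_code e l = 2 * e (fst l) + (if snd l then 0 else 1)"

text \<open>Generators have even codes and their inverses the next odd numbers; the bounded
  quantifier tests parity.\<close>

definition cinv :: "nat \<Rightarrow> nat" where
  "cinv a = (if \<exists>k<Suc a. k + k = a then Suc a else a - 1)"

definition ccancel :: "nat \<Rightarrow> nat \<Rightarrow> nat" where
  "ccancel a w = (if \<not> w = 0 \<and> chd w = cinv a then ctl w else ccons a w)"

text \<open>The fold runs from the right end of \<open>u\<close>, hence the index
  \<open>clen u - Suc k\<close> in step \<open>k\<close>.\<close>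

definition cmult :: "nat \<Rightarrow> nat \<Rightarrow> nat" where
  "cmult u v = rec_nat v (\<lambda>k z. ccancel (cnth u (clen u - Suc k)) z) (clen u)"

definition cpow :: "nat \<Rightarrow> nat \<Rightarrow> nat" where
  "cpow u n = rec_nat 0 (\<lambda>_ z. cmult u z) n"

text \<open>\<open>d\<close> codes a table with a row for each state and a column for each letter
  code.\<close>

definition crun :: "nat \<Rightarrow> nat \<Rightarrow> nat \<Rightarrow> nat" where
  "crun d q w = rec_nat q (\<lambda>k z. cnth (cnth d z) (cnth w k)) (clen w)"

definition citer :: "nat \<Rightarrow> nat \<Rightarrow> nat \<Rightarrow> nat" where
  "citer m n q = rec_nat q (\<lambda>_ z. cnth m z) n"

section \<open>Computability of the operations on codes\<close>

lemma computable_ccancel: "computable n f \<Longrightarrow> computable n g \<Longrightarrow> computable n (\<lambda>xs. ccancel (f xs) (g xs))"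
proof (rule computable_compose2[of ccancel])
  show "computable (Suc (Suc 0)) (\<lambda>xs. ccancel (hd xs) (hd (tl xs)))"
    unfolding ccancel_def cinv_def by (intro computable_intros)
qed

lemma computable_cmult: "computable n f \<Longrightarrow> computable n g \<Longrightarrow> computable n (\<lambda>xs. cmult (f xs) (g xs))"
proof (rule computable_compose2[of cmult])
  show "computable (Suc (Suc 0)) (\<lambda>xs. cmult (hd xs) (hd (tl xs)))"
    unfolding cmult_def by (intro computable_ccancel computable_intros)
qed

lemma computable_cpow: "computable n f \<Longrightarrow> computable n g \<Longrightarrow> computable n (\<lambda>xs. cpow (f xs) (g xs))"
proof (rule computable_compose2[of cpow])
  show "computable (Suc (Suc 0)) (\<lambda>xs. cpow (hd xs) (hd (tl xs)))"
    unfolding cpow_def by (intro computable_cmult computable_intros)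
qed

lemma computable_crun:
  "computable n f \<Longrightarrow> computable n g \<Longrightarrow> computable n h \<Longrightarrow> computable n (\<lambda>xs. crun (f xs) (g xs) (h xs))"
proof (rule computable_compose3[of crun])
  show "computable (Suc (Suc (Suc 0))) (\<lambda>xs. crun (hd xs) (hd (tl xs)) (hd (tl (tl xs))))"
    unfolding crun_def by (intro computable_intros)
qed

lemma computable_citer:
  "computable n f \<Longrightarrow> computable n g \<Longrightarrow> computable n h \<Longrightarrow> computable n (\<lambda>xs. citer (f xs) (g xs) (h xs))"
proof (rule computable_compose3[of citer])
  show "computable (Suc (Suc (Suc 0))) (\<lambda>xs. citer (hd xs) (hd (tl xs)) (hd (tl (tl xs))))"
    unfolding citer_def by (intro computable_intros)
qed

lemmas word_computable_intros = computable_intros computable_cmult computable_cpow computable_crun computable_citer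

section \<open>Agreement of the operations on codes with words\<close>

locale numbered_generators =
  fixes X :: "'a set" and e :: "'a \<Rightarrow> nat"
  assumes inj: "inj_on e X"
begin

lemma word_code_eq: "word_code e w = list_encode (map (letter_code e) w)"
  unfolding word_code_def letter_code_def[abs_def] ..

lemma word_code_Nil [simp]: "word_code e [] = 0"
  and word_code_Cons: "word_code e (l # w) = ccons (letter_code e l) (word_code e w)"
  by (simp_all add: word_code_eq list_encode_Cons)

lemma letter_code_eq_iff: "l \<in> X \<times> UNIV \<Longrightarrow> m \<in> X \<times> UNIV \<Longrightarrow> letter_code e l = letter_code e m \<longleftrightarrow> l = m"
proof
  assume "l \<in> X \<times> UNIV" "m \<in> X \<times> UNIV" and eq: "letter_code e l = letter_code e m"
  have "e (fst l) = e (fst m) \<and> snd l = snd m"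
    using eq unfolding letter_code_def by (cases "snd l"; cases "snd m"; simp; presburger)
  then show "l = m"
    using \<open>l \<in> X \<times> UNIV\<close> \<open>m \<in> X \<times> UNIV\<close> inj by (auto simp: prod_eq_iff inj_on_def)
qed simp

lemma word_code_eq_iff:
  assumes "set u \<subseteq> X \<times> UNIV" "set v \<subseteq> X \<times> UNIV"
  shows "word_code e u = word_code e v \<longleftrightarrow> u = v"
proof -
  have "inj_on (letter_code e) (X \<times> UNIV)" using letter_code_eq_iff by (auto simp: inj_on_def)
  then have "inj_on (letter_code e) (set u \<union> set v)" by (rule inj_on_subset) (use assms in auto)
  then show ?thesis by (simp add: word_code_eq list_encode_eq inj_on_map_eq_map)
qed

lemma cinv_letter_code: "cinv (letter_code e l) = letter_code e (inv_letter l)"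
proof -
  have "(\<exists>k<Suc (letter_code e l). k + k = letter_code e l) \<longleftrightarrow> snd l"
  proof
    assume "\<exists>k<Suc (letter_code e l). k + k = letter_code e l"
    then show "snd l" unfolding letter_code_def by (metis (full_types) add.right_neutral even_add even_mult_iff even_numeral odd_one)
  next
    assume "snd l"
    then show "\<exists>k<Suc (letter_code e l). k + k = letter_code e l"
      by (intro exI[of _ "e (fst l)"]) (auto simp: letter_code_def)
  qed
  then show ?thesis by (auto simp: cinv_def letter_code_def inv_letter_def)
qed

lemma ccancel_word_code:
  assumes "l \<in> X \<times> UNIV" "set w \<subseteq> X \<times> UNIV"
  shows "ccancel (letter_code e l) (word_code e w) = word_code e (cons_cancel l w)"
  using assms letter_code_eq_iff[of "hd w" "inv_letter l"]
  by (cases w) (auto simp: ccancel_def cinv_letter_code word_code_Cons)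

lemma clen_word_code [simp]: "clen (word_code e w) = length w"
  by (simp add: word_code_eq)

lemma cnth_word_code: "i < length w \<Longrightarrow> cnth (word_code e w) i = letter_code e (w ! i)"
  by (simp add: word_code_eq cnth_list_encode)

lemma cmult_word_code:
  assumes "set u \<subseteq> X \<times> UNIV" "set v \<subseteq> X \<times> UNIV"
  shows "cmult (word_code e u) (word_code e v) = word_code e (u \<star> v)"
proof -
  have "rec_nat (word_code e v) (\<lambda>k z. ccancel (cnth (word_code e u) (length u - Suc k)) z) k =
    word_code e (drop (length u - k) u \<star> v)" if "k \<le> length u" for k
    using that
  proof (induction k)
    case (Suc k)
    define l where "l = u ! (length u - Suc k)"
    have drop: "drop (length u - Suc k) u = l # drop (length u - k) u"
      using Suc.prems Cons_nth_drop_Suc[of "length u - Suc k" u] by (simp add: l_def Suc_diff_Suc)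
    have "l \<in> X \<times> UNIV" "set (drop (length u - k) u) \<subseteq> X \<times> UNIV"
      using assms(1) drop set_drop_subset[of "length u - Suc k" u] by auto
    then have "ccancel (letter_code e l) (word_code e (drop (length u - k) u \<star> v)) =
      word_code e (cons_cancel l (drop (length u - k) u \<star> v))"
      using assms(2) by (intro ccancel_word_code set_star)
    then show ?case using Suc drop by (simp add: cnth_word_code l_def)
  qed simp
  from this[of "length u"] show ?thesis by (simp add: cmult_def)
qed

lemma cpow_word_code:
  assumes "set u \<subseteq> X \<times> UNIV"
  shows "cpow (word_code e u) n = word_code e (wpow u n \<star> [])"
proof (induction n)
  case (Suc n)
  have "set (wpow u n \<star> []) \<subseteq> X \<times> UNIV"
    using set_wpow_subset[OF assms] by (intro set_star) auto
  with Suc show ?case using cmult_word_code[OF assms] by (simp add: cpow_def)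
qed (simp add: cpow_def)

lemma crun_word_code:
  assumes "\<And>q l. q < V \<Longrightarrow> l \<in> X \<times> UNIV \<Longrightarrow> cnth (cnth d q) (letter_code e l) = \<delta> q l \<and> \<delta> q l < V"
    and "q < V" "set w \<subseteq> X \<times> UNIV"
  shows "crun d q (word_code e w) = foldl \<delta> q w"
proof -
  have "rec_nat q (\<lambda>k z. cnth (cnth d z) (cnth (word_code e w) k)) k = foldl \<delta> q (take k w) \<and>
    foldl \<delta> q (take k w) < V" if "k \<le> length w" for k
    using that
  proof (induction k)
    case (Suc k)
    then have "w ! k \<in> X \<times> UNIV" using assms(3) nth_mem[of k w] by auto
    then show ?case using Suc assms(1) by (simp add: cnth_word_code take_Suc_conv_app_nth)
  qed (use assms(2) in simp)
  from this[of "length w"] show ?thesis by (simp add: crun_def)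
qed

end

section \<open>Derivations of elements of the isolator\<close>

text \<open>A single rule, by which a positive power of the new element is the inverse of an earlier
  element times another earlier one, covers inverses, products and roots at once and needs no
  inversion of words. The bound \<open>N\<close> on the exponents makes each step checkable by a
  bounded search.\<close>

definition derivation :: "'a set \<Rightarrow> 'a word set \<Rightarrow> nat \<Rightarrow> 'a word list \<Rightarrow> bool" where
  "derivation X S N D \<longleftrightarrow> set D \<subseteq> carrier (free_group X) \<and>
    (\<forall>i<length D. D ! i = [] \<or> D ! i \<in> S \<or>
      (\<exists>j<i. \<exists>k<i. \<exists>n<N. D ! j \<star> wpow (D ! i) (Suc n) \<star> [] = D ! k))"

lemma derivation_mono: "derivation X S N D \<Longrightarrow> N \<le> N' \<Longrightarrow> derivation X S N' D"
  unfolding derivation_def by (meson order_less_le_trans)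

lemma derivation_append:
  assumes "derivation X S N D" "derivation X S N D'"
  shows "derivation X S N (D @ D')"
  unfolding derivation_def
proof (intro conjI allI impI)
  fix i assume i: "i < length (D @ D')"
  let ?D = "D @ D'" and ?m = "length D"
  show "?D ! i = [] \<or> ?D ! i \<in> S \<or>
      (\<exists>j<i. \<exists>k<i. \<exists>n<N. ?D ! j \<star> wpow (?D ! i) (Suc n) \<star> [] = ?D ! k)"
  proof (cases "i < ?m")
    case True
    then consider "D ! i = [] \<or> D ! i \<in> S" | j k n where "j < i" "k < i" "n < N"
      "D ! j \<star> wpow (D ! i) (Suc n) \<star> [] = D ! k"
      using assms(1) unfolding derivation_def by blast
    then show ?thesis
    proof cases
      case 2
      then have "?D ! j \<star> wpow (?D ! i) (Suc n) \<star> [] = ?D ! k"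
        using True by (simp add: nth_append)
      then show ?thesis using 2 by blast
    qed (use True in \<open>auto simp: nth_append\<close>)
  next
    case False
    define i' where "i' = i - ?m"
    have i': "i' < length D'" "i = ?m + i'" using i False by (auto simp: i'_def)
    from i'(1) consider "D' ! i' = [] \<or> D' ! i' \<in> S" | j k n where "j < i'" "k < i'" "n < N"
      "D' ! j \<star> wpow (D' ! i') (Suc n) \<star> [] = D' ! k"
      using assms(2) unfolding derivation_def by blast
    then show ?thesis
    proof cases
      case 2
      then have "?D ! (?m + j) \<star> wpow (?D ! i) (Suc n) \<star> [] = ?D ! (?m + k)"
        using i' by (simp add: nth_append)
      moreover have "?m + j < i" "?m + k < i" using 2 i' by auto
      ultimately show ?thesis using 2 by blast
    qed (use i' in \<open>auto simp: nth_append\<close>)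
  qed
qed (use assms in \<open>auto simp: derivation_def\<close>)

lemma derivation_snoc:
  assumes D: "derivation X S N D" and x: "x \<in> carrier (free_group X)"
    and yz: "y \<in> set D" "z \<in> set D" "y \<star> wpow x (Suc n) \<star> [] = z" "n < N"
  shows "derivation X S N (D @ [x])"
  unfolding derivation_def
proof (intro conjI allI impI)
  fix i assume i: "i < length (D @ [x])"
  let ?D = "D @ [x]"
  show "?D ! i = [] \<or> ?D ! i \<in> S \<or>
      (\<exists>j<i. \<exists>k<i. \<exists>n<N. ?D ! j \<star> wpow (?D ! i) (Suc n) \<star> [] = ?D ! k)"
  proof (cases "i < length D")
    case True
    then consider "D ! i = [] \<or> D ! i \<in> S" | j k n where "j < i" "k < i" "n < N"
      "D ! j \<star> wpow (D ! i) (Suc n) \<star> [] = D ! k"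
      using D unfolding derivation_def by blast
    then show ?thesis
    proof cases
      case 2
      then have "?D ! j \<star> wpow (?D ! i) (Suc n) \<star> [] = ?D ! k"
        using True by (simp add: nth_append)
      then show ?thesis using 2 by blast
    qed (use True in \<open>auto simp: nth_append\<close>)
  next
    case False
    then have i: "i = length D" using i by simp
    obtain j k where "j < length D" "k < length D" "D ! j = y" "D ! k = z"
      using yz(1,2) by (auto simp: in_set_conv_nth)
    then have "j < i" "k < i" "?D ! j \<star> wpow (?D ! i) (Suc n) \<star> [] = ?D ! k"
      using yz(3) i by (auto simp: nth_append)
    then show ?thesis using yz(4) by blast
  qed
qed (use D x in \<open>auto simp: derivation_def\<close>)

text \<open>Each application of the rule exhibits a positive power of the new element inside the
  isolator.\<close>

lemma derivation_sound:
  assumes S: "S \<subseteq> carrier (free_group X)" and D: "derivation X S N D"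
  shows "set D \<subseteq> isolator (free_group X) (generate (free_group X) S)"
proof -
  let ?F = "free_group X"
  let ?I = "isolator ?F (generate ?F S)"
  have "generate ?F S \<subseteq> carrier ?F" using free_group.generate_incl[OF S] .
  then have iso: "isolated ?F ?I" by (rule free_group.isolated_isolator)
  then have sub: "subgroup ?I ?F" by (simp add: isolated_def)
  have SI: "S \<subseteq> ?I"
    using free_group.subset_isolator[of "generate ?F S"] generate.incl[of _ S ?F] by blast
  have "D ! i \<in> ?I" if "i < length D" for i
    using that
  proof (induction i rule: less_induct)
    case (less i)
    have x: "D ! i \<in> carrier ?F" using D less.prems nth_mem by (auto simp: derivation_def)
    from less.prems consider "D ! i = [] \<or> D ! i \<in> S" | j k n where "j < i" "k < i"
      "D ! j \<star> wpow (D ! i) (Suc n) \<star> [] = D ! k"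
      using D unfolding derivation_def by blast
    then show ?case
    proof cases
      case 1
      then show ?thesis using SI subgroup_free_groupD(2)[OF sub] by auto
    next
      case 2
      then have yz: "D ! j \<in> ?I" "D ! k \<in> ?I" using less by auto
      have "D ! i [^]\<^bsub>?F\<^esub> Suc n = wpow (D ! i) (Suc n) \<star> []" using wpow_star[OF x] .
      also have "\<dots> = winv (D ! j) \<star> D ! k"
        unfolding 2(3)[symmetric] by (rule star_winv_left[symmetric]) simp
      also have "\<dots> \<in> ?I" using subgroup_free_groupD(3,4)[OF sub] yz by blast
      finally show ?thesis using free_group.isolatedD[OF iso x, of "Suc n"] by simp
    qed
  qed
  then show ?thesis by (auto simp: in_set_conv_nth)
qed

text \<open>The derivable elements form an isolated subgroup containing \<open>S\<close>, hence
  contain the isolator; finitely many derivations are then concatenated into one.\<close>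

lemma derivation_complete:
  assumes S: "S \<subseteq> carrier (free_group X)"
    and C: "finite C" "C \<subseteq> isolator (free_group X) (generate (free_group X) S)"
  obtains N D where "derivation X S N D" "C \<subseteq> set D"
proof -
  let ?F = "free_group X"
  define I where "I = {x. \<exists>N D. derivation X S N D \<and> x \<in> set D}"
  have Ic: "I \<subseteq> carrier ?F" by (auto simp: I_def derivation_def)
  have both: "\<exists>N D. n < N \<and> derivation X S N D \<and> x \<in> set D \<and> y \<in> set D"
    if xy: "x \<in> I" "y \<in> I" for x y n
  proof -
    obtain N1 N2 D1 D2 where D: "derivation X S N1 D1" "x \<in> set D1" "derivation X S N2 D2" "y \<in> set D2"
      using xy by (auto simp: I_def)
    let ?N = "Suc n + N1 + N2"
    have "derivation X S ?N (D1 @ D2)"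
      by (intro derivation_append) (use D in \<open>auto elim: derivation_mono\<close>)
    then show ?thesis using D by (intro exI[of _ ?N] exI[of _ "D1 @ D2"]) auto
  qed
  have step: "x \<in> I" if "y \<in> I" "z \<in> I" "x \<in> carrier ?F" "y \<star> wpow x (Suc n) \<star> [] = z" for x y z n
    using both[OF that(1,2), of n] derivation_snoc[OF _ that(3) _ _ that(4)]
    unfolding I_def by fastforce
  have Nil: "[] \<in> I" unfolding I_def
    by (intro CollectI exI[of _ 0] exI[of _ "[[]]"]) (auto simp: derivation_def)
  have SI: "S \<subseteq> I"
  proof
    fix x assume "x \<in> S"
    then show "x \<in> I" unfolding I_def
      by (intro CollectI exI[of _ 0] exI[of _ "[x]"]) (use S in \<open>auto simp: derivation_def\<close>)
  qed
  \<comment> \<open>The instance of the rule with \<open>y = u\<close>, \<open>z = []\<close> and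
    exponent one; roots are the instances with \<open>y = []\<close>.\<close>
  have inv: "winv u \<in> I" if "u \<in> I" for u
    using that Ic star_winv_right[of "[]" u] 
    by (intro step[of u "[]" "winv u" 0] Nil winv_carrier) auto
  have sub: "subgroup I ?F"
  proof (rule subgroup_free_groupI[OF Ic Nil])
    show "u \<star> v \<in> I" if "u \<in> I" "v \<in> I" for u v
    \<comment> \<open>The instance \<open>winv u \<star> (u \<star> v) = v\<close> of the
      rule.\<close>
    proof (rule step[of "winv u" v _ 0])
      have uv: "u \<in> carrier ?F" "v \<in> carrier ?F" using that Ic by auto
      then show "u \<star> v \<in> carrier ?F" by (intro star_carrier) (auto simp: carrier_free_group)
      show "winv u \<star> wpow (u \<star> v) (Suc 0) \<star> [] = v"
        using uv star_winv_left[of v u] by (simp add: star_Nil carrier_free_group)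
    qed (use that inv in auto)
  qed (rule inv)
  have "isolated ?F I"
  proof (rule free_group.isolatedI[OF sub])
    fix g and n :: nat assume g: "g \<in> carrier ?F" "0 < n" "g [^]\<^bsub>?F\<^esub> n \<in> I"
    then obtain m where "n = Suc m" by (cases n) auto
    then show "g \<in> I" using step[OF Nil g(3) g(1), of m] wpow_star[OF g(1), of n] by simp
  qed
  moreover have "generate ?F S \<subseteq> I" using free_group.generate_subgroup_incl[OF SI sub] .
  ultimately have "C \<subseteq> I" using free_group.isolator_least C(2) by blast
  with C(1) have "\<exists>N D. derivation X S N D \<and> C \<subseteq> set D"
  proof (induction C rule: finite_induct)
    case empty
    show ?case by (intro exI[of _ 0] exI[of _ "[]"]) (auto simp: derivation_def)
  next
    case (insert x C)
    then obtain N1 D1 N2 D2 where D: "derivation X S N1 D1" "C \<subseteq> set D1" "derivation X S N2 D2" "x \<in> set D2"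
      by (auto simp: I_def)
    have "derivation X S (N1 + N2) (D1 @ D2)"
      by (intro derivation_append) (use D in \<open>auto elim: derivation_mono\<close>)
    then show ?case using D by (intro exI[of _ "N1 + N2"] exI[of _ "D1 @ D2"]) auto
  qed
  then show ?thesis using that by blast
qed


section \<open>Certificates\<close>

text \<open>Multiplying by the empty word reduces freely, so the last condition says that the coded
  word is already reduced.\<close>

definition valid_code :: "'a set \<Rightarrow> ('a \<Rightarrow> nat) \<Rightarrow> nat \<Rightarrow> bool" where
  "valid_code X e n \<longleftrightarrow>
    (\<forall>i<clen n. \<exists>l\<in>X \<times> UNIV. cnth n i = letter_code e l) \<and> cmult n 0 = n"

text \<open>The axioms of \<open>basis_graph\<close> on codes with bounded quantifiers, followed by
  distinctness of the listed basis. Membership of the basis words in the free group is left to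
  \<open>valid_code\<close>.\<close>

definition graph_check :: "'a set \<Rightarrow> ('a \<Rightarrow> nat) \<Rightarrow> nat \<Rightarrow> nat \<Rightarrow> nat \<Rightarrow> nat \<Rightarrow> bool" where
  "graph_check X e V d T B \<longleftrightarrow>
    1 < V \<and>
    (\<forall>l\<in>X \<times> UNIV. cnth (cnth d 0) (letter_code e l) = 0) \<and>
    (\<forall>q<V. \<forall>l\<in>X \<times> UNIV. cnth (cnth d q) (letter_code e l) < V) \<and>
    (\<forall>q<V. \<forall>l\<in>X \<times> UNIV. \<not> cnth (cnth d q) (letter_code e l) = 0 \<longrightarrow>
      cnth (cnth d (cnth (cnth d q) (letter_code e l))) (letter_code e (inv_letter l)) = q) \<and>
    cnth T 1 = 0 \<and>
    (\<forall>q<V. 1 < q \<longrightarrow> (\<exists>p<q. \<not> p = 0 \<and> (\<exists>l\<in>X \<times> UNIV. cnth (cnth d p) (letter_code e l) = q \<and>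
      cnth T q = cmult (cnth T p) (word_code e [l])))) \<and>
    (\<forall>q<V. \<forall>l\<in>X \<times> UNIV. \<not> cnth (cnth d q) (letter_code e l) = 0 \<longrightarrow>
      cmult (cnth T q) (word_code e [l]) = cnth T (cnth (cnth d q) (letter_code e l)) \<or>
      (\<exists>i<clen B.
        cmult (cnth T q) (word_code e [l]) = cmult (cnth B i) (cnth T (cnth (cnth d q) (letter_code e l))) \<or>
        cmult (cnth B i) (cmult (cnth T q) (word_code e [l])) = cnth T (cnth (cnth d q) (letter_code e l)))) \<and>
    (\<forall>i<clen B. \<exists>q<V. \<exists>l\<in>X \<times> UNIV. \<not> cnth (cnth d q) (letter_code e l) = 0 \<and>
      cmult (cnth T q) (word_code e [l]) = cmult (cnth B i) (cnth T (cnth (cnth d q) (letter_code e l)))) \<and>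
    (\<forall>i<clen B. \<forall>j<clen B. \<not> cmult (cnth B i) (cnth B j) = 0) \<and>
    (\<forall>i<clen B. \<forall>j<clen B. cnth B i = cnth B j \<longrightarrow> i = j)"

text \<open>
  \<open>M\<close> lists the transition maps of all words on the vertices. These maps are injective where they
  are defined, so if \<open>c\<close> moves \<open>q\<close>, then either some power of \<open>c\<close> fixes \<open>q\<close>, which contradicts
  isolation, or \<open>c ^ V\<close> is undefined at \<open>q\<close>.
\<close>

definition isolation_check :: "'a set \<Rightarrow> ('a \<Rightarrow> nat) \<Rightarrow> nat \<Rightarrow> nat \<Rightarrow> nat \<Rightarrow> bool" where
  "isolation_check X e V d M \<longleftrightarrow>
    (\<exists>k<clen M. \<forall>q<V. cnth (cnth M k) q = q) \<and>
    (\<forall>k<clen M. \<forall>l\<in>X \<times> UNIV. \<exists>j<clen M. \<forall>q<V.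
      cnth (cnth M j) q = cnth (cnth d (cnth (cnth M k) q)) (letter_code e l)) \<and>
    (\<forall>k<clen M. \<forall>q<V. cnth (cnth M k) q = q \<or> citer (cnth M k) V q = 0)"

definition derivation_check :: "'a set \<Rightarrow> ('a \<Rightarrow> nat) \<Rightarrow> nat \<Rightarrow> nat \<Rightarrow> nat \<Rightarrow> bool" where
  "derivation_check X e D N w \<longleftrightarrow>
    (\<forall>i<clen D. valid_code X e (cnth D i) \<and>
      (cnth D i = 0 \<or> (\<exists>j<clen w. cnth D i = cnth w j) \<or>
       (\<exists>j<i. \<exists>k<i. \<exists>n<N. cmult (cnth D j) (cpow (cnth D i) (Suc n)) = cnth D k)))"

definition certificate ::
    "'a set \<Rightarrow> ('a \<Rightarrow> nat) \<Rightarrow> nat \<Rightarrow> nat \<Rightarrow> nat \<Rightarrow> nat \<Rightarrow> nat \<Rightarrow> nat \<Rightarrow> nat \<Rightarrow> nat \<Rightarrow> bool" where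
  "certificate X e B V d T M D N w \<longleftrightarrow>
    (\<forall>i<clen B. valid_code X e (cnth B i)) \<and>
    (\<forall>q<V. \<not> q = 0 \<longrightarrow> valid_code X e (cnth T q)) \<and>
    graph_check X e V d T B \<and>
    (\<forall>i<clen w. crun d 1 (cnth w i) = 1) \<and>
    isolation_check X e V d M \<and>
    derivation_check X e D N w \<and>
    (\<forall>i<clen B. \<exists>j<clen D. cnth B i = cnth D j)"

section \<open>Decidability of certificates\<close>

lemma decidable_valid_code:
  assumes "finite X" "computable n f"
  shows "decidable n (\<lambda>xs. valid_code X e (f xs))"
proof (rule decidable_compose1[OF _ assms(2)])
  have "finite (X \<times> (UNIV :: bool set))" using assms(1) by simp
  then show "decidable (Suc 0) (\<lambda>xs. valid_code X e (hd xs))"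
    unfolding valid_code_def by (intro word_computable_intros decidable_bex_finite)
qed

text \<open>A candidate is one number coding the list of the seven components, so that the search
  runs over a single variable.\<close>

lemma decidable_certificate:
  assumes "finite X"
  shows "decidable (Suc (Suc 0)) (\<lambda>xs. certificate X e (cnth (hd xs) 0) (cnth (hd xs) 1)
    (cnth (hd xs) 2) (cnth (hd xs) 3) (cnth (hd xs) 4) (cnth (hd xs) 5) (cnth (hd xs) 6) (hd (tl xs)))"
proof -
  have fin: "finite (X \<times> (UNIV :: bool set))" using assms by simp
  show ?thesis
    unfolding certificate_def graph_check_def isolation_check_def derivation_check_def
    by (intro word_computable_intros decidable_valid_code[OF assms] 
        decidable_ball_finite[OF fin] decidable_bex_finite[OF fin])
qed

section \<open>Soundness and existence of certificates\<close>

context numbered_generators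
begin

lemma letters: "w \<in> carrier (free_group X) \<Longrightarrow> set w \<subseteq> X \<times> UNIV"
  by (simp add: carrier_free_group)

lemma valid_code_iff: "valid_code X e n \<longleftrightarrow> (\<exists>w\<in>carrier (free_group X). n = word_code e w)"
proof
  assume valid: "valid_code X e n"
  define ns where "ns = list_decode n"
  have n: "n = list_encode ns" by (simp add: ns_def)
  obtain L where L: "\<And>i. i < length ns \<Longrightarrow> L i \<in> X \<times> UNIV \<and> ns ! i = letter_code e (L i)"
    using valid unfolding valid_code_def n clen_list_encode by (metis cnth_list_encode)
  define w where "w = map L [0..<length ns]"
  have w: "set w \<subseteq> X \<times> UNIV" 
    unfolding w_def set_map set_upt image_subset_iff using L by simp
  have "map (letter_code e) w = ns" by (rule nth_equalityI) (use L in \<open>auto simp: w_def\<close>)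
  then have nw: "n = word_code e w" by (simp add: word_code_eq n)
  have "word_code e (w \<star> []) = word_code e w"
    using valid cmult_word_code[OF w, of "[]"] by (simp add: valid_code_def nw)
  then have "w \<star> [] = w" using word_code_eq_iff[OF set_star[OF w] w] by simp
  then have "reduced w" using reduced_star[of "[]" w] by simp
  with w nw show "\<exists>w\<in>carrier (free_group X). n = word_code e w" by (auto simp: carrier_free_group)
next
  assume "\<exists>w\<in>carrier (free_group X). n = word_code e w"
  then obtain w where w: "w \<in> carrier (free_group X)" "n = word_code e w" by auto
  have "\<exists>l\<in>X \<times> UNIV. cnth n i = letter_code e l" if "i < clen n" for i
    using letters[OF w(1)] that by (intro bexI[of _ "w ! i"]) (auto simp: w(2) cnth_word_code)
  then show "valid_code X e n"
    using cmult_word_code[OF letters[OF w(1)], of "[]"] w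
    by (simp add: valid_code_def star_Nil carrier_free_group)
qed

lemma words_code_eq: "words_code e ws = list_encode (map (word_code e) ws)"
  by (simp add: words_code_def)

lemma clen_words_code [simp]: "clen (words_code e ws) = length ws"
  by (simp add: words_code_eq)

lemma cnth_words_code: "i < length ws \<Longrightarrow> cnth (words_code e ws) i = word_code e (ws ! i)"
  by (simp add: words_code_eq cnth_list_encode)

lemma valid_codes:
  assumes "\<forall>i<clen n. valid_code X e (cnth n i)"
  obtains ws where "set ws \<subseteq> carrier (free_group X)" "n = words_code e ws"
proof -
  define ns where "ns = list_decode n"
  have n: "n = list_encode ns" by (simp add: ns_def)
  obtain W where W: "\<And>i. i < length ns \<Longrightarrow> W i \<in> carrier (free_group X) \<and> ns ! i = word_code e (W i)"
    using assms unfolding n clen_list_encode valid_code_iff by (metis cnth_list_encode)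
  have "map (word_code e) (map W [0..<length ns]) = ns"
    by (rule nth_equalityI) (use W in auto)
  then have "n = words_code e (map W [0..<length ns])" by (simp only: n words_code_eq)
  moreover have "set (map W [0..<length ns]) \<subseteq> carrier (free_group X)" using W by auto
  ultimately show ?thesis by (rule that[rotated])
qed

text \<open>Codes of words over \<open>X\<close> are injective, so equations between codes translate
  into equations between words. Tree words are given only at genuine vertices; a state with an
  outgoing edge is nonzero, so no condition constrains a tree word of state
  \<open>0\<close>.\<close>

lemma graph_check_iff:
  assumes T: "\<And>q. 0 < q \<Longrightarrow> q < V \<Longrightarrow> T' q \<in> carrier (free_group X) \<and> cnth T q = word_code e (T' q)"
    and d: "\<And>q l. q < V \<Longrightarrow> l \<in> X \<times> UNIV \<Longrightarrow> cnth (cnth d q) (letter_code e l) = \<delta> q l"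
    and bs: "set bs \<subseteq> carrier (free_group X)" "B = words_code e bs"
  shows "graph_check X e V d T B \<longleftrightarrow> basis_graph X V \<delta> T' (set bs) \<and> distinct bs"
proof -
  have Tl: "set (T' q) \<subseteq> X \<times> UNIV" if "0 < q" "q < V" for q
    using T[OF that] letters by blast
  have bl: "set (bs ! i) \<subseteq> X \<times> UNIV" if "i < length bs" for i
    using bs(1) letters nth_mem[OF that] by blast
  have sl: "set (T' q \<star> [l]) \<subseteq> X \<times> UNIV" if "0 < q" "q < V" "l \<in> X \<times> UNIV" for q l
    using Tl[OF that(1,2)] that(3) by (intro set_star) auto
  have k0: "cmult (cnth T q) (word_code e [l]) = word_code e (T' q \<star> [l])"
    if "0 < q" "q < V" "l \<in> X \<times> UNIV" for q l
    using cmult_word_code[OF Tl[OF that(1,2)], of "[l]"] T[OF that(1,2)] that by simp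
  have k1: "word_code e (T' q \<star> [l]) = cnth T r \<longleftrightarrow> T' q \<star> [l] = T' r"
    "cnth T r = word_code e (T' q \<star> [l]) \<longleftrightarrow> T' r = T' q \<star> [l]"
    if "0 < q" "q < V" "l \<in> X \<times> UNIV" "0 < r" "r < V" for q l r
    using word_code_eq_iff[OF sl Tl] T that by metis+
  have k2: "word_code e (T' q \<star> [l]) = cmult (cnth B i) (cnth T r) \<longleftrightarrow> T' q \<star> [l] = bs ! i \<star> T' r"
    if "0 < q" "q < V" "l \<in> X \<times> UNIV" "0 < r" "r < V" "i < length bs" for q l r i
    using cmult_word_code[OF bl Tl, of i r] word_code_eq_iff[OF sl set_star[OF bl Tl], of q l i r] T[of r] that
    by (simp add: bs(2) cnth_words_code)
  have k3: "cmult (cnth B i) (word_code e (T' q \<star> [l])) = cnth T r \<longleftrightarrow> bs ! i \<star> T' q \<star> [l] = T' r"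
    if "0 < q" "q < V" "l \<in> X \<times> UNIV" "0 < r" "r < V" "i < length bs" for q l r i
    using cmult_word_code[OF bl sl, of i q l] word_code_eq_iff[OF set_star[OF bl sl] Tl, of i q l r] T[of r] that
    by (simp add: bs(2) cnth_words_code)
  have k4: "cmult (cnth B i) (cnth B j) = 0 \<longleftrightarrow> bs ! i \<star> bs ! j = []"
    if "i < length bs" "j < length bs" for i j
    using cmult_word_code[OF bl bl, of i j] word_code_eq_iff[OF set_star[OF bl bl], of i j "[]"] that
    by (simp add: bs(2) cnth_words_code)
  have k5: "cnth B i = cnth B j \<longleftrightarrow> bs ! i = bs ! j" if "i < length bs" "j < length bs" for i j
    using word_code_eq_iff[OF bl bl, of i j] that by (simp add: bs(2) cnth_words_code)
  have k6: "cnth T 1 = 0 \<longleftrightarrow> T' 1 = []" if "1 < V"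
    using T[of 1] word_code_eq_iff[OF Tl, of 1 "[]"] that by simp
  have len: "clen B = length bs" by (simp add: bs(2))
  show ?thesis
  proof
    assume "graph_check X e V d T B"
    note c = this[unfolded graph_check_def len]
    have V: "1 < V" using c by blast
    have dead: "\<delta> 0 l = 0" if "l \<in> X \<times> UNIV" for l using c d[of 0 l] V that by auto
    have bounded: "\<delta> q l < V" if "q < V" "l \<in> X \<times> UNIV" for q l using c d[OF that] that by metis
    have pos: "0 < q" if "l \<in> X \<times> UNIV" "\<delta> q l \<noteq> 0" for q l using dead that by (cases q) auto
    have "basis_graph X V \<delta> T' (set bs)"
    proof
      show "\<delta> (\<delta> q l) (inv_letter l) = q" if "q < V" "l \<in> X \<times> UNIV" "\<delta> q l \<noteq> 0" for q l
        using c d[OF that(1,2)] d[OF bounded[OF that(1,2)], of "inv_letter l"] that inv_letter_mem_iff[of l X] by metis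
      show "T' 1 = []" using c k6 by blast
      show "\<exists>p<q. p \<noteq> 0 \<and> (\<exists>l\<in>X \<times> UNIV. \<delta> p l = q \<and> T' q = T' p \<star> [l])" if q: "1 < q" "q < V" for q
      proof -
        obtain p l where p: "p < q" "p \<noteq> 0" "l \<in> X \<times> UNIV" "cnth (cnth d p) (letter_code e l) = q"
          "cnth T q = cmult (cnth T p) (word_code e [l])" using c q by blast
        have "0 < p" "p < V" "0 < q" using p q by auto
        then have "\<delta> p l = q" "T' q = T' p \<star> [l]"
          using p d[of p l] k0[of p l] k1(2)[of p l q] q by auto
        then show ?thesis using p by blast
      qed
      show "T' q \<star> [l] = T' (\<delta> q l) \<or>
        (\<exists>b\<in>set bs. T' q \<star> [l] = b \<star> T' (\<delta> q l) \<or> b \<star> T' q \<star> [l] = T' (\<delta> q l))"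
        if ql: "q < V" "l \<in> X \<times> UNIV" "\<delta> q l \<noteq> 0" for q l
      proof -
        let ?r = "\<delta> q l"
        have h: "0 < q" "0 < ?r" "?r < V" using pos[OF ql(2,3)] bounded[OF ql(1,2)] ql(3) by auto
        consider "word_code e (T' q \<star> [l]) = cnth T ?r"
          | i where "i < length bs" "word_code e (T' q \<star> [l]) = cmult (cnth B i) (cnth T ?r)"
          | i where "i < length bs" "cmult (cnth B i) (word_code e (T' q \<star> [l])) = cnth T ?r"
          using c ql d[OF ql(1,2)] k0[OF h(1) ql(1,2)] by metis
        then show ?thesis
        proof cases
          case 1
          then show ?thesis using k1(1)[OF h(1) ql(1,2) h(2,3)] by blast
        next
          case (2 i)
          then show ?thesis using k2[OF h(1) ql(1,2) h(2,3)] nth_mem by blast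
        next
          case (3 i)
          then show ?thesis using k3[OF h(1) ql(1,2) h(2,3)] nth_mem by blast
        qed
      qed
      show "\<exists>q<V. \<exists>l\<in>X \<times> UNIV. \<delta> q l \<noteq> 0 \<and> T' q \<star> [l] = b \<star> T' (\<delta> q l)" if "b \<in> set bs" for b
      proof -
        obtain i where i: "i < length bs" "bs ! i = b" using \<open>b \<in> set bs\<close> by (auto simp: in_set_conv_nth)
        then obtain q l where ql: "q < V" "l \<in> X \<times> UNIV" "\<delta> q l \<noteq> 0"
          "cmult (cnth T q) (word_code e [l]) = cmult (cnth B i) (cnth T (\<delta> q l))"
          using c d by metis
        have h: "0 < q" "0 < \<delta> q l" "\<delta> q l < V" using pos[OF ql(2,3)] bounded[OF ql(1,2)] ql(3) by auto
        then show ?thesis using k0[OF h(1) ql(1,2)] k2[OF h(1) ql(1,2) h(2,3) i(1)] ql i(2) by metis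
      qed
      show "b \<star> b' \<noteq> []" if "b \<in> set bs" "b' \<in> set bs" for b b'
        using that c k4 by (metis in_set_conv_nth)
    qed (use V dead bounded bs(1) in auto)
    moreover have "distinct bs" using c k5 by (metis distinct_conv_nth)
    ultimately show "basis_graph X V \<delta> T' (set bs) \<and> distinct bs" ..
  next
    assume asm: "basis_graph X V \<delta> T' (set bs) \<and> distinct bs"
    then interpret basis_graph X V \<delta> T' "set bs" by blast
    have pos: "0 < q" if "l \<in> X \<times> UNIV" "\<delta> q l \<noteq> 0" for q l using dead that by (cases q) auto
    show "graph_check X e V d T B"
      unfolding graph_check_def len
    proof (intro conjI allI ballI impI)
      show "1 < V" by (rule V)
      show "cnth T 1 = 0" using k6[OF V] T_1 by simp
    next
      fix l assume "l \<in> X \<times> (UNIV :: bool set)"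
      then show "cnth (cnth d 0) (letter_code e l) = 0" using d[of 0 l] V dead by auto
    next
      fix q l assume ql: "q < V" "l \<in> X \<times> (UNIV :: bool set)"
      then show "cnth (cnth d q) (letter_code e l) < V" using d bounded by simp
      assume "\<not> cnth (cnth d q) (letter_code e l) = 0"
      then have alive: "\<delta> q l \<noteq> 0" using d[OF ql] by simp
      let ?r = "\<delta> q l"
      have h: "0 < q" "0 < ?r" "?r < V" using pos[OF ql(2) alive] bounded[OF ql] alive by auto
      show "cnth (cnth d (cnth (cnth d q) (letter_code e l))) (letter_code e (inv_letter l)) = q"
        using d[OF ql] d[OF h(3), of "inv_letter l"] folded[OF ql alive] ql by simp
      consider "T' q \<star> [l] = T' ?r" | i where "i < length bs" "T' q \<star> [l] = bs ! i \<star> T' ?r"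
        | i where "i < length bs" "bs ! i \<star> T' q \<star> [l] = T' ?r"
        using edge[OF ql alive] by (metis in_set_conv_nth)
      then show "cmult (cnth T q) (word_code e [l]) = cnth T (cnth (cnth d q) (letter_code e l)) \<or>
        (\<exists>i<length bs.
          cmult (cnth T q) (word_code e [l]) = cmult (cnth B i) (cnth T (cnth (cnth d q) (letter_code e l))) \<or>
          cmult (cnth B i) (cmult (cnth T q) (word_code e [l])) = cnth T (cnth (cnth d q) (letter_code e l)))"
        unfolding d[OF ql] k0[OF h(1) ql]
        using k1(1)[OF h(1) ql h(2,3)] k2[OF h(1) ql h(2,3)] k3[OF h(1) ql h(2,3)] by cases blast+
    next
      fix q assume q: "q < V" "1 < q"
      then obtain p l where p: "p < q" "p \<noteq> 0" "l \<in> X \<times> UNIV" "\<delta> p l = q" "T' q = T' p \<star> [l]"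
        using tree by blast
      have h: "0 < p" "p < V" "0 < q" using p q by auto
      have "cnth (cnth d p) (letter_code e l) = q" "cnth T q = cmult (cnth T p) (word_code e [l])"
        using d[OF h(2) p(3)] k0[OF h(1,2) p(3)] k1(2)[OF h(1,2) p(3) h(3) q(1)] p by auto
      then show "\<exists>p<q. \<not> p = 0 \<and> (\<exists>l\<in>X \<times> UNIV. cnth (cnth d p) (letter_code e l) = q \<and>
        cnth T q = cmult (cnth T p) (word_code e [l]))" using p by blast
    next
      fix i assume i: "i < length bs"
      then obtain q l where ql: "q < V" "l \<in> X \<times> UNIV" "\<delta> q l \<noteq> 0" "T' q \<star> [l] = bs ! i \<star> T' (\<delta> q l)"
        using basis_edge[OF nth_mem[OF i]] by blast
      have h: "0 < q" "0 < \<delta> q l" "\<delta> q l < V" using pos[OF ql(2,3)] bounded[OF ql(1,2)] ql(3) by auto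
      show "\<exists>q<V. \<exists>l\<in>X \<times> UNIV. \<not> cnth (cnth d q) (letter_code e l) = 0 \<and>
        cmult (cnth T q) (word_code e [l]) = cmult (cnth B i) (cnth T (cnth (cnth d q) (letter_code e l)))"
        using k0[OF h(1) ql(1,2)] k2[OF h(1) ql(1,2) h(2,3) i] ql d[OF ql(1,2)] by metis
      fix j assume j: "j < length bs"
      show "\<not> cmult (cnth B i) (cnth B j) = 0" using k4 i j indep nth_mem by blast
      show "i = j" if "cnth B i = cnth B j" using k5[OF i j] that asm i j nth_eq_iff_index_eq by blast
    qed
  qed
qed

theorem certificate_sound:
  assumes cert: "certificate X e B V d T M D N (words_code e ws)"
    and ws: "set ws \<subseteq> carrier (free_group X)"
  obtains bs where "B = words_code e bs" "distinct bs"
    "free_basis (free_group X) (isolator (free_group X) (generate (free_group X) (set ws))) (set bs)"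
proof -
  let ?F = "free_group X"
  let ?K = "generate ?F (set ws)"
  have c: "\<forall>i<clen B. valid_code X e (cnth B i)" "\<forall>q<V. q \<noteq> 0 \<longrightarrow> valid_code X e (cnth T q)"
    "graph_check X e V d T B" "\<forall>i<length ws. crun d 1 (cnth (words_code e ws) i) = 1"
    "isolation_check X e V d M" "derivation_check X e D N (words_code e ws)"
    "\<forall>i<clen B. \<exists>j<clen D. cnth B i = cnth D j"
    using cert by (simp_all add: certificate_def)
  obtain bs where bs: "set bs \<subseteq> carrier ?F" "B = words_code e bs"
    using valid_codes[OF c(1)] .
  obtain T' where T': "\<And>q. 0 < q \<Longrightarrow> q < V \<Longrightarrow> T' q \<in> carrier ?F \<and> cnth T q = word_code e (T' q)"
    using c(2) unfolding valid_code_iff by (metis neq0_conv)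
  define \<delta> where "\<delta> q l = cnth (cnth d q) (letter_code e l)" for q l
  have graph: "basis_graph X V \<delta> T' (set bs)" "distinct bs"
    using graph_check_iff[OF T' _ bs, where d = d and \<delta> = \<delta>] c(3) by (auto simp: \<delta>_def)
  interpret basis_graph X V \<delta> T' "set bs" by (rule graph(1))
  have M: "\<exists>k<clen M. \<forall>q<V. cnth (cnth M k) q = q"
    "\<And>k l. k < clen M \<Longrightarrow> l \<in> X \<times> UNIV \<Longrightarrow>
      \<exists>j<clen M. \<forall>q<V. cnth (cnth M j) q = \<delta> (cnth (cnth M k) q) l"
    "\<And>k q. k < clen M \<Longrightarrow> q < V \<Longrightarrow> cnth (cnth M k) q = q \<or> citer (cnth M k) V q = 0"
    using c(5) by (auto simp: isolation_check_def \<delta>_def)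
  \<comment> \<open>Containing the identity and closed under appending a letter, the list
    \<open>M\<close> contains the transition map of every word.\<close>
  have tables: "\<exists>k<clen M. \<forall>q<V. cnth (cnth M k) q = foldl \<delta> q c" if "set c \<subseteq> X \<times> UNIV" for c
    using that
  proof (induction c rule: rev_induct)
    case Nil
    then show ?case using M(1) by auto
  next
    case (snoc l c')
    then obtain k where k: "k < clen M" "\<forall>q<V. cnth (cnth M k) q = foldl \<delta> q c'" by auto
    have "l \<in> X \<times> UNIV" using snoc.prems by auto
    from M(2)[OF k(1) this] obtain j where 
      "j < clen M" "\<forall>q<V. cnth (cnth M j) q = \<delta> (cnth (cnth M k) q) l" by auto
    with k(2) show ?case by auto
  qed
  have isolated: "isolated ?F lang"
  proof (rule free_group.isolatedI[OF subgroup_lang])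
    fix g and n :: nat assume g: "g \<in> carrier ?F" "0 < n" "g [^]\<^bsub>?F\<^esub> n \<in> lang"
    then obtain u c' where uc: "g = u @ c' @ winv u" "foldl \<delta> 1 u \<noteq> 0"
      "foldl \<delta> (foldl \<delta> 1 u) (wpow c' n) = foldl \<delta> 1 u"
      "foldl \<delta> (foldl \<delta> 1 u) c' = foldl \<delta> 1 u \<Longrightarrow> g \<in> lang"
      using pow_in_langE[OF g] by metis
    have sub: "set u \<subseteq> X \<times> UNIV" "set c' \<subseteq> X \<times> UNIV" using letters[OF g(1)] uc(1) by auto
    define f where "f q = foldl \<delta> q c'" for q
    define q where "q = foldl \<delta> 1 u"
    have q: "q < V" "q \<noteq> 0" using run_bounded[OF V sub(1)] uc(2) by (auto simp: q_def)
    obtain k where k: "k < clen M" "\<forall>q<V. cnth (cnth M k) q = f q"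
      using tables[OF sub(2)] by (auto simp: f_def)
    have f_bound: "f r < V" if "r < V" for r using run_bounded[OF that sub(2)] by (simp add: f_def)
    have iter: "citer (cnth M k) i q = (f ^^ i) q \<and> (f ^^ i) q < V" for i
      by (induction i) (use q k f_bound in \<open>auto simp: citer_def\<close>)
    have f0: "(f ^^ i) 0 = 0" for i using run_dead[OF sub(2)] by (induction i) (auto simp: f_def)
    have "(f ^^ n) q = q" using uc(3) by (simp add: foldl_wpow f_def[abs_def] q_def)
    \<comment> \<open>The closed orbit at \<open>q\<close> is followed for \<open>n * V\<close>
      iterations, hence for at least \<open>V\<close>, so the \<open>V\<close>-th iterate cannot
      have reached the absorbing state \<open>0\<close>.\<close>
    then have "(f ^^ (n * i)) q = q" for i
      by (induction i) (simp_all add: funpow_add)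
    moreover have "V \<le> n * V" using g(2) by simp
    then have "(f ^^ (n * V)) q = (f ^^ (n * V - V)) ((f ^^ V) q)"
      using funpow_add[of "n * V - V" V f] by simp
    ultimately have "(f ^^ V) q \<noteq> 0" using f0 q(2) by metis
    then have "cnth (cnth M k) q = q"
      using M(3)[OF k(1) q(1)] iter[of V] by simp
    then show "g \<in> lang" using uc(4) k(2) q(1) by (simp add: q_def f_def)
  qed
  have "set ws \<subseteq> lang"
  proof
    fix w assume "w \<in> set ws"
    then obtain i where i: "i < length ws" "w = ws ! i" by (auto simp: in_set_conv_nth)
    have w: "w \<in> carrier ?F" using ws \<open>w \<in> set ws\<close> by auto
    have "crun d 1 (word_code e w) = 1" using c(4) i cnth_words_code[OF i(1)] by auto
    moreover have "crun d 1 (word_code e w) = foldl \<delta> 1 w"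
      by (rule crun_word_code[where V = V]) (use bounded V letters[OF w] in \<open>auto simp: \<delta>_def\<close>)
    ultimately show "w \<in> lang" using w by (simp add: lang_def)
  qed
  then have "?K \<subseteq> lang" by (rule free_group.generate_subgroup_incl[OF _ subgroup_lang])
  then have upper: "isolator ?F ?K \<subseteq> lang" using isolated by (rule free_group.isolator_least)
  obtain Ds where Ds: "set Ds \<subseteq> carrier ?F" "D = words_code e Ds"
    by (rule valid_codes[of D]) (use c(6) in \<open>simp add: derivation_check_def\<close>)
  have "derivation X (set ws) N Ds"
    unfolding derivation_def
  proof (intro conjI allI impI Ds)
    fix i assume i: "i < length Ds"
    have code: "cnth D j = word_code e (Ds ! j)" "Ds ! j \<in> carrier ?F" "set (Ds ! j) \<subseteq> X \<times> UNIV" if "j < length Ds" for j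
      using that Ds cnth_words_code letters nth_mem by blast+
    consider "word_code e (Ds ! i) = word_code e []" 
      | j where "j < length ws" "word_code e (Ds ! i) = word_code e (ws ! j)"
      | j k n where "j < i" "k < i" "n < N" "cmult (cnth D j) (cpow (cnth D i) (Suc n)) = cnth D k"
      using c(6) i code(1)[OF i] cnth_words_code[of _ ws] unfolding derivation_check_def Ds(2) clen_words_code word_code_Nil
      by metis
    then show "Ds ! i = [] \<or> Ds ! i \<in> set ws \<or>
      (\<exists>j<i. \<exists>k<i. \<exists>n<N. Ds ! j \<star> wpow (Ds ! i) (Suc n) \<star> [] = Ds ! k)"
    proof cases
      case 1
      then show ?thesis using word_code_eq_iff[OF code(3)[OF i], of "[]"] by simp
    next
      case (2 j)
      then have "Ds ! i = ws ! j"
        using word_code_eq_iff[OF code(3)[OF i], of "ws ! j"] ws letters nth_mem by blast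
      then show ?thesis using 2(1) by simp
    next
      case (3 j k n)
      have jk: "j < length Ds" "k < length Ds" using 3 i by auto
      have pow: "set (wpow (Ds ! i) (Suc n) \<star> []) \<subseteq> X \<times> UNIV"
        using set_wpow_subset[OF code(3)[OF i]] by (rule set_star) simp
      have "word_code e (Ds ! j \<star> wpow (Ds ! i) (Suc n) \<star> []) = word_code e (Ds ! k)"
        using 3(4) cmult_word_code[OF code(3)[OF jk(1)] pow] cpow_word_code[OF code(3)[OF i], of "Suc n"]
          code(1)[OF i] code(1)[OF jk(1)] code(1)[OF jk(2)] by simp
      then have "Ds ! j \<star> wpow (Ds ! i) (Suc n) \<star> [] = Ds ! k"
        using word_code_eq_iff[OF set_star[OF code(3)[OF jk(1)] pow] code(3)[OF jk(2)]] by blast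
      then show ?thesis using 3 by blast
    qed
  qed
  from derivation_sound[OF ws this] have "set Ds \<subseteq> isolator ?F ?K" .
  moreover have "set bs \<subseteq> set Ds"
  proof
    fix b assume "b \<in> set bs"
    then obtain i where i: "i < length bs" "b = bs ! i" by (auto simp: in_set_conv_nth)
    then obtain j where j: "j < length Ds" "cnth B i = cnth D j" using c(7) unfolding bs(2) Ds(2) by auto
    then have "word_code e (bs ! i) = word_code e (Ds ! j)" 
      using i cnth_words_code unfolding bs(2) Ds(2) by metis
    moreover have "set (bs ! i) \<subseteq> X \<times> UNIV" "set (Ds ! j) \<subseteq> X \<times> UNIV"
      using bs(1) Ds(1) letters nth_mem i(1) j(1) by blast+
    ultimately show "b \<in> set Ds" using word_code_eq_iff i(2) j(1) by simp
  qed
  moreover have K: "?K \<subseteq> carrier ?F" using free_group.generate_incl[OF ws] .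
  ultimately have "generate ?F (set bs) \<subseteq> isolator ?F ?K"
    using free_group.generate_subgroup_incl[OF _ free_group.subgroup_isolator[OF K], of "set bs"] by blast
  moreover have "lang = generate ?F (set bs)" using free_group.free_basis_generate[OF free_basis_lang] .
  ultimately have "isolator ?F ?K = lang" using upper by blast
  then show ?thesis using that[OF bs(2) graph(2)] free_basis_lang by simp
qed

theorem certificate_complete:
  assumes fin: "finite X" and ws: "set ws \<subseteq> carrier (free_group X)"
  obtains B V d T M D N where "certificate X e B V d T M D N (words_code e ws)"
proof -
  let ?F = "free_group X"
  let ?K = "generate ?F (set ws)"
  let ?I = "isolator ?F ?K"
  let ?L = "X \<times> (UNIV :: bool set)"
  have K: "?K \<subseteq> carrier ?F" using free_group.generate_incl[OF ws] .
  have iso: "isolated ?F ?I" using free_group.isolated_isolator[OF K] .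
  have sub: "subgroup ?I ?F" using iso by (simp add: isolated_def)
  have KI: "?K \<subseteq> ?I" by (rule free_group.subset_isolator)
  have wsI: "set ws \<subseteq> ?I" using KI generate.incl[of _ "set ws" ?F] by blast
  have "\<exists>V \<delta> T B. basis_graph X V \<delta> T B \<and> folded_graph.lang X \<delta> = ?I \<and> finite B \<and>
    (isolated ?F ?I \<longrightarrow> (\<forall>c q. set c \<subseteq> ?L \<longrightarrow> 0 < q \<longrightarrow> q < V \<longrightarrow>
      foldl \<delta> q c = q \<or> ((\<lambda>q. foldl \<delta> q c) ^^ V) q = 0))"
  proof (rule ex_finite_basis_graph[OF fin sub wsI])
    fix L assume L: "subgroup L ?F" "L \<subseteq> ?I" "set ws \<subseteq> L"
      and roots: "\<And>w n. w \<in> ?I \<Longrightarrow> 0 < (n::nat) \<Longrightarrow> w [^]\<^bsub>?F\<^esub> n \<in> L \<Longrightarrow> w \<in> L"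
    have "isolated ?F L"
    proof (rule free_group.isolatedI[OF L(1)])
      fix g and n :: nat assume g: "g \<in> carrier ?F" "0 < n" "g [^]\<^bsub>?F\<^esub> n \<in> L"
      then have "g \<in> ?I" using free_group.isolatedD[OF iso g(1,2)] L(2) by blast
      then show "g \<in> L" using roots g by blast
    qed
    then show "?I \<subseteq> L"
      using free_group.isolator_least free_group.generate_subgroup_incl[OF L(3,1)] by blast
  qed
  then obtain V \<delta> T Bs where
    graph: "basis_graph X V \<delta> T Bs" "folded_graph.lang X \<delta> = ?I" "finite Bs" and
    dead_or_fixed: "\<And>c q. set c \<subseteq> ?L \<Longrightarrow> 0 < q \<Longrightarrow> q < V \<Longrightarrow>
      foldl \<delta> q c = q \<or> ((\<lambda>q. foldl \<delta> q c) ^^ V) q = 0"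
    using iso by blast
  interpret basis_graph X V \<delta> T Bs by (rule graph(1))
  obtain bs where bs: "set bs = Bs" "distinct bs" using finite_distinct_list[OF graph(3)] by auto
  define B where "B = words_code e bs"
  define Tc where "Tc = list_encode (map (\<lambda>q. word_code e (T q)) [0..<V])"
  have Tc: "T q \<in> carrier ?F \<and> cnth Tc q = word_code e (T q)" if "0 < q" "q < V" for q
    using tree_word[OF that] that by (simp add: Tc_def cnth_list_encode)
  \<comment> \<open>An exclusive bound for all letter codes, so that every row of the transition
    table is long enough to be read at each letter.\<close>
  define A where "A = Suc (\<Sum>l\<in>?L. letter_code e l)"
  have A: "letter_code e l < A" if "l \<in> ?L" for l
    using member_le_sum[OF that, of "letter_code e"] fin by (simp add: A_def less_Suc_eq_le)
  \<comment> \<open>Column \<open>a\<close> belongs to the letter with code \<open>a\<close>,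
    recovered by \<open>inv_into\<close> because the codes are injective.\<close>
  define d where "d = list_encode (map (\<lambda>q. list_encode (map (\<lambda>a. \<delta> q (inv_into ?L (letter_code e) a)) [0..<A])) [0..<V])"
  have inj_code: "inj_on (letter_code e) ?L" using letter_code_eq_iff by (auto simp: inj_on_def)
  have d: "cnth (cnth d q) (letter_code e l) = \<delta> q l" if "q < V" "l \<in> ?L" for q l
    using that A[OF that(2)] inv_into_f_f[OF inj_code that(2)] by (simp add: d_def cnth_list_encode)
  have graph_check: "graph_check X e V d Tc B"
    using graph_check_iff[OF Tc d, where bs = bs and B = B] graph(1) bs B_carrier by (simp add: B_def)
  \<comment> \<open>However many words there are, they induce only finitely many maps on the states
    below \<open>V\<close>, so all of these maps can be listed.\<close>
  define tables where "tables = {list_encode (map (\<lambda>q. foldl \<delta> q c) [0..<V]) |c. set c \<subseteq> ?L}"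
  have "tables \<subseteq> list_encode ` {qs. set qs \<subseteq> {..<V} \<and> length qs = V}"
    using run_bounded by (auto simp: tables_def intro!: imageI)
  then have "finite tables" by (rule finite_subset) (intro finite_imageI finite_lists_length_eq finite_lessThan)
  then obtain ms where ms: "set ms = tables" using finite_list by blast
  define M where "M = list_encode ms"
  have lenM: "clen M = length ms" by (simp add: M_def)
  have table: "\<exists>c. set c \<subseteq> ?L \<and> (\<forall>q<V. cnth (cnth M k) q = foldl \<delta> q c)" if "k < length ms" for k
  proof -
    have "ms ! k \<in> tables" using that ms nth_mem by blast
    then obtain c where "set c \<subseteq> ?L" "ms ! k = list_encode (map (\<lambda>q. foldl \<delta> q c) [0..<V])"
      by (auto simp: tables_def)
    then show ?thesis using that by (intro exI[of _ c]) (auto simp: M_def cnth_list_encode)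
  qed
  have index: "\<exists>k<length ms. \<forall>q<V. cnth (cnth M k) q = foldl \<delta> q c" if "set c \<subseteq> ?L" for c
  proof -
    have "list_encode (map (\<lambda>q. foldl \<delta> q c) [0..<V]) \<in> set ms" using that ms by (auto simp: tables_def)
    then obtain k where "k < length ms" "ms ! k = list_encode (map (\<lambda>q. foldl \<delta> q c) [0..<V])"
      by (auto simp: in_set_conv_nth)
    then show ?thesis by (intro exI[of _ k]) (auto simp: M_def cnth_list_encode)
  qed
  have isolation_check: "isolation_check X e V d M"
    unfolding isolation_check_def lenM
  proof (intro conjI allI impI ballI)
    show "\<exists>k<length ms. \<forall>q<V. cnth (cnth M k) q = q" using index[of "[]"] by simp
  next
    fix k l assume k: "k < length ms" and l: "l \<in> ?L"
    obtain c where c: "set c \<subseteq> ?L" "\<forall>q<V. cnth (cnth M k) q = foldl \<delta> q c" using table[OF k] by auto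
    then have "set (c @ [l]) \<subseteq> ?L" using l by auto
    from index[OF this] obtain j where j: "j < length ms" "\<forall>q<V. cnth (cnth M j) q = foldl \<delta> q (c @ [l])"
      by auto
    have "cnth (cnth M j) q = cnth (cnth d (cnth (cnth M k) q)) (letter_code e l)" if "q < V" for q
      using j(2) c(2) d[OF run_bounded[OF that c(1)] l] that by simp
    with j(1) show "\<exists>j<length ms. \<forall>q<V. cnth (cnth M j) q = cnth (cnth d (cnth (cnth M k) q)) (letter_code e l)"
      by blast
  next
    fix k q assume k: "k < length ms" and q: "q < V"
    obtain c where c: "set c \<subseteq> ?L" "\<forall>q<V. cnth (cnth M k) q = foldl \<delta> q c" using table[OF k] by auto
    have iter: "citer (cnth M k) i q = ((\<lambda>q. foldl \<delta> q c) ^^ i) q \<and> citer (cnth M k) i q < V" for i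
      by (induction i) (use q c run_bounded in \<open>auto simp: citer_def\<close>)
    show "cnth (cnth M k) q = q \<or> citer (cnth M k) V q = 0"
    proof (cases "q = 0")
      case True
      then show ?thesis using c q run_dead[OF c(1)] by simp
    next
      case False
      then show ?thesis using dead_or_fixed[OF c(1), of q] c(2) q iter[of V] by simp
    qed
  qed
  have run: "crun d 1 (cnth (words_code e ws) i) = 1" if "i < length ws" for i
  proof -
    have "ws ! i \<in> lang" using wsI graph(2) that nth_mem by blast
    then show ?thesis
      using crun_word_code[where V = V and d = d and \<delta> = \<delta> and q = 1 and w = "ws ! i"] d bounded V langD[of "ws ! i"] that by (simp add: cnth_words_code)
  qed
  have "Bs \<subseteq> ?I" using basis_lang(1) graph(2) by blast
  from derivation_complete[OF ws graph(3) this] obtain N Ds where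
    Ds: "derivation X (set ws) N Ds" "Bs \<subseteq> set Ds" by blast
  have Dsc: "set Ds \<subseteq> carrier ?F" using Ds(1) by (simp add: derivation_def)
  define D where "D = words_code e Ds"
  have D: "cnth D i = word_code e (Ds ! i)" "Ds ! i \<in> carrier ?F" "set (Ds ! i) \<subseteq> ?L" if "i < length Ds" for i
    using that Dsc letters nth_mem cnth_words_code unfolding D_def by blast+
  have lenD: "clen D = length Ds" by (simp add: D_def)
  have derivation_check: "derivation_check X e D N (words_code e ws)"
    unfolding derivation_check_def lenD
  proof (intro allI impI conjI)
    fix i assume i: "i < length Ds"
    show "valid_code X e (cnth D i)" using D[OF i] by (auto simp: valid_code_iff)
    consider "Ds ! i = []" | "Ds ! i \<in> set ws" | j k n where "j < i" "k < i" "n < N"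
      "Ds ! j \<star> wpow (Ds ! i) (Suc n) \<star> [] = Ds ! k"
      using Ds(1) i unfolding derivation_def by blast
    then show "cnth D i = 0 \<or> (\<exists>j<clen (words_code e ws). cnth D i = cnth (words_code e ws) j) \<or>
       (\<exists>j<i. \<exists>k<i. \<exists>n<N. cmult (cnth D j) (cpow (cnth D i) (Suc n)) = cnth D k)"
    proof cases
      case 1
      then show ?thesis using D[OF i] by simp
    next
      case 2
      then obtain j where "j < length ws" "Ds ! i = ws ! j" by (auto simp: in_set_conv_nth)
      then have "j < clen (words_code e ws)" "cnth D i = cnth (words_code e ws) j"
        using D[OF i] by (auto simp: cnth_words_code)
      then show ?thesis by blast
    next
      case (3 j k n)
      have jk: "j < length Ds" "k < length Ds" using 3 i by auto
      have pow: "set (wpow (Ds ! i) (Suc n) \<star> []) \<subseteq> ?L"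
        using set_wpow_subset[OF D(3)[OF i]] by (rule set_star) simp
      have "cmult (cnth D j) (cpow (cnth D i) (Suc n)) = cnth D k"
        using cmult_word_code[OF D(3)[OF jk(1)] pow] cpow_word_code[OF D(3)[OF i], of "Suc n"]
          D(1)[OF i] D(1)[OF jk(1)] D(1)[OF jk(2)] 3(4) by simp
      then show ?thesis using 3 by blast
    qed
  qed
  have "\<exists>j<length Ds. cnth B i = cnth D j" if "i < length bs" for i
  proof -
    have "bs ! i \<in> set Ds" using that bs(1) Ds(2) nth_mem by blast
    then obtain j where "j < length Ds" "Ds ! j = bs ! i" by (auto simp: in_set_conv_nth)
    then show ?thesis using that D(1) by (intro exI[of _ j]) (simp add: B_def cnth_words_code)
  qed
  moreover have "valid_code X e (cnth B i)" if "i < length bs" for i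
    using that bs(1) B_carrier nth_mem[OF that] unfolding valid_code_iff B_def by (auto simp: cnth_words_code)
  moreover have "valid_code X e (cnth Tc q)" if "q < V" "q \<noteq> 0" for q
    using Tc[of q] that unfolding valid_code_iff by auto
  ultimately have "certificate X e B V d Tc M D N (words_code e ws)"
    using graph_check isolation_check run derivation_check
    by (simp add: certificate_def lenD B_def)
  then show ?thesis by (rule that)
qed

text \<open>The program searches for the least number that codes a certificate for the input and
  outputs its component \<open>0\<close>, the basis. Soundness applies to whichever certificate is
  found; existence makes the search halt.\<close>

theorem isolator_algorithm:
  assumes fin: "finite X"
  shows "\<exists>p. \<forall>ws. set ws \<subseteq> carrier (free_group X) \<longrightarrow>
    (\<exists>bs. computes p [words_code e ws] (words_code e bs) \<and> distinct bs \<and>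
      free_basis (free_group X) (isolator (free_group X) (generate (free_group X) (set ws))) (set bs))"
proof -
  define P where "P k xs \<longleftrightarrow> certificate X e (cnth k 0) (cnth k 1) (cnth k 2) (cnth k 3) (cnth k 4)
    (cnth k 5) (cnth k 6) (hd xs)" for k xs
  have "decidable (Suc (Suc 0)) (\<lambda>ys. P (hd ys) (tl ys))"
    unfolding P_def by (rule decidable_certificate[OF fin])
  then obtain p where p: "\<And>xs. length xs = Suc 0 \<Longrightarrow> \<exists>k. P k xs \<Longrightarrow> computes p xs (LEAST k. P k xs)"
    using unbounded_search by blast
  have "computable (Suc 0) (\<lambda>xs. cnth (hd xs) 0)" by (intro computable_intros)
  then obtain out where out: "\<And>x. computes out [x] (cnth x 0)"
    unfolding computable_def by (metis length_Cons list.sel(1) list.size(3))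
  have "\<exists>bs. computes (Comp out [p]) [words_code e ws] (words_code e bs) \<and> distinct bs \<and>
      free_basis (free_group X) (isolator (free_group X) (generate (free_group X) (set ws))) (set bs)"
    if ws: "set ws \<subseteq> carrier (free_group X)" for ws
  proof -
    define k where "k = (LEAST k. P k [words_code e ws])"
    obtain B V d T M D N where cert: "certificate X e B V d T M D N (words_code e ws)"
      using certificate_complete[OF fin ws] by blast
    have "P (list_encode [B, V, d, T, M, D, N]) [words_code e ws]"
      using cert by (simp add: P_def cnth_list_encode)
    then have ex: "\<exists>k. P k [words_code e ws]" by blast
    then have "P k [words_code e ws]" unfolding k_def by (rule LeastI_ex)
    note sound = certificate_sound[OF this[unfolded P_def list.sel(1)] ws]
    obtain bs where bs: "cnth k 0 = words_code e bs" "distinct bs"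
      "free_basis (free_group X) (isolator (free_group X) (generate (free_group X) (set ws))) (set bs)"
      by (rule sound)
    have "computes (Comp out [p]) [words_code e ws] (cnth k 0)"
      by (rule computes_Comp[of "[k]"]) (use p ex out in \<open>auto simp: k_def\<close>)
    then show ?thesis using bs by auto
  qed
  then show ?thesis by blast
qed

end


section \<open>The isolator\<close>

text \<open>Every subgroup containing the generators contains
  \<open>generate (free_group X) S\<close>, so the part of its coset graph traversed by them already
  yields a finite basis.\<close>

lemma fin_gen_free_basis:
  assumes "finite X" "finite S" "S \<subseteq> carrier (free_group X)"
  shows "\<exists>B. finite B \<and> free_basis (free_group X) (generate (free_group X) S) B"
proof -
  obtain ws where ws: "set ws = S" using finite_list[OF assms(2)] by auto
  let ?K = "generate (free_group X) S"
  have sub: "subgroup ?K (free_group X)" using free_group.generate_is_subgroup[OF assms(3)] .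
  have "set ws \<subseteq> ?K" using ws generate.incl[of _ S "free_group X"] by auto
  then obtain V \<delta> T B where graph: "basis_graph X V \<delta> T B" "folded_graph.lang X \<delta> = ?K" "finite B"
    using ex_finite_basis_graph[OF assms(1) sub, of ws] free_group.generate_subgroup_incl[of S] ws by blast
  then show ?thesis using basis_graph.free_basis_lang[OF graph(1)] by auto
qed

text \<open>The basis is the output of the algorithm, run with an arbitrary numbering of the finite
  set of generators.\<close>

lemma isolator_free_basis:
  assumes "finite X" "finite S" "S \<subseteq> carrier (free_group X)"
  shows "\<exists>B. finite B \<and> free_basis (free_group X) (isolator (free_group X) (generate (free_group X) S)) B"
proof -
  obtain ws where ws: "set ws = S" using finite_list[OF assms(2)] by auto
  obtain e :: "'a \<Rightarrow> nat" where "inj_on e X" using assms(1) finite_imp_inj_to_nat_seg by metis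
  then interpret numbered_generators X e by unfold_locales
  show ?thesis using isolator_algorithm[OF assms(1)] assms(3) ws by (metis List.finite_set)
qed

theorem theorem13p9:
  fixes X :: "'a set"
  assumes "finite X"
  shows
    "(\<forall>K. fin_gen_subgroup (free_group X) K \<longrightarrow>
        (\<exists>!M. minimal_isolated_algebraic (free_group X) K M) \<and>
        (\<forall>M. minimal_isolated_algebraic (free_group X) K M \<longrightarrow> isolator (free_group X) K = M) \<and>
        fin_gen_subgroup (free_group X) (isolator (free_group X) K) \<and>
        algebraic_extension (free_group X) K (isolator (free_group X) K) \<and>
        rk (free_group X) (isolator (free_group X) K) \<le> rk (free_group X) K) \<and>
     (\<forall>e :: 'a \<Rightarrow> nat. inj_on e X \<longrightarrow>
        (\<exists>p. \<forall>ws. set ws \<subseteq> carrier (free_group X) \<longrightarrow>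
           (\<exists>bs. computes p [words_code e ws] (words_code e bs) \<and>
                 distinct bs \<and>
                 free_basis (free_group X)
                   (isolator (free_group X) (generate (free_group X) (set ws))) (set bs))))"
proof (intro conjI allI impI)
  fix K assume "fin_gen_subgroup (free_group X) K"
  then obtain S where S: "finite S" "S \<subseteq> carrier (free_group X)" "K = generate (free_group X) S"
    by (auto simp: fin_gen_subgroup_def)
  let ?I = "isolator (free_group X) K"
  have K: "subgroup K (free_group X)" unfolding S(3) using free_group.generate_is_subgroup[OF S(2)] .
  have tf: "group.torsion_free (free_group X)"
    using free_group_torsion_free by (auto simp: free_group.torsion_free_def)
  note iff = free_group.minimal_isolated_algebraic_iff[OF K tf]
  show "\<exists>!M. minimal_isolated_algebraic (free_group X) K M" unfolding iff by simp
  show "?I = M" if "minimal_isolated_algebraic (free_group X) K M" for M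
    using that unfolding iff by simp
  show "algebraic_extension (free_group X) K ?I"
    using free_group.algebraic_extension_isolator[OF K tf] .
  obtain B where B: "finite B" "free_basis (free_group X) ?I B"
    using isolator_free_basis[OF assms S(1,2)] S(3) by auto
  obtain C where C: "finite C" "free_basis (free_group X) K C"
    using fin_gen_free_basis[OF assms S(1,2)] S(3) by auto
  have "B \<subseteq> carrier (free_group X)" 
    using B(2) subgroup.subset unfolding free_basis_def by blast
  then show "fin_gen_subgroup (free_group X) ?I"
    using B free_group.free_basis_generate[OF B(2)] by (auto simp: fin_gen_subgroup_def)
  show "rk (free_group X) ?I \<le> rk (free_group X) K"
    using free_group.rank_isolator_le[OF B(2,1) C(2,1)] free_group.rk_eq_card B C by metis
next
  fix e :: "'a \<Rightarrow> nat" assume "inj_on e X"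
  then interpret numbered_generators X e by unfold_locales
  show "\<exists>p. \<forall>ws. set ws \<subseteq> carrier (free_group X) \<longrightarrow>
           (\<exists>bs. computes p [words_code e ws] (words_code e bs) \<and>
                 distinct bs \<and>
                 free_basis (free_group X)
                   (isolator (free_group X) (generate (free_group X) (set ws))) (set bs))"
    by (rule isolator_algorithm[OF assms])
qed

end
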